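(* Let $n\ge 1$ be an integer, $g_0\ge 0$, $g_1\ge 0$, $\omega>0$, and let $\mathrm{C}$ stand for $\mathrm{A}$ or $\mathrm{B}$. Let $p^{\mathrm{A}}_\lambda$ and $p^{\mathrm{B}}_\lambda$ ($\lambda\in\Lambda$) be the multivariable Hermite (type A) and Laguerre (type B) polynomials. Then for all $\lambda,\mu\in\Lambda$ with $\lambda\neq\mu$ (not necessarily comparable in the partial order on $\Lambda$), $$\langle p_\lambda^{\mathrm{C}},p_\mu^{\mathrm{C}}\rangle_{\mathrm{C}}=\int_{-\infty}^{\infty}\cdots\int_{-\infty}^{\infty}p_\lambda^{\mathrm{C}}(x)\,\overline{p_\mu^{\mathrm{C}}(x)}\,\Delta^{\mathrm{C}}(x)\,dx_1\cdots dx_n=0 .$$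
   Context: Weight functions on $\mathbb{R}^n$: $$\Delta^{\mathrm{A}}(x)=\prod_{1\le j<k\le n}|x_j-x_k|^{2g_0}\prod_{1\le j\le n}e^{-\omega x_j^2},$$ $$\Delta^{\mathrm{B}}(x)=\prod_{1\le j<k\le n}|(x_j-x_k)(x_j+x_k)|^{2g_0}\prod_{1\le j\le n}|x_j|^{2g_1}e^{-\omega x_j^2}.$$ For $\mathrm{C}\in\{\mathrm{A},\mathrm{B}\}$, $\langle f,g\rangle_{\mathrm{C}}=\int_{\mathbb{R}^n}f(x)\overline{g(x)}\,\Delta^{\mathrm{C}}(x)\,dx_1\cdots dx_n$. $\Lambda=\{\lambda\in\mathbb{Z}^n\mid\lambda_1\ge\lambda_2\ge\cdots\ge\lambda_n\ge 0\}$, partially ordered by: $\lambda\le\mu$ iff $\sum_{j=1}^k\lambda_j\le\sum_{j=1}^k\mu_j$ for all $k=1,\dots,n$ (equality of the total sums is not required); $\lambda<\mu$ means $\lambda\le\mu$ and $\lambda\ne\mu$. Symmetric monomials: $m_\lambda(x)=\sum_{\mu\in S_n(\lambda)}x_1^{\mu_1}\cdots x_n^{\mu_n}$, the sum being over the orbit of $\lambda$ under permutation of its components; $m_{2\lambda}(x)=\sum_{\mu\in S_n(\lambda)}x_1^{2\mu_1}\cdots x_n^{2\mu_n}$. $p_\lambda^{\mathrm{A}}$ is the unique polynomial of the form $m_\lambda+\sum_{\mu\in\Lambda,\,\mu<\lambda}c^{\mathrm{A}}_{\lambda,\mu}m_\mu$ with $c^{\mathrm{A}}_{\lambda,\mu}\in\mathbb{C}$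 such that $\langle p^{\mathrm{A}}_\lambda,m_\mu\rangle_{\mathrm{A}}=0$ for all $\mu\in\Lambda$ with $\mu<\lambda$. $p_\lambda^{\mathrm{B}}$ is the unique polynomial of the form $m_{2\lambda}+\sum_{\mu\in\Lambda,\,\mu<\lambda}c^{\mathrm{B}}_{\lambda,\mu}m_{2\mu}$ with $c^{\mathrm{B}}_{\lambda,\mu}\in\mathbb{C}$ such that $\langle p^{\mathrm{B}}_\lambda,m_{2\mu}\rangle_{\mathrm{B}}=0$ for all $\mu\in\Lambda$ with $\mu<\lambda$. *)

theory Defs
  imports "HOL-Analysis.Analysis" "HOL-Combinatorics.Permutations"
begin

(* A point of R^n is a function x :: nat => real of which only the components
   x 1, ..., x n matter; n-tuples of nonnegative integers are functions nat => nat
   that vanish outside {1..n}, so that equality of tuples is equality of functions. *)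

datatype wtype = TypeA | TypeB

(* Note 0 powr 0 = 0: for g0 = 0 (resp. g1 = 0) the factors below differ from the
   convention 0^0 = 1, but only on the hyperplanes x j = x k, x j = - x k
   (resp. x j = 0). These are Lebesgue null sets, so no integral is affected. *)
fun weight :: "wtype \<Rightarrow> nat \<Rightarrow> real \<Rightarrow> real \<Rightarrow> real \<Rightarrow> (nat \<Rightarrow> real) \<Rightarrow> real" where
  "weight TypeA n g0 g1 \<omega> x =
     (\<Prod>k\<in>{1..n}. \<Prod>j\<in>{1..<k}. \<bar>x j - x k\<bar> powr (2 * g0)) *
     (\<Prod>j\<in>{1..n}. exp (- \<omega> * (x j)\<^sup>2))"
| "weight TypeB n g0 g1 \<omega> x =
     (\<Prod>k\<in>{1..n}. \<Prod>j\<in>{1..<k}. \<bar>(x j - x k) * (x j + x k)\<bar> powr (2 * g0)) *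
     (\<Prod>j\<in>{1..n}. \<bar>x j\<bar> powr (2 * g1) * exp (- \<omega> * (x j)\<^sup>2))"

definition inner_prod ::
    "wtype \<Rightarrow> nat \<Rightarrow> real \<Rightarrow> real \<Rightarrow> real \<Rightarrow>
     ((nat \<Rightarrow> real) \<Rightarrow> complex) \<Rightarrow> ((nat \<Rightarrow> real) \<Rightarrow> complex) \<Rightarrow> complex" where
  "inner_prod C n g0 g1 \<omega> f g =
     (LINT x | (\<Pi>\<^sub>M j\<in>{1..n}. (lborel :: real measure)).
        f x * cnj (g x) * complex_of_real (weight C n g0 g1 \<omega> x))"

definition partitions :: "nat \<Rightarrow> (nat \<Rightarrow> nat) set" where
  "partitions n = {\<nu>. (\<forall>j k. 1 \<le> j \<and> j \<le> k \<and> k \<le> n \<longrightarrow> \<nu> k \<le> \<nu> j) \<and> (\<forall>j. j \<notin> {1..n} \<longrightarrow> \<nu> j = 0)}"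

definition dom_le :: "nat \<Rightarrow> (nat \<Rightarrow> nat) \<Rightarrow> (nat \<Rightarrow> nat) \<Rightarrow> bool" where
  "dom_le n \<nu> \<mu> \<longleftrightarrow> (\<forall>k\<in>{1..n}. (\<Sum>j=1..k. \<nu> j) \<le> (\<Sum>j=1..k. \<mu> j))"

definition dom_less :: "nat \<Rightarrow> (nat \<Rightarrow> nat) \<Rightarrow> (nat \<Rightarrow> nat) \<Rightarrow> bool" where
  "dom_less n \<nu> \<mu> \<longleftrightarrow> dom_le n \<nu> \<mu> \<and> \<nu> \<noteq> \<mu>"

definition orbit_Sn :: "nat \<Rightarrow> (nat \<Rightarrow> nat) \<Rightarrow> (nat \<Rightarrow> nat) set" where
  "orbit_Sn n \<nu> = {\<nu> \<circ> \<sigma> | \<sigma>. \<sigma> permutes {1..n}}"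

fun sym_mono :: "wtype \<Rightarrow> nat \<Rightarrow> (nat \<Rightarrow> nat) \<Rightarrow> (nat \<Rightarrow> real) \<Rightarrow> complex" where
  "sym_mono TypeA n \<nu> x = complex_of_real (\<Sum>\<mu>\<in>orbit_Sn n \<nu>. \<Prod>j\<in>{1..n}. x j ^ \<mu> j)"
| "sym_mono TypeB n \<nu> x = complex_of_real (\<Sum>\<mu>\<in>orbit_Sn n \<nu>. \<Prod>j\<in>{1..n}. x j ^ (2 * \<mu> j))"

(* Polynomials are identified with polynomial functions. *)
definition is_hermite_laguerre ::
    "wtype \<Rightarrow> nat \<Rightarrow> real \<Rightarrow> real \<Rightarrow> real \<Rightarrow> (nat \<Rightarrow> nat) \<Rightarrow> ((nat \<Rightarrow> real) \<Rightarrow> complex) \<Rightarrow> bool" where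
  "is_hermite_laguerre C n g0 g1 \<omega> \<nu> p \<longleftrightarrow>
     (\<exists>c :: (nat \<Rightarrow> nat) \<Rightarrow> complex.
        p = (\<lambda>x. sym_mono C n \<nu> x +
                 (\<Sum>\<mu>\<in>{\<mu>\<in>partitions n. dom_less n \<mu> \<nu>}. c \<mu> * sym_mono C n \<mu> x))) \<and>
     (\<forall>\<mu>\<in>partitions n. dom_less n \<mu> \<nu> \<longrightarrow> inner_prod C n g0 g1 \<omega> p (sym_mono C n \<mu>) = 0)"

definition hermite_laguerre ::
    "wtype \<Rightarrow> nat \<Rightarrow> real \<Rightarrow> real \<Rightarrow> real \<Rightarrow> (nat \<Rightarrow> nat) \<Rightarrow> (nat \<Rightarrow> real) \<Rightarrow> complex" where
  "hermite_laguerre C n g0 g1 \<omega> \<nu> = (THE p. is_hermite_laguerre C n g0 g1 \<omega> \<nu> p)"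

(* The index sets of the sums above are finite, so these sums are genuine. *)

lemma finite_orbit_Sn: "finite (orbit_Sn n \<nu>)"
proof -
  have "orbit_Sn n \<nu> = (\<lambda>\<sigma>. \<nu> \<circ> \<sigma>) ` {\<sigma>. \<sigma> permutes {1..n}}"
    by (auto simp: orbit_Sn_def)
  then show ?thesis
    by (simp add: finite_permutations)
qed

lemma finite_dom_less: "finite {\<mu>\<in>partitions n. dom_less n \<mu> \<nu>}"
proof -
  have "\<mu> j \<le> (\<Sum>i=1..n. \<nu> i)" if "dom_less n \<mu> \<nu>" "j \<in> {1..n}" for \<mu> j
  proof -
    have "\<mu> j \<le> (\<Sum>i=1..n. \<mu> i)"
      using that(2) by (intro member_le_sum) auto
    also have "\<dots> \<le> (\<Sum>i=1..n. \<nu> i)"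
      using that by (auto simp: dom_less_def dom_le_def)
    finally show ?thesis .
  qed
  then have "{\<mu>\<in>partitions n. dom_less n \<mu> \<nu>} \<subseteq>
      {f. \<forall>i. (i \<in> {1..n} \<longrightarrow> f i \<in> {..(\<Sum>i=1..n. \<nu> i)}) \<and> (i \<notin> {1..n} \<longrightarrow> f i = 0)}"
    by (auto simp: partitions_def)
  then show ?thesis
    by (rule finite_subset) (rule finite_set_of_finite_funs; simp)
qed

end

theory Submission
  imports Defs "HOL-Probability.Distributions" "HOL-Real_Asymp.Real_Asymp"
begin

text \<open>
  In the variables y = x (type A) or y j = (x j)^2 (type B) both pairings have the form
  (f, h) |-> L (f h). Let D_j be the type A Dunkl operator in y. Integration by parts gives
  L (D_j ((a + b y_j) f)) = L ((y_j + s) f) with constants a, b, s depending on the type; hence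
  xi_j = (y_j + s) D_j - D_j (a + b y_j) D_j + g * sum_(k < j) s_jk is symmetric for the pairing.
  Modulo monomials whose sorted exponent is strictly smaller, xi_j maps y^u to e_j(u) y^u plus
  monomials obtained by moving a larger entry of u to a smaller index, and since g >= 0 the vector
  (e_j(u))_j determines u. Subtracting from y^u its projection onto the smaller monomials yields
  polynomials on which xi_j acts by the same triangular formula without remainder, so an induction
  makes any two of them with different sorted exponents orthogonal. The polynomial of index l is,
  up to a null vector, the sum of these over the orbit of l. Neither commutativity of the xi_j nor
  comparability of the indices enters.
\<close>

text \<open>The defining conditions see only smaller indices, so incomparable pairs must be
  separated by symmetric operators. Nonsymmetric polynomials are used because there the operators
  are explicit on monomials: (y_j + s) D_j - D_j (a + b y_j) D_j has the Dirichlet form L ((a + b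
  y_j) D_j f D_j h), and adding the ordered sum over k < j, as for Cherednik operators, makes its
  leading part triangular without destroying symmetry. The remainder of the triangular formula on a
  projected monomial lies in the span of the smaller monomials; by symmetry it is also orthogonal to
  that span, so its norm is zero. At this stage L is known only to be semidefinite, hence such
  remainders are discarded by pairing with test polynomials. The analytic obstacle is integration by
  parts for small g, where the weight is not differentiable on y_j = y_k. The squared differences
  are therefore replaced by (y_j - y_k)^2 + r. The resulting kernel becomes singular as r tends to
  0, but averaging over the transposition turns it into a difference quotient of a polynomial with a
  bounded factor, and dominated convergence applies.\<close>

type_synonym point = "nat \<Rightarrow> real"

section \<open>Weak submajorization of exponents\<close>

definition expo :: "nat \<Rightarrow> (nat \<Rightarrow> nat) set" where
  "expo n = {u. \<forall>i. i \<notin> {1..n} \<longrightarrow> u i = 0}"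

text \<open>On partitions this is the dominance order; the formulation needs no sorting.\<close>

definition dle :: "nat \<Rightarrow> (nat \<Rightarrow> nat) \<Rightarrow> (nat \<Rightarrow> nat) \<Rightarrow> bool" where
  "dle n v u \<longleftrightarrow> (\<forall>t. (\<Sum>i=1..n. v i - t) \<le> (\<Sum>i=1..n. u i - t))"

definition lower :: "nat \<Rightarrow> (nat \<Rightarrow> nat) \<Rightarrow> (nat \<Rightarrow> nat) set" where
  "lower n u = {v\<in>expo n. dle n v u}"

text \<open>\<open>dle\<close> is only a preorder on exponents, all rearrangements of one exponent
  being equivalent; strictness therefore means that the converse comparison fails, and whole orbits
  lie in or out together.\<close>

definition slower :: "nat \<Rightarrow> (nat \<Rightarrow> nat) \<Rightarrow> (nat \<Rightarrow> nat) set" where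
  "slower n u = {v\<in>expo n. dle n v u \<and> \<not> dle n u v}"

lemma dle_refl [simp]: "dle n u u"
  by (simp add: dle_def)

lemma dle_trans: "dle n u v \<Longrightarrow> dle n v q \<Longrightarrow> dle n u q"
  unfolding dle_def by (meson order_trans)

lemma slower_lower: "slower n u \<subseteq> lower n u"
  by (auto simp: slower_def lower_def)

lemma slower_lower_trans:
  "v \<in> slower n q \<Longrightarrow> dle n q u \<Longrightarrow> v \<in> slower n u"
  "q \<in> slower n u \<Longrightarrow> v \<in> lower n q \<Longrightarrow> v \<in> slower n u"
  unfolding slower_def lower_def using dle_trans by blast+

lemma slower_cong: "dle n u v \<Longrightarrow> dle n v u \<Longrightarrow> slower n u = slower n v"
  using slower_lower_trans(1) by blast

lemma finite_lower: "finite (lower n u)"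
proof -
  have "v j \<le> (\<Sum>i=1..n. u i)" if "dle n v u" "j \<in> {1..n}" for v j
  proof -
    \<comment> \<open>The threshold t = 0 compares total degrees, which bounds every entry.\<close>
    have "v j \<le> (\<Sum>i=1..n. v i - 0)"
      using that(2) member_le_sum[of j "{1..n}" v] by simp
    also have "\<dots> \<le> (\<Sum>i=1..n. u i - 0)"
      using that(1) unfolding dle_def by blast
    finally show ?thesis by simp
  qed
  then have "lower n u \<subseteq>
      {f. \<forall>i. (i \<in> {1..n} \<longrightarrow> f i \<in> {..(\<Sum>i=1..n. u i)}) \<and> (i \<notin> {1..n} \<longrightarrow> f i = 0)}"
    by (auto simp: lower_def expo_def)
  then show ?thesis
    by (rule finite_subset) (rule finite_set_of_finite_funs; simp)
qed

lemma finite_slower: "finite (slower n u)"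
  using finite_lower slower_lower by (rule finite_subset[rotated])

lemma sum_update2:
  fixes f :: "nat \<Rightarrow> 'b::comm_monoid_add" and n :: nat and u :: "nat \<Rightarrow> nat"
  assumes "j \<in> {1..n}" "k \<in> {1..n}" "j \<noteq> k"
  shows "(\<Sum>i=1..n. f ((u(j := p, k := q)) i)) = f p + f q + (\<Sum>i\<in>{1..n}-{j,k}. f (u i))"
proof -
  have "{1..n} = insert j (insert k ({1..n}-{j,k}))"
    using assms by auto
  then have "(\<Sum>i=1..n. f ((u(j := p, k := q)) i)) =
      (\<Sum>i\<in>insert j (insert k ({1..n}-{j,k})). f ((u(j := p, k := q)) i))"
    by simp
  also have "\<dots> = f p + (f q + (\<Sum>i\<in>{1..n}-{j,k}. f ((u(j := p, k := q)) i)))"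
    using assms by simp
  also have "(\<Sum>i\<in>{1..n}-{j,k}. f ((u(j := p, k := q)) i)) = (\<Sum>i\<in>{1..n}-{j,k}. f (u i))"
    by (rule sum.cong) auto
  finally show ?thesis by (simp only: add.assoc)
qed

lemma expo_update: "u \<in> expo n \<Longrightarrow> j \<in> {1..n} \<Longrightarrow> u(j := p) \<in> expo n"
  by (auto simp: expo_def)

text \<open>Each truncated difference a - t is a nondecreasing convex function of a; its sum over a
  pair cannot grow when the pair becomes less spread out and its total does not increase.\<close>

lemma dle_update2:
  assumes "j \<in> {1..n}" "k \<in> {1..n}" "j \<noteq> k"
    and "p \<le> max (u j) (u k)" "q \<le> max (u j) (u k)" "p + q \<le> u j + u k"
  shows "dle n (u(j := p, k := q)) u"
proof -
  have "(p - t) + (q - t) \<le> (u j - t) + (u k - t)" for t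
    using assms(4-6) by (simp add: max_def split: if_splits; arith)
  then show ?thesis
    unfolding dle_def
    using sum_update2[OF assms(1-3), of "\<lambda>a. a - t" u p q for t]
      sum_update2[OF assms(1-3), of "\<lambda>a. a - t" u "u j" "u k" for t]
    by (simp del: fun_upd_apply)
qed

lemma slower_update2:
  assumes "j \<in> {1..n}" "k \<in> {1..n}" "j \<noteq> k" "u \<in> expo n"
    and "p \<le> max (u j) (u k)" "q \<le> max (u j) (u k)" "p + q \<le> u j + u k"
    and "p + q < u j + u k \<or> p < max (u j) (u k) \<and> q < max (u j) (u k)"
  shows "u(j := p, k := q) \<in> slower n u"
proof -
  have "\<exists>t. (p - t) + (q - t) < (u j - t) + (u k - t)"
  proof (cases "p + q < u j + u k")
    case True
    \<comment> \<open>Threshold 0 detects the loss of total degree.\<close>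
    then show ?thesis by (intro exI[of _ 0]) simp
  next
    case False
    \<comment> \<open>At one below the larger old entry, that entry still counts, whereas both new
      entries are truncated to 0.\<close>
    then show ?thesis
      using assms(8) by (intro exI[of _ "max (u j) (u k) - 1"]) (simp add: max_def split: if_splits; arith)
  qed
  then obtain t where "(p - t) + (q - t) < (u j - t) + (u k - t)" by blast
  then have "(\<Sum>i=1..n. (u(j := p, k := q)) i - t) < (\<Sum>i=1..n. u i - t)"
    using sum_update2[OF assms(1-3), of "\<lambda>a. a - t" u p q]
      sum_update2[OF assms(1-3), of "\<lambda>a. a - t" u "u j" "u k"] by simp
  then have "\<not> dle n u (u(j := p, k := q))"
    unfolding dle_def by (meson not_le)
  then show ?thesis
    using dle_update2[OF assms(1-3,5-7)] assms(1-4) by (simp add: slower_def expo_update)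
qed

lemma slower_decrease:
  assumes "j \<in> {1..n}" "u \<in> expo n" "u j > 0"
  shows "u(j := u j - 1) \<in> slower n u"
proof -
  have le: "(\<Sum>i=1..n. (u(j := u j - 1)) i - t) \<le> (\<Sum>i=1..n. u i - t)" for t
    by (rule sum_mono) auto
  have "(\<Sum>i=1..n. (u(j := u j - 1)) i) < (\<Sum>i=1..n. u i)"
    using assms by (intro sum_strict_mono_ex1) auto
  then have "\<not> (\<Sum>i=1..n. u i - 0) \<le> (\<Sum>i=1..n. (u(j := u j - 1)) i - 0)"
    by simp
  then have "\<not> dle n u (u(j := u j - 1))"
    unfolding dle_def by blast
  then show ?thesis
    using le assms by (simp add: slower_def expo_update dle_def)
qed

section \<open>Rearrangements of exponents and sorting\<close>

lemma comp_permutes_expo: "p permutes {1..n} \<Longrightarrow> u \<in> expo n \<Longrightarrow> u \<circ> p \<in> expo n"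
  by (auto simp: expo_def permutes_not_in)

lemma dle_permutes:
  assumes "p permutes {1..n}"
  shows "dle n (u \<circ> p) u" "dle n u (u \<circ> p)"
  using sum.permute[OF assms, of "\<lambda>i. u i - t" for t] by (auto simp: dle_def o_def)

abbreviation tr :: "nat \<Rightarrow> nat \<Rightarrow> nat \<Rightarrow> nat" where
  "tr \<equiv> Transposition.transpose"

lemma tr_permutes: "j \<in> {1..n} \<Longrightarrow> k \<in> {1..n} \<Longrightarrow> tr j k permutes {1..n::nat}"
  by (rule permutes_swap_id)

lemma comp_tr: "u \<circ> tr j k = u(j := u k, k := u j)"
  by (auto simp: transpose_def fun_eq_iff)

text \<open>The induction measure for the triangularity of the operators xi.\<close>

definition disorder :: "nat \<Rightarrow> (nat \<Rightarrow> nat) \<Rightarrow> nat" where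
  "disorder n u = (\<Sum>i=1..n. i * u i)"

text \<open>Rearrangement inequality: the swap lowers the sum by the product of j - k and u j - u k,
  both positive.\<close>

lemma disorder_transpose:
  assumes "j \<in> {1..n}" "k \<in> {1..n}" "k < j" "u k < u j"
  shows "disorder n (u \<circ> tr j k) < disorder n u"
proof -
  have I: "{1..n} = insert j (insert k ({1..n}-{j,k}))"
    using assms by auto
  have *: "disorder n v = j * v j + k * v k + (\<Sum>i\<in>{1..n}-{j,k}. i * v i)" for v
    unfolding disorder_def using assms by (subst I) (subst sum.insert; simp)+
  have "(\<Sum>i\<in>{1..n}-{j,k}. i * (u \<circ> tr j k) i) = (\<Sum>i\<in>{1..n}-{j,k}. i * u i)"
    by (rule sum.cong) (auto simp: transpose_def)
  moreover have "j * u k + k * u j < j * u j + k * u k"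
  proof -
    obtain a b where "j = k + a" "a > 0" "u j = u k + b" "b > 0"
      using assms by (metis less_imp_add_positive)
    then show ?thesis by (simp add: algebra_simps)
  qed
  ultimately show ?thesis
    by (simp add: *)
qed

text \<open>A rearrangement of least \<open>disorder\<close> is weakly decreasing, since an ascent
  could be swapped to lower it further.\<close>

lemma sorted_permutation:
  assumes "u \<in> expo n"
  obtains l p where "l \<in> partitions n" "p permutes {1..n}" "u = l \<circ> p"
proof -
  let ?P = "\<lambda>p. p permutes {1..n}"
  obtain p where p: "?P p" and min: "\<And>t. ?P t \<Longrightarrow> disorder n (u \<circ> p) \<le> disorder n (u \<circ> t)"
    using ex_has_least_nat[of ?P id "\<lambda>p. disorder n (u \<circ> p)"] permutes_id by blast
  have "(u \<circ> p) k \<le> (u \<circ> p) j" if "1 \<le> j" "j \<le> k" "k \<le> n" for j k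
  proof (rule ccontr)
    assume "\<not> ?thesis"
    moreover from this that have "j < k" by (cases "j = k") auto
    ultimately have "disorder n (u \<circ> p \<circ> tr k j) < disorder n (u \<circ> p)"
      using that by (intro disorder_transpose) auto
    moreover have "?P (p \<circ> tr k j)"
      using p that by (intro permutes_compose permutes_swap_id) auto
    ultimately show False
      using min by (fastforce simp: o_assoc)
  qed
  moreover have "u \<circ> p \<in> expo n"
    using assms p by (rule comp_permutes_expo[rotated])
  ultimately have "u \<circ> p \<in> partitions n"
    by (auto simp: partitions_def expo_def)
  moreover have "u = (u \<circ> p) \<circ> inv p"
    using p by (simp add: permutes_inv_o o_assoc[symmetric])
  ultimately show ?thesis
    using that permutes_inv[OF p] by blast
qed

section \<open>Comparison with the dominance order on partitions\<close>

lemma partitions_expo: "partitions n \<subseteq> expo n"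
  by (auto simp: partitions_def expo_def)

text \<open>For a partition l, the sum of the truncations l i - t is the maximum over k of the k-th
  partial sum minus k * t, attained at the number of parts exceeding t. For any m, each expression
  of this kind is a lower bound of the truncated sum.\<close>

lemma dom_le_imp_dle:
  assumes "l \<in> partitions n" "dom_le n l m"
  shows "dle n l m"
  unfolding dle_def
proof
  fix t
  \<comment> \<open>The parts exceeding t form an initial segment; k is its length, and 0 stands for
    an empty one.\<close>
  define k where "k = Max (insert 0 {i\<in>{1..n}. t < l i})"
  have "k \<in> insert 0 {i\<in>{1..n}. t < l i}"
    unfolding k_def by (rule Max_in) auto
  then have kn: "k \<le> n" and gt: "\<And>i. i \<in> {1..k} \<Longrightarrow> t < l i"
    using assms(1) by (auto simp: partitions_def intro: less_le_trans)
  have le: "l i \<le> t" if "i \<in> {1..n} - {1..k}" for i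
    using Max_ge[of "insert 0 {i\<in>{1..n}. t < l i}" i] that unfolding k_def by fastforce
  have 1: "(\<Sum>i=1..n. l i - t) = (\<Sum>i=1..k. l i - t)"
    using kn le by (intro sum.mono_neutral_right) auto
  have "(\<Sum>i=1..k. l i - t) + k * t = (\<Sum>i=1..k. (l i - t) + t)"
    by (simp add: sum.distrib)
  also have "\<dots> = (\<Sum>i=1..k. l i)"
    by (rule sum.cong[OF refl]) (use gt in force)
  also have "\<dots> \<le> (\<Sum>i=1..k. m i)"
    using assms(2) kn by (cases "k = 0") (auto simp: dom_le_def)
  also have "\<dots> \<le> (\<Sum>i=1..k. (m i - t) + t)"
    by (rule sum_mono) simp
  also have "\<dots> = (\<Sum>i=1..k. m i - t) + k * t"
    by (simp add: sum.distrib)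
  also have "(\<Sum>i=1..k. m i - t) \<le> (\<Sum>i=1..n. m i - t)"
    using kn by (intro sum_mono2) auto
  finally show "(\<Sum>i=1..n. l i - t) \<le> (\<Sum>i=1..n. m i - t)"
    using 1 by simp
qed

lemma dle_imp_dom_le:
  assumes "m \<in> partitions n" "dle n l m"
  shows "dom_le n l m"
  unfolding dom_le_def
proof
  fix k assume k: "k \<in> {1..n}"
  \<comment> \<open>With this threshold the parts of m up to index k are at least t and the later
    ones at most t, so the truncated sum of m equals its k-th partial sum minus k * t.\<close>
  define t where "t = m k"
  have "(\<Sum>i=1..k. l i) \<le> (\<Sum>i=1..k. (l i - t) + t)"
    by (rule sum_mono) simp
  also have "\<dots> = (\<Sum>i=1..k. l i - t) + k * t"
    by (simp add: sum.distrib)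
  also have "(\<Sum>i=1..k. l i - t) \<le> (\<Sum>i=1..n. l i - t)"
    using k by (intro sum_mono2) auto
  also have "\<dots> \<le> (\<Sum>i=1..n. m i - t)"
    using assms(2) unfolding dle_def by blast
  also have "\<dots> = (\<Sum>i=1..k. m i - t)"
    using k assms(1) by (intro sum.mono_neutral_right) (auto simp: t_def partitions_def)
  also have "(\<Sum>i=1..k. m i - t) + k * t = (\<Sum>i=1..k. (m i - t) + t)"
    by (simp add: sum.distrib)
  also have "\<dots> = (\<Sum>i=1..k. m i)"
    using k assms(1) by (intro sum.cong) (auto simp: t_def partitions_def)
  finally show "(\<Sum>i=1..k. l i) \<le> (\<Sum>i=1..k. m i)" by simp
qed

lemma dom_le_antisym:
  assumes "l \<in> partitions n" "m \<in> partitions n" "dom_le n l m" "dom_le n m l"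
  shows "l = m"
proof
  fix i
  have eq: "(\<Sum>j=1..k. l j) = (\<Sum>j=1..k. m j)" if "k \<le> n" for k
    using assms(3,4) that by (cases "k = 0") (auto simp: dom_le_def intro!: antisym)
  show "l i = m i"
  proof (cases "i \<in> {1..n}")
    case True
    then obtain k where "i = Suc k" by (cases i) auto
    then show ?thesis
      using eq[of i] eq[of k] True by simp
  next
    case False
    then show ?thesis using assms(1,2) by (auto simp: partitions_def)
  qed
qed

lemma dle_partitions_antisym:
  "l \<in> partitions n \<Longrightarrow> m \<in> partitions n \<Longrightarrow> dle n l m \<Longrightarrow> dle n m l \<Longrightarrow> l = m"
  using dom_le_antisym dle_imp_dom_le by blast

lemma dom_less_iff_slower:
  assumes "l \<in> partitions n" "m \<in> partitions n"
  shows "dom_less n l m \<longleftrightarrow> l \<in> slower n m"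
  using assms partitions_expo dom_le_imp_dle dle_imp_dom_le dle_partitions_antisym
  unfolding dom_less_def slower_def by blast

section \<open>Dunkl operators on polynomials\<close>

text \<open>
  Spans are taken modulo equality at points with pairwise distinct coordinates: elsewhere the
  difference quotients in the Dunkl operators have the junk value 0.
\<close>

inductive_set lspan :: "nat \<Rightarrow> ('i \<Rightarrow> point \<Rightarrow> real) \<Rightarrow> 'i set \<Rightarrow> (point \<Rightarrow> real) set"
  for n b S where
  lspan_zero: "(\<forall>x. inj_on x {1..n} \<longrightarrow> f x = 0) \<Longrightarrow> f \<in> lspan n b S"
| lspan_step: "f \<in> lspan n b S \<Longrightarrow> i \<in> S \<Longrightarrow>
    (\<forall>x. inj_on x {1..n} \<longrightarrow> h x = f x + c * b i x) \<Longrightarrow> h \<in> lspan n b S"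

lemma lspan_cong:
  assumes "f \<in> lspan n b S" "\<And>x. inj_on x {1..n} \<Longrightarrow> h x = f x"
  shows "h \<in> lspan n b S"
  using assms(1)
proof cases
  case lspan_zero
  then show ?thesis using assms(2) by (intro lspan.lspan_zero) auto
next
  case (lspan_step f' i c)
  then show ?thesis using assms(2) by (intro lspan.lspan_step[of f' n b S i h c]) auto
qed

lemma lspan_base: "i \<in> S \<Longrightarrow> b i \<in> lspan n b S"
  by (rule lspan_step[OF lspan_zero[of n "\<lambda>_. 0"], of _ _ _ 1]) auto

lemma lspan_add:
  assumes "h \<in> lspan n b S" "f \<in> lspan n b S"
  shows "(\<lambda>x. f x + h x) \<in> lspan n b S"
  using assms
proof induction
  case (lspan_zero h)
  then show ?case by (elim lspan_cong) auto
next
  case (lspan_step h i h' c)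
  then show ?case by (intro lspan.lspan_step[of "\<lambda>x. f x + h x" n b S i "\<lambda>x. f x + h' x" c]) auto
qed

lemma lspan_scale:
  assumes "f \<in> lspan n b S"
  shows "(\<lambda>x. c * f x) \<in> lspan n b S"
  using assms
proof induction
  case (lspan_zero f)
  then show ?case by (intro lspan.lspan_zero) auto
next
  case (lspan_step f i h d)
  then show ?case
    by (intro lspan.lspan_step[of "\<lambda>x. c * f x" n b S i "\<lambda>x. c * h x" "c * d"]) (auto simp: algebra_simps)
qed

lemma lspan_minus: "f \<in> lspan n b S \<Longrightarrow> (\<lambda>x. - f x) \<in> lspan n b S"
  using lspan_scale[of f n b S "-1"] by simp

lemma lspan_diff:
  "f \<in> lspan n b S \<Longrightarrow> h \<in> lspan n b S \<Longrightarrow> (\<lambda>x. f x - h x) \<in> lspan n b S"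
  using lspan_add[OF lspan_minus[of h n b S], of f] by simp

lemma lspan_sum:
  "(\<And>i. i \<in> A \<Longrightarrow> f i \<in> lspan n b S) \<Longrightarrow> (\<lambda>x. \<Sum>i\<in>A. f i x) \<in> lspan n b S"
proof (induction A rule: infinite_finite_induct)
  case (insert a A)
  then show ?case by (auto intro: lspan_add)
qed (auto intro: lspan_zero)

lemma lspan_trans:
  assumes "f \<in> lspan n b S" "\<And>i. i \<in> S \<Longrightarrow> b i \<in> lspan n b' S'"
  shows "f \<in> lspan n b' S'"
  using assms(1)
proof induction
  case (lspan_zero f)
  then show ?case by (rule lspan.lspan_zero)
next
  case (lspan_step f i h c)
  have "(\<lambda>x. f x + c * b i x) \<in> lspan n b' S'"
    using lspan_step assms(2) by (intro lspan_add lspan_scale)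
  then show ?case
    by (rule lspan_cong) (use lspan_step in auto)
qed

lemma lspan_mono: "f \<in> lspan n b S \<Longrightarrow> S \<subseteq> T \<Longrightarrow> f \<in> lspan n b T"
  by (erule lspan_trans) (auto intro: lspan_base)

text \<open>Linearity is demanded on the span and at regular points: \<open>deriv\<close> is
  additive for differentiable functions, and difference quotients are meaningful where the
  coordinates differ.\<close>

lemma lspan_image:
  assumes "f \<in> lspan n b S"
    and cong: "\<And>f h x. (\<And>y. inj_on y {1..n} \<Longrightarrow> f y = h y) \<Longrightarrow> inj_on x {1..n} \<Longrightarrow> T f x = T h x"
    and lin: "\<And>f i c x. f \<in> lspan n b S \<Longrightarrow> i \<in> S \<Longrightarrow> inj_on x {1..n} \<Longrightarrow>
      T (\<lambda>x. f x + c * b i x) x = T f x + c * T (b i) x"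
    and zero: "\<And>x. inj_on x {1..n} \<Longrightarrow> T (\<lambda>x. 0) x = 0"
    and base: "\<And>i. i \<in> S \<Longrightarrow> T (b i) \<in> lspan n b' S'"
  shows "T f \<in> lspan n b' S'"
  using assms(1)
proof induction
  case (lspan_zero f)
  have "T f x = 0" if "inj_on x {1..n}" for x
    using cong[of f "\<lambda>_. 0" x] zero that lspan_zero by simp
  then show ?case by (intro lspan.lspan_zero) simp
next
  case (lspan_step f i h c)
  have "(\<lambda>x. T f x + c * T (b i) x) \<in> lspan n b' S'"
    using lspan_step base by (intro lspan_add lspan_scale)
  then show ?case
    by (rule lspan_cong) (use lspan_step lin cong[of h "\<lambda>x. f x + c * b i x"] in auto)
qed

text \<open>Membership in a span carries no coefficients; they are recovered here for the existence
  proof in \<open>hl_exists_unique\<close>, where a polynomial of the prescribed form has to be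
  exhibited.\<close>

lemma lspan_finite:
  assumes "f \<in> lspan n b S" "finite S"
  shows "\<exists>c. \<forall>x. inj_on x {1..n} \<longrightarrow> f x = (\<Sum>i\<in>S. c i * b i x)"
  using assms(1)
proof induction
  case (lspan_zero f)
  then show ?case by (intro exI[of _ "\<lambda>_. 0"]) auto
next
  case (lspan_step f i h c)
  then obtain d where d: "\<And>x. inj_on x {1..n} \<Longrightarrow> f x = (\<Sum>i\<in>S. d i * b i x)"
    by blast
  have "(\<Sum>k\<in>S. (d k + (if k = i then c else 0)) * b k x) = (\<Sum>i\<in>S. d i * b i x) + c * b i x" for x
  proof -
    have "(\<Sum>k\<in>S. (d k + (if k = i then c else 0)) * b k x)
        = (\<Sum>k\<in>S. d k * b k x + (if k = i then c * b i x else 0))"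
      by (rule sum.cong) (auto simp: algebra_simps)
    then show ?thesis
      using lspan_step assms(2) by (simp add: sum.distrib)
  qed
  then show ?case
    using d lspan_step by (intro exI[of _ "\<lambda>k. d k + (if k = i then c else 0)"]) auto
qed

section \<open>Monomials and polynomial functions\<close>

definition xpow :: "nat \<Rightarrow> (nat \<Rightarrow> nat) \<Rightarrow> point \<Rightarrow> real" where
  "xpow n u x = (\<Prod>i=1..n. x i ^ u i)"

abbreviation pspan :: "nat \<Rightarrow> (nat \<Rightarrow> nat) set \<Rightarrow> (point \<Rightarrow> real) set" where
  "pspan n \<equiv> lspan n (xpow n)"

abbreviation polys :: "nat \<Rightarrow> (point \<Rightarrow> real) set" where
  "polys n \<equiv> pspan n (expo n)"

lemma polys_lower: "f \<in> pspan n (lower n u) \<Longrightarrow> f \<in> polys n"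
  by (erule lspan_mono) (auto simp: lower_def)

lemma polys_slower: "f \<in> pspan n (slower n u) \<Longrightarrow> f \<in> polys n"
  by (erule lspan_mono) (auto simp: slower_def)

lemma xpow_mult: "xpow n u x * xpow n v x = xpow n (\<lambda>i. u i + v i) x"
  by (simp add: xpow_def prod.distrib power_add)

lemma polys_mult:
  assumes "f \<in> polys n" "h \<in> polys n"
  shows "(\<lambda>x. f x * h x) \<in> polys n"
proof -
  have 1: "(\<lambda>x. f x * xpow n v x) \<in> polys n" if "v \<in> expo n" for v
    using assms(1)
  proof (rule lspan_image)
    fix i assume "i \<in> expo n"
    then have "(\<lambda>i'. i i' + v i') \<in> expo n" using that by (auto simp: expo_def)
    then show "(\<lambda>x. xpow n i x * xpow n v x) \<in> polys n"
      unfolding xpow_mult by (rule lspan_base)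
  qed (auto simp: algebra_simps)
  show ?thesis
    using assms(2) by (rule lspan_image) (use 1 in \<open>auto simp: algebra_simps\<close>)
qed

lemma polys_const: "(\<lambda>x. c) \<in> polys n"
proof -
  have "(\<lambda>x. c * xpow n (\<lambda>_. 0) x) \<in> polys n"
    by (intro lspan_scale lspan_base) (simp add: expo_def)
  then show ?thesis by (simp add: xpow_def)
qed

lemma xpow_update:
  assumes "j \<in> {1..n}"
  shows "xpow n u (x(j := t)) = t ^ u j * (\<Prod>i\<in>{1..n}-{j}. x i ^ u i)"
proof -
  have "xpow n u (x(j := t)) = t ^ u j * (\<Prod>i\<in>{1..n}-{j}. (x(j := t)) i ^ u i)"
    unfolding xpow_def using assms by (subst prod.remove[of _ j]) auto
  also have "(\<Prod>i\<in>{1..n}-{j}. (x(j := t)) i ^ u i) = (\<Prod>i\<in>{1..n}-{j}. x i ^ u i)"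
    by (rule prod.cong) auto
  finally show ?thesis .
qed

lemma xpow_expo_update:
  assumes "j \<in> {1..n}"
  shows "xpow n (u(j := p)) x = x j ^ p * (\<Prod>i\<in>{1..n}-{j}. x i ^ u i)"
proof -
  have "xpow n (u(j := p)) x = x j ^ p * (\<Prod>i\<in>{1..n}-{j}. x i ^ (u(j := p)) i)"
    unfolding xpow_def using assms by (subst prod.remove[of _ j]) auto
  also have "(\<Prod>i\<in>{1..n}-{j}. x i ^ (u(j := p)) i) = (\<Prod>i\<in>{1..n}-{j}. x i ^ u i)"
    by (rule prod.cong) auto
  finally show ?thesis .
qed

lemma xpow_expo_update2:
  assumes "j \<in> {1..n}" "k \<in> {1..n}" "j \<noteq> k"
  shows "xpow n (u(j := p, k := q)) x = x j ^ p * x k ^ q * (\<Prod>i\<in>{1..n}-{j,k}. x i ^ u i)"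
proof -
  have "xpow n (u(j := p, k := q)) x
      = x j ^ p * (x k ^ q * (\<Prod>i\<in>{1..n}-{j}-{k}. x i ^ (u(j := p, k := q)) i))"
    unfolding xpow_def using assms by (subst prod.remove[of _ j], simp_all, subst prod.remove[of _ k], simp_all)
  also have "(\<Prod>i\<in>{1..n}-{j}-{k}. x i ^ (u(j := p, k := q)) i) = (\<Prod>i\<in>{1..n}-{j,k}. x i ^ u i)"
    by (rule prod.cong) auto
  finally show ?thesis by (simp only: mult.assoc)
qed

lemma xpow_mult_var: "j \<in> {1..n} \<Longrightarrow> x j * xpow n u x = xpow n (u(j := Suc (u j))) x"
  using xpow_expo_update[of j n u "u j" x] xpow_expo_update[of j n u "Suc (u j)" x] by simp

lemma polys_var: "j \<in> {1..n} \<Longrightarrow> (\<lambda>x. x j) \<in> polys n"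
proof -
  assume j: "j \<in> {1..n}"
  have "xpow n ((\<lambda>_. 0)(j := 1)) \<in> polys n"
    using j by (intro lspan_base) (simp add: expo_def)
  then show ?thesis
    by (rule lspan_cong) (use xpow_expo_update[OF j, of "\<lambda>_. 0" 1] in simp)
qed

lemma xpow_permute:
  assumes "p permutes {1..n}"
  shows "xpow n (u \<circ> p) (x \<circ> p) = xpow n u x"
  unfolding xpow_def using prod.permute[OF assms, of "\<lambda>i. x i ^ u i"] by (simp add: o_def)

lemma xpow_permute':
  assumes "p permutes {1..n}"
  shows "xpow n u (x \<circ> p) = xpow n (u \<circ> inv p) x"
  using xpow_permute[OF permutes_inv[OF assms], of u "x \<circ> p"] assms
  by (simp add: o_assoc[symmetric] permutes_inv_o)

lemma xpow_transpose:
  assumes "j \<in> {1..n}" "k \<in> {1..n}"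
  shows "xpow n u (x \<circ> tr j k) = xpow n (u \<circ> tr j k) x"
  using xpow_permute'[OF tr_permutes[OF assms]] by simp

lemma regular_permute:
  assumes "p permutes {1..n}"
  shows "inj_on (x \<circ> p) {1..n} \<longleftrightarrow> inj_on x {1..n}"
  using comp_inj_on_iff[of p "{1..n}" x] permutes_inj_on[OF assms] permutes_image[OF assms] by auto

lemma lspan_permute:
  assumes "p permutes {1..n}" "f \<in> pspan n S"
    and "\<And>u. u \<in> S \<Longrightarrow> u \<circ> inv p \<in> T"
  shows "(\<lambda>x. f (x \<circ> p)) \<in> pspan n T"
  using assms(2)
proof (rule lspan_image)
  fix u assume "u \<in> S"
  then show "(\<lambda>x. xpow n u (x \<circ> p)) \<in> pspan n T"
    unfolding xpow_permute'[OF assms(1)] using assms(3) by (intro lspan_base)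
next
  fix f h :: "point \<Rightarrow> real" and x :: point
  assume "\<And>y. inj_on y {1..n} \<Longrightarrow> f y = h y" "inj_on x {1..n}"
  then show "f (x \<circ> p) = h (x \<circ> p)"
    using regular_permute[OF assms(1)] by blast
qed auto

lemma polys_permute:
  "p permutes {1..n} \<Longrightarrow> f \<in> polys n \<Longrightarrow> (\<lambda>x. f (x \<circ> p)) \<in> polys n"
  by (rule lspan_permute) (blast intro: comp_permutes_expo permutes_inv)+

lemma lower_permute:
  assumes "p permutes {1..n}" "v \<in> lower n u"
  shows "v \<circ> p \<in> lower n u"
  using assms dle_trans[OF dle_permutes(1)[OF assms(1)]] comp_permutes_expo
  unfolding lower_def by blast

lemma slower_permute:
  assumes "p permutes {1..n}" "v \<in> slower n u"
  shows "v \<circ> p \<in> slower n u"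
  using assms slower_lower_trans(2)[of v n u "v \<circ> p"] lower_permute[of p n v v]
  unfolding lower_def slower_def by auto

section \<open>Difference quotients and Dunkl operators\<close>

definition ddiff :: "nat \<Rightarrow> nat \<Rightarrow> (point \<Rightarrow> real) \<Rightarrow> point \<Rightarrow> real" where
  "ddiff j k f x = (f x - f (x \<circ> tr j k)) / (x j - x k)"

text \<open>Transpositions suffice in type B as well: in the variables y j, the squares of the x j,
  sign changes act trivially.\<close>

definition dunkl :: "nat \<Rightarrow> real \<Rightarrow> nat \<Rightarrow> (point \<Rightarrow> real) \<Rightarrow> point \<Rightarrow> real" where
  "dunkl n g j f x =
     deriv (\<lambda>t. f (x(j := t))) (x j) + g * (\<Sum>k\<in>{1..n}-{j}. ddiff j k f x)"

text \<open>Subtraction on the naturals leaves at most one of the two sums nonempty, depending on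
  which entry is larger. Its exponent pairs run between the old ones and have total degree one
  less.\<close>

lemma ddiff_xpow:
  assumes "j \<in> {1..n}" "k \<in> {1..n}" "x j \<noteq> x k"
  shows "ddiff j k (xpow n u) x =
    (\<Sum>i<u j - u k. xpow n (u(j := u k + i, k := u j - Suc i)) x) -
    (\<Sum>i<u k - u j. xpow n (u(j := u j + i, k := u k - Suc i)) x)"
proof -
  have jk: "j \<noteq> k" using assms(3) by auto
  define R where "R = (\<Prod>i\<in>{1..n}-{j,k}. x i ^ u i)"
  \<comment> \<open>The common factor with the smaller exponent b is pulled out before the geometric
    factorization of the difference of m-th powers.\<close>
  have key: "X ^ (b + m) * Y ^ b - X ^ b * Y ^ (b + m)
      = (X - Y) * (\<Sum>i<m. X ^ (b + i) * Y ^ (b + m - Suc i))" for X Y :: real and b m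
  proof -
    have "X ^ (b + m) * Y ^ b - X ^ b * Y ^ (b + m) = X ^ b * Y ^ b * (X ^ m - Y ^ m)"
      by (simp add: power_add algebra_simps)
    also have "X ^ m - Y ^ m = (X - Y) * (\<Sum>i<m. Y ^ (m - Suc i) * X ^ i)"
      by (rule power_diff_sumr2)
    also have "X ^ b * Y ^ b * ((X - Y) * (\<Sum>i<m. Y ^ (m - Suc i) * X ^ i))
        = (X - Y) * (\<Sum>i<m. X ^ b * Y ^ b * (Y ^ (m - Suc i) * X ^ i))"
      by (simp only: sum_distrib_left mult.left_commute)
    also have "(\<Sum>i<m. X ^ b * Y ^ b * (Y ^ (m - Suc i) * X ^ i))
        = (\<Sum>i<m. X ^ (b + i) * Y ^ (b + m - Suc i))"
    proof (rule sum.cong)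
      fix i assume "i \<in> {..<m}"
      then have "b + m - Suc i = b + (m - Suc i)" by simp
      then show "X ^ b * Y ^ b * (Y ^ (m - Suc i) * X ^ i) = X ^ (b + i) * Y ^ (b + m - Suc i)"
        by (simp only: power_add mult_ac)
    qed simp
    finally show ?thesis .
  qed
  have m: "xpow n u x = x j ^ u j * x k ^ u k * R"
    using xpow_expo_update2[OF assms(1,2) jk, of u "u j" "u k" x] by (simp add: R_def)
  have mt: "xpow n u (x \<circ> tr j k) = x j ^ u k * x k ^ u j * R"
    unfolding xpow_transpose[OF assms(1,2)] unfolding comp_tr
    using xpow_expo_update2[OF assms(1,2) jk, of u "u k" "u j" x] by (simp add: R_def)
  note up = xpow_expo_update2[OF assms(1,2) jk, where u = u and x = x, folded R_def]
  have "xpow n u x - xpow n u (x \<circ> tr j k) = (x j - x k) *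
    ((\<Sum>i<u j - u k. xpow n (u(j := u k + i, k := u j - Suc i)) x) -
    (\<Sum>i<u k - u j. xpow n (u(j := u j + i, k := u k - Suc i)) x))"
  proof (cases "u k \<le> u j")
    case True
    then obtain d where d: "u j = u k + d" using le_Suc_ex by blast
    have "xpow n u x - xpow n u (x \<circ> tr j k)
        = (x j ^ (u k + d) * x k ^ u k - x j ^ u k * x k ^ (u k + d)) * R"
      unfolding m mt d by (simp only: left_diff_distrib)
    also have "\<dots> = (x j - x k) * (\<Sum>i<d. xpow n (u(j := u k + i, k := u k + d - Suc i)) x)"
      unfolding key up by (simp only: sum_distrib_right mult.assoc)
    finally show ?thesis by (simp add: d)
  next
    case False
    then obtain d where d: "u k = u j + d" using le_Suc_ex nat_le_linear by blast
    have "xpow n u x - xpow n u (x \<circ> tr j k)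
        = - ((x j ^ (u j + d) * x k ^ u j - x j ^ u j * x k ^ (u j + d)) * R)"
      unfolding m mt d by (simp add: algebra_simps)
    also have "\<dots> = - ((x j - x k) * (\<Sum>i<d. xpow n (u(j := u j + i, k := u j + d - Suc i)) x))"
      unfolding key up by (simp only: sum_distrib_right mult.assoc)
    finally show ?thesis by (simp add: d)
  qed
  then show ?thesis
    unfolding ddiff_def using assms(3) by simp
qed

lemma regular_noteq: "inj_on x {1..n} \<Longrightarrow> j \<in> {1..n} \<Longrightarrow> k \<in> {1..n} \<Longrightarrow> j \<noteq> k \<Longrightarrow> x j \<noteq> x k"
  by (meson inj_onD)

lemma ddiff_xpow_slower:
  assumes "j \<in> {1..n}" "k \<in> {1..n}" "j \<noteq> k" "u \<in> expo n"
  shows "ddiff j k (xpow n u) \<in> pspan n (slower n u)"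
proof -
  have "(\<lambda>x. (\<Sum>i<u j - u k. xpow n (u(j := u k + i, k := u j - Suc i)) x) -
    (\<Sum>i<u k - u j. xpow n (u(j := u j + i, k := u k - Suc i)) x)) \<in> pspan n (slower n u)"
    using assms by (intro lspan_diff lspan_sum lspan_base slower_update2) auto
  then show ?thesis
    by (rule lspan_cong) (rule ddiff_xpow; use assms regular_noteq in blast)
qed

text \<open>Multiplication by x j restores the degree. Only the last summand of
  \<open>ddiff_xpow\<close> then has the extreme exponent pair, giving u itself or its transpose;
  the other pairs lie strictly between and are smaller.\<close>

lemma var_ddiff_xpow:
  assumes "j \<in> {1..n}" "k \<in> {1..n}" "j \<noteq> k" "u \<in> expo n"
  shows "(\<lambda>x. x j * ddiff j k (xpow n u) x -
      ((if u k < u j then xpow n u x else 0) -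
       (if u j < u k then xpow n (u \<circ> tr j k) x else 0)))
    \<in> pspan n (slower n u)"
proof -
  \<comment> \<open>The entry a plays the role of the smaller one; for a >= b both parts of F
    vanish, so the difference of the two instances covers both cases.\<close>
  define F where "F a b x = x j * (\<Sum>i<b - a. xpow n (u(j := a + i, k := b - Suc i)) x) -
      (if a < b then xpow n (u(j := b, k := a)) x else 0)" for a b x
  have part: "F a b \<in> pspan n (slower n u)"
    if ab: "a = u k \<and> b = u j \<or> a = u j \<and> b = u k" for a b
  proof (cases "a < b")
    case False
    then show ?thesis by (intro lspan_zero) (auto simp: F_def)
  next
    case True
    \<comment> \<open>With b = a + m + 1 the summand i = m has the exponents b and a, which is the
      monomial subtracted in F.\<close>
    then obtain m where m: "b = Suc (a + m)" using less_iff_Suc_add by auto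
    have eq: "x j * xpow n (u(j := p, k := q)) x = xpow n (u(j := Suc p, k := q)) x" for p q x
      using assms by (simp add: xpow_expo_update2)
    have "(\<lambda>x. \<Sum>i<m. xpow n (u(j := Suc (a + i), k := b - Suc i)) x) \<in> pspan n (slower n u)"
      using assms ab m by (intro lspan_sum lspan_base slower_update2) auto
    then show ?thesis
      by (rule lspan_cong) (simp add: F_def m sum_distrib_left distrib_left eq)
  qed
  have "(\<lambda>x. F (u k) (u j) x - F (u j) (u k) x) \<in> pspan n (slower n u)"
    by (intro lspan_diff part) auto
  then show ?thesis
  proof (rule lspan_cong)
    fix x :: point assume "inj_on x {1..n}"
    then have "x j \<noteq> x k" using assms regular_noteq by blast
    then show "x j * ddiff j k (xpow n u) x -
      ((if u k < u j then xpow n u x else 0) -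
       (if u j < u k then xpow n (u \<circ> tr j k) x else 0)) =
      F (u k) (u j) x - F (u j) (u k) x"
      unfolding ddiff_xpow[OF assms(1,2) \<open>x j \<noteq> x k\<close>] comp_tr F_def
      by (simp add: right_diff_distrib)
  qed
qed

text \<open>For u j = 0 the truncated exponent is harmless, its coefficient being 0.\<close>

lemma DERIV_xpow:
  assumes "j \<in> {1..n}"
  shows "((\<lambda>t. xpow n u (x(j := t))) has_field_derivative
    real (u j) * xpow n (u(j := u j - 1)) x) (at (x j))"
  unfolding xpow_update[OF assms] xpow_expo_update[OF assms]
  by (auto intro!: derivative_eq_intros simp: algebra_simps)

text \<open>Regularity is an open condition along each coordinate line; hence a partial derivative
  at a regular point ignores the arbitrary values at other points.\<close>

lemma eventually_regular:
  fixes x :: point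
  assumes "inj_on x {1..n}" "j \<in> {1..n}"
  shows "eventually (\<lambda>t. inj_on (x(j := t)) {1..n}) (nhds (x j))"
proof -
  have "eventually (\<lambda>t. \<forall>k\<in>{1..n}-{j}. t \<noteq> x k) (nhds (x j))"
  proof (rule eventually_ball_finite)
    show "\<forall>k\<in>{1..n} - {j}. eventually (\<lambda>t. t \<noteq> x k) (nhds (x j))"
    proof
      fix k assume "k \<in> {1..n} - {j}"
      then have "x j \<noteq> x k"
        using regular_noteq[OF assms(1,2), of k] by simp
      then show "eventually (\<lambda>t. t \<noteq> x k) (nhds (x j))"
        by (rule t1_space_nhds)
    qed
  qed simp
  then show ?thesis
  proof (rule eventually_mono)
    fix t assume t: "\<forall>k\<in>{1..n}-{j}. t \<noteq> x k"
    show "inj_on (x(j := t)) {1..n}"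
    proof (rule inj_onI)
      fix a b assume ab: "a \<in> {1..n}" "b \<in> {1..n}" "(x(j := t)) a = (x(j := t)) b"
      show "a = b"
      proof (cases "a = j \<or> b = j")
        case True
        then show ?thesis using t ab by (metis DiffI fun_upd_apply singletonD)
      next
        case False
        then show ?thesis using ab regular_noteq[OF assms(1) ab(1,2)] by auto
      qed
    qed
  qed
qed

lemma polys_DERIV:
  assumes "f \<in> pspan n S" "inj_on x {1..n}" "j \<in> {1..n}"
  shows "(\<lambda>t. f (x(j := t))) field_differentiable (at (x j))"
  using assms(1)
proof induction
  case (lspan_zero f)
  have "eventually (\<lambda>t. 0 = f (x(j := t))) (nhds (x j))"
    using eventually_regular[OF assms(2,3)] by (rule eventually_mono) (use lspan_zero in auto)
  then have "((\<lambda>t. f (x(j := t))) has_field_derivative 0) (at (x j))"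
    using DERIV_cong_ev[of "x j" "x j" "\<lambda>_. 0" "\<lambda>t. f (x(j := t))" 0 0] by simp
  then show ?case unfolding field_differentiable_def by blast
next
  case (lspan_step f u h c)
  then obtain d where d: "((\<lambda>t. f (x(j := t))) has_field_derivative d) (at (x j))"
    unfolding field_differentiable_def by blast
  have "((\<lambda>t. f (x(j := t)) + c * xpow n u (x(j := t))) has_field_derivative
      d + c * (real (u j) * xpow n (u(j := u j - 1)) x)) (at (x j))"
    by (intro DERIV_add d DERIV_cmult DERIV_xpow assms)
  moreover have "eventually (\<lambda>t. f (x(j := t)) + c * xpow n u (x(j := t)) = h (x(j := t))) (nhds (x j))"
    using eventually_regular[OF assms(2,3)] by (rule eventually_mono) (use lspan_step in auto)
  ultimately show ?case
    using DERIV_cong_ev[OF refl _ refl, THEN iffD1] unfolding field_differentiable_def by fast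
qed

lemma deriv_regular_cong:
  fixes x :: point and f h :: "point \<Rightarrow> real"
  assumes "\<And>y. inj_on y {1..n} \<Longrightarrow> f y = h y" "inj_on x {1..n}" "j \<in> {1..n}"
  shows "deriv (\<lambda>t. f (x(j := t))) (x j) = deriv (\<lambda>t. h (x(j := t))) (x j)"
  by (rule deriv_cong_ev[OF _ refl], rule eventually_mono[OF eventually_regular[OF assms(2,3)]])
    (use assms in auto)

lemma ddiff_regular_cong:
  assumes "\<And>y. inj_on y {1..n} \<Longrightarrow> f y = h y" "inj_on x {1..n}" "j \<in> {1..n}" "k \<in> {1..n}"
  shows "ddiff j k f x = ddiff j k h x"
proof -
  have "inj_on (x \<circ> tr j k) {1..n}"
    using assms(2) regular_permute[OF tr_permutes[OF assms(3,4)]] by blast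
  then show ?thesis
    unfolding ddiff_def by (simp only: assms(1)[OF assms(2)] assms(1))
qed

lemma dunkl_regular_cong:
  assumes "\<And>y. inj_on y {1..n} \<Longrightarrow> f y = h y" "inj_on x {1..n}" "j \<in> {1..n}"
  shows "dunkl n g j f x = dunkl n g j h x"
  unfolding dunkl_def
  using deriv_regular_cong[of n f h x j] ddiff_regular_cong[of n f h x j] assms by simp

lemma ddiff_zero [simp]: "ddiff j k (\<lambda>x. 0) x = 0"
  by (simp add: ddiff_def)

lemma ddiff_add: "ddiff j k (\<lambda>x. f x + c * h x) x = ddiff j k f x + c * ddiff j k h x"
  by (simp add: ddiff_def field_simps add_divide_distrib diff_divide_distrib)

lemma dunkl_zero [simp]: "dunkl n g j (\<lambda>x. 0) x = 0"
  by (simp add: dunkl_def)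

lemma dunkl_add:
  assumes "f \<in> pspan n S" "h \<in> pspan n T" "inj_on x {1..n}" "j \<in> {1..n}"
  shows "dunkl n g j (\<lambda>x. f x + c * h x) x = dunkl n g j f x + c * dunkl n g j h x"
proof -
  note d = polys_DERIV[OF assms(1,3,4)] polys_DERIV[OF assms(2,3,4)]
  have "deriv (\<lambda>t. f (x(j := t)) + c * h (x(j := t))) (x j)
      = deriv (\<lambda>t. f (x(j := t))) (x j) + c * deriv (\<lambda>t. h (x(j := t))) (x j)"
    by (intro DERIV_imp_deriv DERIV_add DERIV_cmult) (use d in \<open>auto simp: DERIV_deriv_iff_field_differentiable\<close>)
  then show ?thesis
    by (simp add: dunkl_def ddiff_add sum.distrib sum_distrib_left algebra_simps)
qed

lemma dunkl_xpow_slower: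
  assumes "j \<in> {1..n}" "u \<in> expo n"
  shows "dunkl n g j (xpow n u) \<in> pspan n (slower n u)"
proof -
  have 1: "(\<lambda>x. real (u j) * xpow n (u(j := u j - 1)) x) \<in> pspan n (slower n u)"
  proof (cases "u j = 0")
    case True
    then show ?thesis by (auto intro: lspan_zero)
  next
    case False
    then show ?thesis using assms by (intro lspan_scale lspan_base slower_decrease) auto
  qed
  have "(\<lambda>x. real (u j) * xpow n (u(j := u j - 1)) x + g * (\<Sum>k\<in>{1..n}-{j}. ddiff j k (xpow n u) x))
      \<in> pspan n (slower n u)"
    using assms by (intro lspan_add[OF _ 1] lspan_scale lspan_sum ddiff_xpow_slower) auto
  then show ?thesis
    by (rule lspan_cong)
      (simp add: dunkl_def DERIV_imp_deriv[OF DERIV_xpow[OF assms(1)]])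
qed

lemma dunkl_image:
  assumes f: "f \<in> pspan n S" and j: "j \<in> {1..n}"
    and "\<And>v. v \<in> S \<Longrightarrow> dunkl n g j (xpow n v) \<in> pspan n T"
  shows "dunkl n g j f \<in> pspan n T"
  using f
proof (rule lspan_image)
  fix f v c and x :: point
  assume "f \<in> pspan n S" "v \<in> S" "inj_on x {1..n}"
  then show "dunkl n g j (\<lambda>x. f x + c * xpow n v x) x = dunkl n g j f x + c * dunkl n g j (xpow n v) x"
    by (rule dunkl_add[OF _ lspan_base _ j])
next
  fix f h :: "point \<Rightarrow> real" and x :: point
  assume "\<And>y. inj_on y {1..n} \<Longrightarrow> f y = h y" "inj_on x {1..n}"
  then show "dunkl n g j f x = dunkl n g j h x"
    by (rule dunkl_regular_cong[OF _ _ j])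
qed (use assms(3) in simp_all)

lemma dunkl_slower:
  assumes "f \<in> pspan n (lower n u)" and j: "j \<in> {1..n}"
  shows "dunkl n g j f \<in> pspan n (slower n u)"
  using assms
proof (rule dunkl_image)
  fix v assume v: "v \<in> lower n u"
  have "slower n v \<subseteq> slower n u"
    using v slower_lower_trans(1) unfolding lower_def by blast
  moreover have "dunkl n g j (xpow n v) \<in> pspan n (slower n v)"
    using v by (intro dunkl_xpow_slower j) (simp add: lower_def)
  ultimately show "dunkl n g j (xpow n v) \<in> pspan n (slower n u)"
    by (rule lspan_mono[rotated])
qed

lemma polys_dunkl:
  assumes "f \<in> polys n" "j \<in> {1..n}"
  shows "dunkl n g j f \<in> polys n"
  using assms by (rule dunkl_image) (rule polys_slower[OF dunkl_xpow_slower[OF assms(2)]])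

lemma polys_ddiff:
  assumes "f \<in> polys n" "j \<in> {1..n}" "k \<in> {1..n}" "j \<noteq> k"
  shows "ddiff j k f \<in> polys n"
  using assms(1)
proof (rule lspan_image)
  fix v assume "v \<in> expo n"
  then show "ddiff j k (xpow n v) \<in> polys n"
    using ddiff_xpow_slower[OF assms(2-4)] by (intro polys_slower)
next
  fix f h :: "point \<Rightarrow> real" and x :: point
  assume "\<And>y. inj_on y {1..n} \<Longrightarrow> f y = h y" "inj_on x {1..n}"
  then show "ddiff j k f x = ddiff j k h x"
    by (rule ddiff_regular_cong[OF _ _ assms(2,3)])
qed (simp_all add: ddiff_add)

text \<open>The derivative part becomes an Euler operator with eigenvalue u j; the rest is
  \<open>var_ddiff_xpow\<close> summed over k.\<close>

lemma var_dunkl_xpow: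
  assumes j: "j \<in> {1..n}" and "u \<in> expo n"
  shows "(\<lambda>x. x j * dunkl n g j (xpow n u) x - (real (u j) * xpow n u x +
      g * (\<Sum>k\<in>{1..n}-{j}. (if u k < u j then xpow n u x else 0) -
       (if u j < u k then xpow n (u \<circ> tr j k) x else 0))))
    \<in> pspan n (slower n u)"
proof -
  have "(\<lambda>x. g * (\<Sum>k\<in>{1..n}-{j}. x j * ddiff j k (xpow n u) x -
      ((if u k < u j then xpow n u x else 0) -
       (if u j < u k then xpow n (u \<circ> tr j k) x else 0)))) \<in> pspan n (slower n u)"
    using assms by (intro lspan_scale lspan_sum var_ddiff_xpow) auto
  moreover have "x j * dunkl n g j (xpow n u) x
      = real (u j) * xpow n u x + g * (\<Sum>k\<in>{1..n}-{j}. x j * ddiff j k (xpow n u) x)" for x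
  proof -
    have "x j * (real (u j) * xpow n (u(j := u j - 1)) x) = real (u j) * xpow n u x"
      using xpow_mult_var[OF j, of x "u(j := u j - 1)"] by (cases "u j = 0") (auto simp: mult_ac)
    then show ?thesis
      unfolding dunkl_def DERIV_imp_deriv[OF DERIV_xpow[OF j]] distrib_left
      by (simp add: sum_distrib_left mult.left_commute)
  qed
  ultimately show ?thesis
    by (elim lspan_cong) (simp add: right_diff_distrib sum_subtractf)
qed

section \<open>Symmetric triangular operators\<close>

lemma lspan_if: "(P \<Longrightarrow> f \<in> lspan n b S) \<Longrightarrow> (\<lambda>x. if P then f x else 0) \<in> lspan n b S"
  by (cases P) (auto intro: lspan_zero)

text \<open>Ties are broken by the index because \<open>xi\<close> contains g times the
  transposition of j and k for k < j, and this transposition fixes the monomial when u k = u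
  j.\<close>

definition rank_at :: "nat \<Rightarrow> (nat \<Rightarrow> nat) \<Rightarrow> nat \<Rightarrow> nat" where
  "rank_at n u j = card {k\<in>{1..n}. u k < u j \<or> u k = u j \<and> k < j}"

text \<open>
  For g > 0 the shifted values are ordered like the pairs (u k, k), lexicographically, so they
  determine the ranks.
\<close>

lemma rank_shift_inject:
  fixes g :: real
  assumes "g \<ge> 0"
    and eq: "\<And>j. j \<in> {1..n} \<Longrightarrow> real (u j) + g * real (rank_at n u j) = real (v j) + g * real (rank_at n v j)"
    and j: "j \<in> {1..n}"
  shows "u j = v j"
proof (cases "g = 0")
  case True
  then show ?thesis using eq[OF j] by simp
next
  case False
  define E where "E u j = real (u j) + g * real (rank_at n u j)" for u :: "nat \<Rightarrow> nat" and j
  have lt: "E u k < E u j"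
    if "k \<in> {1..n}" "u k < u j \<or> u k = u j \<and> k < j" for u j k
  proof -
    have "rank_at n u k < rank_at n u j"
      unfolding rank_at_def using that by (intro psubset_card_mono) auto
    then show ?thesis
      using that False assms(1) unfolding E_def by (intro add_le_less_mono mult_strict_left_mono) auto
  qed
  have rank: "rank_at n u j = card {k\<in>{1..n}. E u k < E u j}" if "j \<in> {1..n}" for u j
    unfolding rank_at_def
  proof (rule arg_cong[of _ _ card], intro Collect_cong conj_cong refl iffI)
    fix k assume "k \<in> {1..n}" "E u k < E u j"
    then show "u k < u j \<or> u k = u j \<and> k < j"
      using lt[OF that, of u k] by (cases k j rule: linorder_cases) force+
  qed (use lt in auto)
  have "{k\<in>{1..n}. E u k < E u j} = {k\<in>{1..n}. E v k < E v j}"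
    using eq j unfolding E_def by auto
  then have "rank_at n u j = rank_at n v j"
    using rank[OF j] by simp
  then show ?thesis using eq[OF j] by simp
qed

text \<open>Common interface for both weights. \<open>L_nonneg\<close> gives semidefiniteness, so
  identities between polynomials are asserted up to vectors of norm zero, that is, after pairing
  with a test polynomial.\<close>

locale dunkl_form =
  fixes n :: nat and g :: real and L :: "(point \<Rightarrow> real) \<Rightarrow> real" and \<alpha> \<beta> s :: real
  assumes g_nonneg: "g \<ge> 0"
    and L_cong: "\<And>f h. (\<And>x. inj_on x {1..n} \<Longrightarrow> f x = h x) \<Longrightarrow> L f = L h"
    and L_add: "\<And>f h. f \<in> polys n \<Longrightarrow> h \<in> polys n \<Longrightarrow> L (\<lambda>x. f x + h x) = L f + L h"
    and L_scale: "\<And>f c. f \<in> polys n \<Longrightarrow> L (\<lambda>x. c * f x) = c * L f"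
    and L_permute: "\<And>f p. p permutes {1..n} \<Longrightarrow> f \<in> polys n \<Longrightarrow> L (\<lambda>x. f (x \<circ> p)) = L f"
    and L_nonneg: "\<And>f. f \<in> polys n \<Longrightarrow> 0 \<le> L (\<lambda>x. f x * f x)"
    and stein_xpow: "\<And>j u. j \<in> {1..n} \<Longrightarrow> u \<in> expo n \<Longrightarrow>
      L (dunkl n g j (\<lambda>x. (\<alpha> + \<beta> * x j) * xpow n u x)) = L (\<lambda>x. (x j + s) * xpow n u x)"
begin

abbreviation "D \<equiv> dunkl n g"

abbreviation "ip f h \<equiv> L (\<lambda>x. f x * h x)"

section \<open>Linear algebra of a semidefinite pairing\<close>

lemma L_zero: "(\<And>x. inj_on x {1..n} \<Longrightarrow> f x = 0) \<Longrightarrow> L f = 0"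
  using L_cong[of f "\<lambda>x. 0 * 0"] L_scale[OF polys_const, of 0 0] by simp

lemma L_diff: "f \<in> polys n \<Longrightarrow> h \<in> polys n \<Longrightarrow> L (\<lambda>x. f x - h x) = L f - L h"
  using L_add[of f "\<lambda>x. (-1) * h x"] L_scale[of h "-1"] lspan_scale[of h n "xpow n" "expo n" "-1"] by simp

lemma L_sum: "finite A \<Longrightarrow> (\<And>i. i \<in> A \<Longrightarrow> f i \<in> polys n) \<Longrightarrow> L (\<lambda>x. \<Sum>i\<in>A. f i x) = (\<Sum>i\<in>A. L (f i))"
proof (induction A rule: finite_induct)
  case empty
  then show ?case by (simp add: L_zero)
next
  case (insert a A)
  then show ?case by (simp add: L_add lspan_sum)
qed

lemma L_lincomb:
  assumes "f \<in> polys n" "f' \<in> polys n" "h \<in> polys n"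
  shows "L (\<lambda>x. (f x + c * f' x) * h x) = ip f h + c * ip f' h"
proof -
  have "L (\<lambda>x. f x * h x + c * (f' x * h x)) = ip f h + c * ip f' h"
    using assms by (subst L_add) (auto intro!: polys_mult lspan_scale simp: L_scale[OF polys_mult])
  then show ?thesis by (simp add: algebra_simps)
qed

lemma L_commute: "ip f h = ip h f"
  by (simp add: mult.commute)

lemma L_lspan_zero:
  assumes "f \<in> lspan n b S" "h \<in> polys n" "\<And>i. i \<in> S \<Longrightarrow> b i \<in> polys n"
    and "\<And>i. i \<in> S \<Longrightarrow> ip h (b i) = 0"
  shows "ip h f = 0"
  using assms(1)
proof induction
  case (lspan_zero f)
  then show ?case by (intro L_zero) auto
next
  case (lspan_step f i f' c)
  have "f \<in> polys n" using lspan_step(1) assms(3) by (rule lspan_trans)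
  have "ip h f' = L (\<lambda>x. (f x + c * b i x) * h x)"
    using lspan_step by (intro L_cong) auto
  also have "\<dots> = ip f h + c * ip (b i) h"
    using \<open>f \<in> polys n\<close> lspan_step assms by (intro L_lincomb) auto
  finally show ?case
    using lspan_step assms(4)[of i] by (simp add: L_commute[of f] L_commute[of "b i"])
qed

text \<open>The Cauchy-Schwarz inequality for a null vector: the squared norm of h + t f is affine
  in t and nonnegative for all t, which forces the slope to vanish.\<close>

lemma L_null:
  assumes f: "f \<in> polys n" and h: "h \<in> polys n" and null: "ip f f = 0"
  shows "ip f h = 0"
proof -
  let ?a = "ip f h" and ?b = "ip h h"
  have ineq: "0 \<le> 2 * t * ?a + ?b" for t
  proof -
    have p: "(\<lambda>x. h x + t * f x) \<in> polys n"
      using f h by (intro lspan_add lspan_scale)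
    have "0 \<le> L (\<lambda>x. (h x + t * f x) * (h x + t * f x))"
      by (rule L_nonneg[OF p])
    also have "\<dots> = L (\<lambda>x. h x * (h x + t * f x)) + t * L (\<lambda>x. f x * (h x + t * f x))"
      by (rule L_lincomb[OF h f p])
    also have "L (\<lambda>x. h x * (h x + t * f x)) = ?b + t * ?a"
      using L_lincomb[OF h f h, of t] L_commute[of h "\<lambda>x. h x + t * f x"] by simp
    also have "L (\<lambda>x. f x * (h x + t * f x)) = ?a + t * 0"
      using L_lincomb[OF h f f, of t] null L_commute[of f "\<lambda>x. h x + t * f x"]
        L_commute[of f h] by simp
    finally show ?thesis by (simp add: algebra_simps)
  qed
  show ?thesis
  proof (rule ccontr)
    assume "?a \<noteq> 0"
    \<comment> \<open>This t gives the affine expression the value -1.\<close>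
    then show False using ineq[of "- (?b + 1) / (2 * ?a)"] by (simp add: field_simps)
  qed
qed

text \<open>Gram-Schmidt for a semidefinite form and possibly dependent b i: the new vector b a and
  the target f are both projected off S first, and then f is corrected along the remainder e of b
  a.\<close>

lemma orthogonal_projection:
  assumes "finite S" "\<And>i. i \<in> S \<Longrightarrow> b i \<in> polys n" "f \<in> polys n"
  shows "\<exists>v\<in>lspan n b S. \<forall>i\<in>S. L (\<lambda>x. (f x - v x) * b i x) = 0"
  using assms
proof (induction S arbitrary: f rule: finite_induct)
  case empty
  then show ?case by (auto intro!: bexI[of _ "\<lambda>_. 0"] lspan_zero)
next
  case (insert a S)
  have bS: "\<And>i. i \<in> S \<Longrightarrow> b i \<in> polys n" and ba: "b a \<in> polys n"
    using insert by auto
  have inP: "h \<in> polys n" if "h \<in> lspan n b S" for h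
    using that bS by (rule lspan_trans)
  obtain w where w: "w \<in> lspan n b S" "\<forall>i\<in>S. L (\<lambda>x. (b a x - w x) * b i x) = 0"
    using insert.IH[OF bS ba] by blast
  obtain v where v: "v \<in> lspan n b S" "\<forall>i\<in>S. L (\<lambda>x. (f x - v x) * b i x) = 0"
    using insert.IH[OF bS insert.prems(2)] by blast
  define e where "e x = b a x - w x" for x
  define d where "d x = f x - v x" for x
  have eP: "e \<in> polys n" and dP: "d \<in> polys n"
    unfolding e_def d_def using ba w(1) v(1) insert.prems inP by (auto intro!: lspan_diff)
  \<comment> \<open>A null e is orthogonal to d by \<open>L_null\<close>, so the coefficient 0 works
    in that case.\<close>
  define c where "c = (if ip e e = 0 then 0 else ip d e / ip e e)"
  have ce: "ip d e = c * ip e e"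
    using L_null[OF eP dP] by (auto simp: c_def L_commute[of d])
  define r where "r x = d x + (- c) * e x" for x
  have rP: "r \<in> polys n"
    unfolding r_def using dP eP by (intro lspan_add lspan_scale)
  have rS: "ip r (b i) = 0" if "i \<in> S" for i
    unfolding r_def using L_lincomb[OF dP eP bS[OF that], of "-c"] v(2) w(2) that
    by (simp add: e_def d_def)
  have re: "ip r e = 0"
    unfolding r_def using L_lincomb[OF dP eP eP, of "-c"] ce by simp
  have rw: "ip r w = 0"
    using w(1) rP bS rS by (rule L_lspan_zero)
  have ra: "ip r (b a) = 0"
  proof -
    have "L (\<lambda>x. (e x + 1 * w x) * r x) = ip e r + 1 * ip w r"
      by (rule L_lincomb[OF eP inP[OF w(1)] rP])
    then have "ip (b a) r = 0"
      using re rw by (simp add: L_commute[of r] e_def)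
    then show ?thesis by (simp add: L_commute[of r])
  qed
  have "(\<lambda>x. v x + c * e x) \<in> lspan n b (insert a S)"
    unfolding e_def using v(1) w(1)
    by (intro lspan_add lspan_scale lspan_diff lspan_base) (auto elim: lspan_mono)
  moreover have "f x - (v x + c * e x) = r x" for x
    by (simp add: r_def d_def)
  ultimately show ?case
    using rS ra by (intro bexI[of _ "\<lambda>x. v x + c * e x"]) auto
qed

section \<open>Integration by parts and symmetric operators\<close>

lemma affine_polys: "j \<in> {1..n} \<Longrightarrow> (\<lambda>x. a + c * x j) \<in> polys n"
  by (intro lspan_add polys_const lspan_scale polys_var)

lemma shift_polys: "j \<in> {1..n} \<Longrightarrow> (\<lambda>x. x j + a) \<in> polys n"
  by (intro lspan_add polys_const polys_var)

lemma stein: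
  assumes j: "j \<in> {1..n}" and "f \<in> polys n"
  shows "L (D j (\<lambda>x. (\<alpha> + \<beta> * x j) * f x)) = L (\<lambda>x. (x j + s) * f x)"
  using assms(2)
proof induction
  case (lspan_zero f)
  have "L (D j (\<lambda>x. (\<alpha> + \<beta> * x j) * f x)) = L (D j (\<lambda>x. 0))"
    using lspan_zero by (intro L_cong dunkl_regular_cong[OF _ _ j]) auto
  moreover have "L (\<lambda>x. (x j + s) * f x) = 0"
    using lspan_zero by (intro L_zero) auto
  ultimately show ?case by (simp add: L_zero)
next
  case (lspan_step f u h c)
  let ?q = "\<lambda>x. \<alpha> + \<beta> * x j" and ?r = "\<lambda>x. x j + s"
  have u: "xpow n u \<in> polys n" using lspan_step by (intro lspan_base)
  have q: "(\<lambda>x. ?q x * f x) \<in> polys n" "(\<lambda>x. ?q x * xpow n u x) \<in> polys n"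
    using u lspan_step j by (auto intro!: polys_mult affine_polys)
  have "L (D j (\<lambda>x. ?q x * h x)) =
      L (\<lambda>x. D j (\<lambda>x. ?q x * f x) x + c * D j (\<lambda>x. ?q x * xpow n u x) x)"
  proof (rule L_cong)
    fix x :: point assume x: "inj_on x {1..n}"
    have "D j (\<lambda>x. ?q x * h x) x
        = D j (\<lambda>x. ?q x * f x + c * (?q x * xpow n u x)) x"
      using lspan_step by (intro dunkl_regular_cong[OF _ x j]) (simp add: algebra_simps)
    then show "D j (\<lambda>x. ?q x * h x) x
        = D j (\<lambda>x. ?q x * f x) x + c * D j (\<lambda>x. ?q x * xpow n u x) x"
      using dunkl_add[OF q x j, of g c] by simp
  qed
  also have "\<dots> = L (D j (\<lambda>x. ?q x * f x)) + c * L (D j (\<lambda>x. ?q x * xpow n u x))"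
    using polys_dunkl[OF q(1) j] polys_dunkl[OF q(2) j] by (simp add: L_add lspan_scale L_scale)
  also have "\<dots> = ip ?r f + c * ip ?r (xpow n u)"
    using lspan_step j by (simp add: stein_xpow)
  also have "\<dots> = L (\<lambda>x. (f x + c * xpow n u x) * ?r x)"
    using L_lincomb[OF lspan_step(1) u shift_polys[OF j], of c s] by (simp add: mult.commute)
  also have "\<dots> = ip ?r h"
    using lspan_step by (intro L_cong) auto
  finally show ?case .
qed

text \<open>
  The defect of the product rule changes sign under the transposition of j and k.
\<close>

lemma leibniz:
  assumes j: "j \<in> {1..n}" and f: "f \<in> polys n" and h: "h \<in> polys n"
  shows "L (D j (\<lambda>x. f x * h x)) = L (\<lambda>x. D j f x * h x) + L (\<lambda>x. f x * D j h x)"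
proof -
  define q where "q k x = ddiff j k f x * (h x - h (x \<circ> tr j k))" for k x
  have qP: "q k \<in> polys n" if "k \<in> {1..n}-{j}" for k
    unfolding q_def
    by (rule polys_mult[OF polys_ddiff[OF f j] lspan_diff[OF h polys_permute[OF tr_permutes h]]])
      (use that j in auto)
  have q0: "L (q k) = 0" if k: "k \<in> {1..n}-{j}" for k
  proof -
    have perm: "tr j k permutes {1..n}"
      using j k by (intro tr_permutes) auto
    have "L (\<lambda>x. q k (x \<circ> tr j k)) = L (\<lambda>x. (-1) * q k x)"
    proof (rule L_cong)
      fix x :: point
      have "x \<circ> tr j k \<circ> tr j k = x"
        by (simp add: o_assoc[symmetric])
      \<comment> \<open>For x j = x k both quotients are 0, by the value of division by
        zero.\<close>
      moreover have "ddiff j k f (x \<circ> tr j k) = ddiff j k f x"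
        by (cases "x j = x k") (simp_all add: ddiff_def calculation field_simps)
      ultimately show "q k (x \<circ> tr j k) = (-1) * q k x"
        by (simp add: q_def algebra_simps)
    qed
    then show ?thesis
      using L_permute[OF perm qP[OF k]] L_scale[OF qP[OF k], of "-1"] by simp
  qed
  note P = polys_mult[OF polys_dunkl[OF f j] h] polys_mult[OF f polys_dunkl[OF h j]]
  have "L (D j (\<lambda>x. f x * h x)) =
      L (\<lambda>x. (D j f x * h x + f x * D j h x) - g * (\<Sum>k\<in>{1..n}-{j}. q k x))"
  proof (rule L_cong)
    fix x :: point assume x: "inj_on x {1..n}"
    have d: "deriv (\<lambda>t. f (x(j := t)) * h (x(j := t))) (x j)
        = deriv (\<lambda>t. f (x(j := t))) (x j) * h (x(j := x j)) + f (x(j := x j)) * deriv (\<lambda>t. h (x(j := t))) (x j)"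
      using polys_DERIV[OF f x j] polys_DERIV[OF h x j]
      by (simp add: algebra_simps)
    have "ddiff j k (\<lambda>x. f x * h x) x = ddiff j k f x * h x + f x * ddiff j k h x - q k x" for k
      by (simp add: q_def ddiff_def diff_divide_distrib algebra_simps)
    then have sm: "(\<Sum>k\<in>{1..n}-{j}. ddiff j k (\<lambda>x. f x * h x) x) = (\<Sum>k\<in>{1..n}-{j}. ddiff j k f x) * h x
        + f x * (\<Sum>k\<in>{1..n}-{j}. ddiff j k h x) - (\<Sum>k\<in>{1..n}-{j}. q k x)"
      by (simp only: sum.distrib sum_subtractf sum_distrib_left sum_distrib_right)
    show "D j (\<lambda>x. f x * h x) x =
        (D j f x * h x + f x * D j h x) - g * (\<Sum>k\<in>{1..n}-{j}. q k x)"
      unfolding dunkl_def d sm by (simp add: algebra_simps)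
  qed
  also have "\<dots> = L (\<lambda>x. D j f x * h x) + L (\<lambda>x. f x * D j h x)
      - L (\<lambda>x. g * (\<Sum>k\<in>{1..n}-{j}. q k x))"
    by (subst L_diff) (auto intro!: lspan_add lspan_scale lspan_sum qP P simp: L_add[OF P])
  also have "L (\<lambda>x. g * (\<Sum>k\<in>{1..n}-{j}. q k x)) = 0"
  proof -
    have "L (\<lambda>x. \<Sum>k\<in>{1..n}-{j}. q k x) = (\<Sum>k\<in>{1..n}-{j}. L (q k))"
      using qP by (intro L_sum) auto
    also have "\<dots> = 0"
      using q0 by (intro sum.neutral) blast
    finally show ?thesis
      using L_scale[OF lspan_sum, of "{1..n}-{j}" q g] qP by simp
  qed
  finally show ?thesis by simp
qed

text \<open>The first two terms pair as the Dirichlet form L ((\<alpha> + \<beta> * y j) * D j f * D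
  j h). The transpositions over k < j, themselves symmetric, cancel those produced by y j * D j when
  k < j and u j < u k; the transpositions of unequal entries that remain always move the larger
  entry to the smaller index.\<close>

definition xi :: "nat \<Rightarrow> (point \<Rightarrow> real) \<Rightarrow> point \<Rightarrow> real" where
  "xi j f x = (x j + s) * D j f x - D j (\<lambda>y. (\<alpha> + \<beta> * y j) * D j f y) x
     + g * (\<Sum>k\<in>{1..<j}. f (x \<circ> tr j k))"

lemma xi_zero [simp]: "xi j (\<lambda>x. 0) x = 0"
  by (simp add: xi_def)

lemma xi_regular_cong:
  assumes "\<And>y. inj_on y {1..n} \<Longrightarrow> f y = h y" "inj_on x {1..n}" "j \<in> {1..n}"
  shows "xi j f x = xi j h x"
proof -
  have d: "D j f y = D j h y" if "inj_on y {1..n}" for y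
    using assms(1) that assms(3) by (rule dunkl_regular_cong)
  have "D j (\<lambda>y. (\<alpha> + \<beta> * y j) * D j f y) x
      = D j (\<lambda>y. (\<alpha> + \<beta> * y j) * D j h y) x"
    by (rule dunkl_regular_cong[OF _ assms(2,3)]) (simp add: d)
  moreover have "f (x \<circ> tr j k) = h (x \<circ> tr j k)" if "k \<in> {1..<j}" for k
  proof (rule assms(1))
    have "tr j k permutes {1..n}"
      using assms(3) that by (intro tr_permutes) auto
    then show "inj_on (x \<circ> tr j k) {1..n}"
      using assms(2) regular_permute by blast
  qed
  ultimately show ?thesis
    unfolding xi_def by (simp add: d[OF assms(2)])
qed

lemma xi_add:
  assumes "f \<in> polys n" "h \<in> polys n" "inj_on x {1..n}" "j \<in> {1..n}"
  shows "xi j (\<lambda>x. f x + c * h x) x = xi j f x + c * xi j h x"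
proof -
  let ?q = "\<lambda>y. \<alpha> + \<beta> * y j"
  have q: "(\<lambda>y. ?q y * D j f y) \<in> polys n" "(\<lambda>y. ?q y * D j h y) \<in> polys n"
    using assms by (auto intro!: polys_mult affine_polys polys_dunkl)
  have "D j (\<lambda>y. ?q y * D j (\<lambda>x. f x + c * h x) y) x
      = D j (\<lambda>y. ?q y * D j f y + c * (?q y * D j h y)) x"
    by (rule dunkl_regular_cong[OF _ assms(3,4)])
      (simp add: dunkl_add[OF assms(1,2) _ assms(4)] algebra_simps)
  then show ?thesis
    unfolding xi_def dunkl_add[OF assms] using dunkl_add[OF q assms(3,4), of g c]
    by (simp add: sum.distrib sum_distrib_left algebra_simps)
qed

lemma polys_xi:
  assumes "f \<in> polys n" and j: "j \<in> {1..n}"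
  shows "xi j f \<in> polys n"
proof -
  note D = polys_dunkl[OF assms]
  have "(\<lambda>x. f (x \<circ> tr j k)) \<in> polys n" if "k \<in> {1..<j}" for k
    by (rule polys_permute[OF tr_permutes assms(1)]) (use j that in auto)
  then have "(\<lambda>x. g * (\<Sum>k\<in>{1..<j}. f (x \<circ> tr j k))) \<in> polys n"
    by (intro lspan_scale lspan_sum)
  moreover have "D j (\<lambda>y. (\<alpha> + \<beta> * y j) * D j f y) \<in> polys n"
    by (intro polys_dunkl polys_mult affine_polys j D)
  moreover have "(\<lambda>x. (x j + s) * D j f x) \<in> polys n"
    by (intro polys_mult shift_polys j D)
  ultimately show ?thesis
    unfolding xi_def by (intro lspan_add lspan_diff)
qed

text \<open>Pairing with \<open>xi\<close> reduces to the form B: \<open>stein\<close> trades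
  multiplication by x j + s for a derivative of a product, \<open>leibniz\<close> expands it, and
  one of the two terms cancels against the second-order part of \<open>xi\<close>. B is symmetric as
  L is invariant under transpositions, which are involutions.\<close>

lemma xi_selfadjoint:
  assumes j: "j \<in> {1..n}" and f: "f \<in> polys n" and h: "h \<in> polys n"
  shows "ip (xi j f) h = ip f (xi j h)"
proof -
  define B where "B f h = L (\<lambda>x. (\<alpha> + \<beta> * x j) * D j f x * D j h x)
    + g * (\<Sum>k\<in>{1..<j}. L (\<lambda>x. f (x \<circ> tr j k) * h x))" for f h
  have eq: "ip (xi j f) h = B f h" if f: "f \<in> polys n" and h: "h \<in> polys n" for f h
  proof -
    let ?q = "\<lambda>x. \<alpha> + \<beta> * x j"
    note D = polys_dunkl[OF f j] polys_dunkl[OF h j]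
    have qD: "(\<lambda>x. ?q x * D j f x) \<in> polys n"
      by (rule polys_mult[OF affine_polys[OF j] D(1)])
    have T: "(\<lambda>x. f (x \<circ> tr j k) * h x) \<in> polys n" if "k \<in> {1..<j}" for k
      by (rule polys_mult[OF polys_permute[OF tr_permutes f] h]) (use that j in auto)
    have P1: "(\<lambda>x. (x j + s) * (D j f x * h x)) \<in> polys n"
      by (rule polys_mult[OF shift_polys[OF j] polys_mult[OF D(1) h]])
    have P2: "(\<lambda>x. D j (\<lambda>x. ?q x * D j f x) x * h x) \<in> polys n"
      by (rule polys_mult[OF polys_dunkl[OF qD j] h])
    have P3: "(\<lambda>x. g * (\<Sum>k\<in>{1..<j}. f (x \<circ> tr j k) * h x)) \<in> polys n"
      using T by (intro lspan_scale lspan_sum)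
    have "ip (xi j f) h = L (\<lambda>x. (x j + s) * (D j f x * h x)
        - D j (\<lambda>x. ?q x * D j f x) x * h x
        + g * (\<Sum>k\<in>{1..<j}. f (x \<circ> tr j k) * h x))"
      unfolding xi_def by (simp only: ring_distribs mult.assoc sum_distrib_right left_diff_distrib)
    also have "\<dots> = L (\<lambda>x. (x j + s) * (D j f x * h x))
        - L (\<lambda>x. D j (\<lambda>x. ?q x * D j f x) x * h x)
        + L (\<lambda>x. g * (\<Sum>k\<in>{1..<j}. f (x \<circ> tr j k) * h x))"
      using L_add[OF lspan_diff[OF P1 P2] P3] L_diff[OF P1 P2] by simp
    also have "L (\<lambda>x. g * (\<Sum>k\<in>{1..<j}. f (x \<circ> tr j k) * h x))
        = g * (\<Sum>k\<in>{1..<j}. L (\<lambda>x. f (x \<circ> tr j k) * h x))"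
      by (subst L_scale, intro lspan_sum T, assumption, subst L_sum, simp_all add: T)
    also have "L (\<lambda>x. (x j + s) * (D j f x * h x))
        = L (D j (\<lambda>x. ?q x * (D j f x * h x)))"
      by (rule stein[OF j polys_mult[OF D(1) h], symmetric])
    also have "\<dots> = L (D j (\<lambda>x. (?q x * D j f x) * h x))"
      by (simp add: mult.assoc)
    also have "\<dots> = L (\<lambda>x. D j (\<lambda>x. ?q x * D j f x) x * h x)
        + L (\<lambda>x. ?q x * D j f x * D j h x)"
      by (rule leibniz[OF j qD h])
    finally show ?thesis unfolding B_def by linarith
  qed
  have "L (\<lambda>x. f (x \<circ> tr j k) * h x) = L (\<lambda>x. h (x \<circ> tr j k) * f x)"
    if "k \<in> {1..<j}" for k
  proof -
    have perm: "tr j k permutes {1..n}"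
      using j that by (intro tr_permutes) auto
    have "L (\<lambda>x. f (x \<circ> tr j k) * h x) =
        L (\<lambda>x. f ((x \<circ> tr j k) \<circ> tr j k) * h (x \<circ> tr j k))"
      using L_permute[OF perm polys_mult[OF polys_permute[OF perm f] h]] by simp
    then show ?thesis by (simp add: o_assoc[symmetric] mult.commute)
  qed
  then have "B f h = B h f"
    by (simp add: B_def mult_ac)
  then show ?thesis
    using eq[OF f h] eq[OF h f] by (simp add: L_commute[of f])
qed

section \<open>Triangularity on monomials\<close>

definition eig :: "(nat \<Rightarrow> nat) \<Rightarrow> nat \<Rightarrow> real" where
  "eig u j = real (u j) + g * real (rank_at n u j)"

text \<open>Nonzero only where the transposition moves the larger entry to the smaller index, hence
  lowers \<open>disorder\<close>.\<close>

definition offdiag :: "(nat \<Rightarrow> nat) \<Rightarrow> nat \<Rightarrow> nat \<Rightarrow> real" where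
  "offdiag u j k = (if k < j \<and> u k < u j then g else if j < k \<and> u j < u k then - g else 0)"

text \<open>The family b is a parameter because the formula is applied to the monomials, to their
  projected versions \<open>upoly\<close> and to the differences of the two.\<close>

definition tri :: "((nat \<Rightarrow> nat) \<Rightarrow> point \<Rightarrow> real) \<Rightarrow> (nat \<Rightarrow> nat) \<Rightarrow> nat \<Rightarrow> point \<Rightarrow> real" where
  "tri b u j x = eig u j * b u x + (\<Sum>k\<in>{1..n}-{j}. offdiag u j k * b (u \<circ> tr j k) x)"

lemma tri_lspan:
  assumes "b u \<in> pspan n S" "\<And>k. k \<in> {1..n}-{j} \<Longrightarrow> b (u \<circ> tr j k) \<in> pspan n S"
  shows "tri b u j \<in> pspan n S"
  unfolding tri_def[abs_def] using assms by (intro lspan_add lspan_scale lspan_sum)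

lemma xi_triangular:
  assumes j: "j \<in> {1..n}" and u: "u \<in> expo n"
  shows "(\<lambda>x. xi j (xpow n u) x - tri (xpow n) u j x) \<in> pspan n (slower n u)"
proof -
  let ?D = "D j (xpow n u)" and ?S = "slower n u"
  let ?M = "\<lambda>x k. xpow n (u \<circ> tr j k) x"
  have D: "?D \<in> pspan n ?S"
    by (rule dunkl_xpow_slower[OF j u])
  \<comment> \<open>The part of x j * D j supported on u and its transposes; the other differential
    terms of \<open>xi\<close> end up in the span of the smaller monomials.\<close>
  define lead where "lead x = real (u j) * xpow n u x +
      g * (\<Sum>k\<in>{1..n}-{j}. (if u k < u j then xpow n u x else 0) - (if u j < u k then ?M x k else 0))" for x
  have V: "(\<lambda>x. x j * ?D x - lead x) \<in> pspan n ?S"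
    unfolding lead_def by (rule var_dunkl_xpow[OF j u])
  have "lead \<in> pspan n (lower n u)"
    unfolding lead_def using u j
    by (intro lspan_add lspan_scale lspan_sum lspan_diff lspan_if lspan_base lower_permute tr_permutes)
      (auto simp: lower_def)
  \<comment> \<open>The factor x j may undo the descent made by the inner D j, but the outer D j
    descends strictly again.\<close>
  then have "(\<lambda>x. (x j * ?D x - lead x) + lead x) \<in> pspan n (lower n u)"
    using lspan_mono[OF V slower_lower] by (intro lspan_add)
  then have "(\<lambda>x. \<alpha> * ?D x + \<beta> * (x j * ?D x)) \<in> pspan n (lower n u)"
    using lspan_mono[OF D slower_lower] by (intro lspan_add lspan_scale) simp_all
  then have "(\<lambda>x. (\<alpha> + \<beta> * x j) * ?D x) \<in> pspan n (lower n u)"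
    by (simp add: algebra_simps)
  then have "D j (\<lambda>x. (\<alpha> + \<beta> * x j) * ?D x) \<in> pspan n ?S"
    by (rule dunkl_slower[OF _ j])
  then have "(\<lambda>x. (x j * ?D x - lead x) + s * ?D x - D j (\<lambda>x. (\<alpha> + \<beta> * x j) * ?D x) x)
      \<in> pspan n ?S"
    by (rule lspan_diff[OF lspan_add[OF lspan_scale[OF D] V]])
  then show ?thesis
  proof (rule lspan_cong)
    fix x :: point
    have regroup: "(y + s) * d - e + b - ((h + c) * z + o') = (y * d - (h * z + a)) + s * d - e"
      if "a + b = c * z + o'" for a b c d e h y z o' :: real
      using that by (simp add: algebra_simps)
    have "real (rank_at n u j) * xpow n u x
        = (\<Sum>k\<in>{1..n}. if u k < u j \<or> u k = u j \<and> k < j then xpow n u x else 0)"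
      by (simp add: rank_at_def sum.If_cases Int_def conj_commute)
    also have "\<dots> = (\<Sum>k\<in>{1..n}-{j}. if u k < u j \<or> u k = u j \<and> k < j then xpow n u x else 0)"
      by (rule sum.mono_neutral_right) auto
    finally have 1: "g * real (rank_at n u j) * xpow n u x
        = (\<Sum>k\<in>{1..n}-{j}. if u k < u j \<or> u k = u j \<and> k < j then g * xpow n u x else 0)"
      by (simp add: sum_distrib_left if_distrib mult.assoc cong: if_cong)
    have "(\<Sum>k\<in>{1..<j}. xpow n u (x \<circ> tr j k)) = (\<Sum>k\<in>{1..<j}. ?M x k)"
      using j by (intro sum.cong refl xpow_transpose) auto
    also have "\<dots> = (\<Sum>k\<in>{1..n}-{j}. if k < j then ?M x k else 0)"
      using j by (intro sum.mono_neutral_cong_left) auto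
    finally have 2: "g * (\<Sum>k\<in>{1..<j}. xpow n u (x \<circ> tr j k))
        = (\<Sum>k\<in>{1..n}-{j}. if k < j then g * ?M x k else 0)"
      by (simp add: sum_distrib_left if_distrib cong: if_cong)
    \<comment> \<open>For k < j and u j < u k the two transposed monomials cancel. For k < j and u k
      = u j the transposition fixes u, which is the tie counted by \<open>rank_at\<close>.\<close>
    have pt: "g * ((if u k < u j then xpow n u x else 0) - (if u j < u k then ?M x k else 0))
        + (if k < j then g * ?M x k else 0)
        = (if u k < u j \<or> u k = u j \<and> k < j then g * xpow n u x else 0) + offdiag u j k * ?M x k"
      if "k \<in> {1..n}-{j}" for k
    proof (cases "u k = u j")
      case True
      then have "u \<circ> tr j k = u"
        by (auto simp: comp_tr fun_eq_iff)
      then show ?thesis using True by (simp add: offdiag_def)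
    next
      case False
      then show ?thesis using that by (auto simp: offdiag_def algebra_simps)
    qed
    have "g * (\<Sum>k\<in>{1..n}-{j}. (if u k < u j then xpow n u x else 0) - (if u j < u k then ?M x k else 0))
       + g * (\<Sum>k\<in>{1..<j}. xpow n u (x \<circ> tr j k))
       = (\<Sum>k\<in>{1..n}-{j}. g * ((if u k < u j then xpow n u x else 0) - (if u j < u k then ?M x k else 0))
        + (if k < j then g * ?M x k else 0))"
      unfolding 2 by (simp only: sum.distrib sum_distrib_left)
    also have "\<dots> = (\<Sum>k\<in>{1..n}-{j}. (if u k < u j \<or> u k = u j \<and> k < j then g * xpow n u x else 0)
        + offdiag u j k * ?M x k)"
      by (rule sum.cong[OF refl pt])
    also have "\<dots> = g * real (rank_at n u j) * xpow n u x + (\<Sum>k\<in>{1..n}-{j}. offdiag u j k * ?M x k)"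
      unfolding 1 by (rule sum.distrib)
    finally show "xi j (xpow n u) x - tri (xpow n) u j x =
      (x j * ?D x - lead x) + s * ?D x - D j (\<lambda>x. (\<alpha> + \<beta> * x j) * ?D x) x"
      unfolding xi_def lead_def eig_def tri_def by (rule regroup)
  qed
qed

lemma xi_xpow_lower:
  assumes j: "j \<in> {1..n}" and u: "u \<in> expo n"
  shows "xi j (xpow n u) \<in> pspan n (lower n u)"
proof -
  have "tri (xpow n) u j \<in> pspan n (lower n u)"
    using u j by (intro tri_lspan lspan_base lower_permute tr_permutes) (auto simp: lower_def)
  then have "(\<lambda>x. (xi j (xpow n u) x - tri (xpow n) u j x) + tri (xpow n) u j x) \<in> pspan n (lower n u)"
    using lspan_mono[OF xi_triangular[OF assms] slower_lower] by (rule lspan_add)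
  then show ?thesis by simp
qed

lemma xi_slower:
  assumes "f \<in> pspan n (slower n u)" "j \<in> {1..n}"
  shows "xi j f \<in> pspan n (slower n u)"
  using assms(1)
proof (rule lspan_image)
  fix v assume v: "v \<in> slower n u"
  then have "xi j (xpow n v) \<in> pspan n (lower n v)"
    by (intro xi_xpow_lower assms(2)) (simp add: slower_def)
  then show "xi j (xpow n v) \<in> pspan n (slower n u)"
    using slower_lower_trans(2)[OF v] by (elim lspan_mono) blast
next
  fix f v c and x :: point
  assume "f \<in> pspan n (slower n u)" "v \<in> slower n u" "inj_on x {1..n}"
  then show "xi j (\<lambda>x. f x + c * xpow n v x) x = xi j f x + c * xi j (xpow n v) x"
    by (intro xi_add assms(2) polys_slower[of _ _ u] lspan_base)
next
  fix f h :: "point \<Rightarrow> real" and x :: point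
  assume "\<And>y. inj_on y {1..n} \<Longrightarrow> f y = h y" "inj_on x {1..n}"
  then show "xi j f x = xi j h x"
    by (rule xi_regular_cong[OF _ _ assms(2)])
qed (rule xi_zero)

text \<open>The monomial minus a projection onto all smaller monomials. A choice is made because
  projections for a semidefinite form need not be unique.\<close>

definition upoly :: "(nat \<Rightarrow> nat) \<Rightarrow> point \<Rightarrow> real" where
  "upoly u x = xpow n u x - (SOME z. z \<in> pspan n (slower n u) \<and>
     (\<forall>v\<in>slower n u. L (\<lambda>x. (xpow n u x - z x) * xpow n v x) = 0)) x"

lemma upoly:
  assumes "u \<in> expo n"
  shows "(\<lambda>x. xpow n u x - upoly u x) \<in> pspan n (slower n u)"
    and "v \<in> slower n u \<Longrightarrow> ip (upoly u) (xpow n v) = 0"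
proof -
  let ?P = "\<lambda>z. z \<in> pspan n (slower n u) \<and>
     (\<forall>v\<in>slower n u. L (\<lambda>x. (xpow n u x - z x) * xpow n v x) = 0)"
  have "\<exists>z. ?P z"
    using orthogonal_projection[OF finite_slower[of n u], of "xpow n" "xpow n u"] assms
    by (auto intro!: lspan_base simp: slower_def)
  then have "?P (SOME z. ?P z)" by (rule someI_ex)
  then show "(\<lambda>x. xpow n u x - upoly u x) \<in> pspan n (slower n u)"
    and "v \<in> slower n u \<Longrightarrow> ip (upoly u) (xpow n v) = 0"
    unfolding upoly_def by auto
qed

lemma upoly_polys: "u \<in> expo n \<Longrightarrow> upoly u \<in> polys n"
  using lspan_diff[OF lspan_base[of u "expo n"] polys_slower[OF upoly(1)], of u] by simp

lemma upoly_orthogonal_slower: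
  assumes "u \<in> expo n" "f \<in> pspan n (slower n u)"
  shows "ip (upoly u) f = 0"
  using assms(2) upoly_polys[OF assms(1)] _ upoly(2)[OF assms(1)]
  by (rule L_lspan_zero) (auto intro: lspan_base simp: slower_def)

lemma comp_transpose_expo:
  "j \<in> {1..n} \<Longrightarrow> k \<in> {1..n} \<Longrightarrow> u \<in> expo n \<Longrightarrow> u \<circ> tr j k \<in> expo n"
  by (rule comp_permutes_expo[OF tr_permutes])

text \<open>The remainder r of the triangular formula lies in the span of the smaller monomials.
  Moving \<open>xi\<close> to the other factor shows that r is also orthogonal to itself, because
  \<open>xi\<close> preserves that span and every \<open>upoly\<close> involved is orthogonal to it.
  Hence r pairs to zero with every h.\<close>

lemma xi_upoly:
  assumes j: "j \<in> {1..n}" and u: "u \<in> expo n" and h: "h \<in> polys n"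
  shows "ip (xi j (upoly u)) h = eig u j * ip (upoly u) h +
    (\<Sum>k\<in>{1..n}-{j}. offdiag u j k * ip (upoly (u \<circ> tr j k)) h)"
proof -
  let ?S = "slower n u" and ?K = "{1..n}-{j}"
  let ?u = "\<lambda>k. u \<circ> tr j k"
  have uk: "?u k \<in> expo n" "slower n (?u k) = ?S" if "k \<in> ?K" for k
  proof -
    have p: "tr j k permutes {1..n}"
      using that j by (intro tr_permutes) auto
    show "?u k \<in> expo n" by (rule comp_permutes_expo[OF p u])
    show "slower n (?u k) = ?S"
      by (rule slower_cong) (rule dle_permutes[OF p])+
  qed
  let ?l = "tri upoly u j"
  define r where "r x = xi j (upoly u) x - ?l x" for x
  \<comment> \<open>Subtracting z from the monomials turns \<open>xi_triangular\<close> into a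
    statement about r; a transposition of u does not change the set of smaller exponents.\<close>
  define z where "z v x = xpow n v x - upoly v x" for v x
  have vS: "z u \<in> pspan n ?S" and vk: "\<And>k. k \<in> ?K \<Longrightarrow> z (?u k) \<in> pspan n ?S"
    unfolding z_def using upoly(1)[OF u] upoly(1)[OF uk(1)] uk(2) by auto
  have uP: "upoly u \<in> polys n" and ukP: "\<And>k. k \<in> ?K \<Longrightarrow> upoly (?u k) \<in> polys n"
    using upoly_polys u uk(1) by blast+
  have lP: "?l \<in> polys n"
    using uP ukP by (rule tri_lspan)
  have rS: "r \<in> pspan n ?S"
  proof -
    have "(\<lambda>x. (xi j (xpow n u) x - tri (xpow n) u j x) - xi j (z u) x + tri z u j x) \<in> pspan n ?S"
      using vS vk by (intro lspan_add lspan_diff tri_lspan xi_triangular[OF j u] xi_slower[OF _ j])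
    then show ?thesis
    proof (rule lspan_cong)
      fix x :: point assume x: "inj_on x {1..n}"
      have "xi j (upoly u) x = xi j (\<lambda>x. xpow n u x + (-1) * z u x) x"
        by (rule arg_cong[where f = "\<lambda>f. xi j f x"]) (simp add: z_def fun_eq_iff)
      also have "\<dots> = xi j (xpow n u) x + (-1) * xi j (z u) x"
        by (rule xi_add[OF lspan_base[OF u] polys_slower[OF vS] x j])
      finally show "r x = (xi j (xpow n u) x - tri (xpow n) u j x) - xi j (z u) x + tri z u j x"
        by (simp add: r_def tri_def z_def sum_subtractf right_diff_distrib)
    qed
  qed
  have rP: "r \<in> polys n" by (rule polys_slower[OF rS])
  have xP: "xi j (upoly u) \<in> polys n" by (rule polys_xi[OF uP j])
  have lL: "ip ?l h = eig u j * ip (upoly u) h +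
      (\<Sum>k\<in>?K. offdiag u j k * ip (upoly (?u k)) h)" if h: "h \<in> polys n" for h
  proof -
    have "ip ?l h = L (\<lambda>x. eig u j * (upoly u x * h x) +
        (\<Sum>k\<in>?K. offdiag u j k * (upoly (?u k) x * h x)))"
      unfolding tri_def by (simp only: distrib_right sum_distrib_right mult.assoc)
    also have "\<dots> = eig u j * ip (upoly u) h +
        L (\<lambda>x. \<Sum>k\<in>?K. offdiag u j k * (upoly (?u k) x * h x))"
      using uP ukP h by (subst L_add) (auto intro!: lspan_scale lspan_sum polys_mult simp: L_scale[OF polys_mult])
    also have "L (\<lambda>x. \<Sum>k\<in>?K. offdiag u j k * (upoly (?u k) x * h x))
        = (\<Sum>k\<in>?K. offdiag u j k * ip (upoly (?u k)) h)"
      using ukP h by (subst L_sum) (auto intro!: lspan_scale polys_mult sum.cong L_scale)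
    finally show ?thesis .
  qed
  have diff: "ip r h = ip (xi j (upoly u)) h - ip ?l h"
    if h: "h \<in> polys n" for h
    using L_lincomb[OF xP lP h, of "-1"] by (simp add: r_def)
  have "ip r r = 0"
  proof -
    have "ip (xi j (upoly u)) r = ip (upoly u) (xi j r)"
      by (rule xi_selfadjoint[OF j uP rP])
    also have "\<dots> = 0"
      by (rule upoly_orthogonal_slower[OF u xi_slower[OF rS j]])
    moreover have "ip (upoly u) r = 0"
      by (rule upoly_orthogonal_slower[OF u rS])
    moreover have "ip (upoly (?u k)) r = 0" if "k \<in> ?K" for k
      using rS uk[OF that] by (intro upoly_orthogonal_slower) auto
    ultimately show ?thesis
      using diff[OF rP] lL[OF rP] by simp
  qed
  then have "ip r h = 0"
    by (rule L_null[OF rP h])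
  then show ?thesis
    using diff[OF h] lL[OF h] by simp
qed

text \<open>The off-diagonal terms of \<open>xi_upoly\<close> replace u or v by a rearrangement of
  smaller \<open>disorder\<close>, so they vanish by induction. What remains equates eig u j and eig
  v j times the same pairing for every j, and by \<open>rank_shift_inject\<close> distinct exponents
  differ in some eigenvalue.\<close>

lemma upoly_orthogonal:
  assumes "u \<in> expo n" "v \<in> expo n" "\<not> (dle n u v \<and> dle n v u)"
  shows "ip (upoly u) (upoly v) = 0"
  using assms
proof (induction "disorder n u + disorder n v" arbitrary: u v rule: less_induct)
  case less
  let ?l = "ip (upoly u) (upoly v)"
  have off: "u \<circ> tr j k \<in> expo n \<and> dle n (u \<circ> tr j k) u \<and> dle n u (u \<circ> tr j k) \<and>
      disorder n (u \<circ> tr j k) < disorder n u"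
    if "offdiag u j k \<noteq> 0" "j \<in> {1..n}" "k \<in> {1..n}" "u \<in> expo n" for u j k
  proof -
    have "disorder n (u \<circ> tr j k) < disorder n u"
      using that disorder_transpose[of j n k u] disorder_transpose[of k n j u]
      by (auto simp: offdiag_def transpose_commute split: if_splits)
    then show ?thesis
      using that comp_transpose_expo dle_permutes[OF tr_permutes] by blast
  qed
  have "eig u j = eig v j" if "?l \<noteq> 0" "j \<in> {1..n}" for j
  proof -
    have 1: "offdiag u j k * ip (upoly (u \<circ> tr j k)) (upoly v) = 0"
      if "k \<in> {1..n}-{j}" for k
    proof (cases "offdiag u j k = 0")
      case False
      note o = off[OF False \<open>j \<in> {1..n}\<close> _ less.prems(1)]
      have "ip (upoly (u \<circ> tr j k)) (upoly v) = 0"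
      proof (rule less.hyps)
        show "\<not> (dle n (u \<circ> tr j k) v \<and> dle n v (u \<circ> tr j k))"
          using o that less.prems(3) dle_trans by (metis DiffD1)
      qed (use o that less.prems(2) in auto)
      then show ?thesis by simp
    qed simp
    have 2: "offdiag v j k * ip (upoly (v \<circ> tr j k)) (upoly u) = 0"
      if "k \<in> {1..n}-{j}" for k
    proof (cases "offdiag v j k = 0")
      case False
      note o = off[OF False \<open>j \<in> {1..n}\<close> _ less.prems(2)]
      have "ip (upoly u) (upoly (v \<circ> tr j k)) = 0"
      proof (rule less.hyps)
        show "\<not> (dle n u (v \<circ> tr j k) \<and> dle n (v \<circ> tr j k) u)"
          using o that less.prems(3) dle_trans by (metis DiffD1)
      qed (use o that less.prems(1) in auto)
      then show ?thesis by (simp add: L_commute[of "upoly u"])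
    qed simp
    have "eig u j * ?l = ip (xi j (upoly u)) (upoly v)"
      using xi_upoly[OF that(2) less.prems(1) upoly_polys[OF less.prems(2)]] 1 by simp
    also have "\<dots> = L (\<lambda>x. xi j (upoly v) x * upoly u x)"
      using xi_selfadjoint[OF that(2) upoly_polys[OF less.prems(1)] upoly_polys[OF less.prems(2)]]
      by (simp add: L_commute[of "upoly u"])
    also have "\<dots> = eig v j * ip (upoly v) (upoly u)"
      using xi_upoly[OF that(2) less.prems(2) upoly_polys[OF less.prems(1)]] 2 by simp
    finally show ?thesis
      using that(1) by (simp add: L_commute[of "upoly v"])
  qed
  moreover have "\<exists>j\<in>{1..n}. eig u j \<noteq> eig v j"
  proof (rule ccontr)
    assume "\<not> ?thesis"
    then have "u j = v j" if "j \<in> {1..n}" for j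
      using rank_shift_inject[OF g_nonneg _ that, of u v] unfolding eig_def by blast
    then have "u = v"
      using less.prems(1,2) unfolding expo_def fun_eq_iff by (metis (mono_tags, lifting) mem_Collect_eq)
    then show False using less.prems(3) by simp
  qed
  ultimately show ?case by blast
qed

text \<open>The polynomial w is a combination of \<open>upoly\<close> v over exponents v equivalent
  to l. Its last property stands in for explicit coefficients: whatever is orthogonal to all these
  \<open>upoly\<close> v is orthogonal to w.\<close>

lemma upoly_decomposition:
  assumes "f \<in> pspan n (lower n l)"
  shows "\<exists>w\<in>polys n. (\<lambda>x. f x - w x) \<in> pspan n (slower n l) \<and>
    (\<forall>v\<in>slower n l. ip w (xpow n v) = 0) \<and>
    (\<forall>h\<in>polys n. (\<forall>u\<in>expo n. dle n u l \<longrightarrow> dle n l u \<longrightarrow> ip (upoly u) h = 0) \<longrightarrow>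
      ip w h = 0)"
  using assms
proof induction
  case (lspan_zero f)
  then show ?case
    by (intro bexI[of _ "\<lambda>_. 0"]) (auto intro!: lspan.lspan_zero L_zero)
next
  case (lspan_step f v f' c)
  then obtain w where w: "w \<in> polys n" "(\<lambda>x. f x - w x) \<in> pspan n (slower n l)"
    and w1: "\<And>v. v \<in> slower n l \<Longrightarrow> ip w (xpow n v) = 0"
    and w2: "\<And>h. h \<in> polys n \<Longrightarrow> (\<And>u. u \<in> expo n \<Longrightarrow> dle n u l \<Longrightarrow> dle n l u \<Longrightarrow> ip (upoly u) h = 0)
      \<Longrightarrow> ip w h = 0"
    by blast
  show ?case
  proof (cases "v \<in> slower n l")
    case True
    have "(\<lambda>x. (f x - w x) + c * xpow n v x) \<in> pspan n (slower n l)"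
      using True by (intro lspan_add w lspan_scale lspan_base)
    then have "(\<lambda>x. f' x - w x) \<in> pspan n (slower n l)"
      by (rule lspan_cong) (use lspan_step in auto)
    then show ?thesis using w w1 w2 by blast
  next
    case False
    then have v: "v \<in> expo n" "dle n v l" "dle n l v"
      using lspan_step by (auto simp: lower_def slower_def)
    have S: "slower n v = slower n l" by (rule slower_cong[OF v(2,3)])
    note uP = upoly_polys[OF v(1)]
    let ?w = "\<lambda>x. w x + c * upoly v x"
    have "(\<lambda>x. (f x - w x) + c * (xpow n v x - upoly v x)) \<in> pspan n (slower n l)"
      using upoly(1)[OF v(1)] unfolding S by (intro lspan_add w lspan_scale)
    then have "(\<lambda>x. f' x - ?w x) \<in> pspan n (slower n l)"
      by (rule lspan_cong) (use lspan_step in \<open>auto simp: algebra_simps\<close>)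
    moreover have "?w \<in> polys n"
      by (intro lspan_add lspan_scale w uP)
    moreover have "L (\<lambda>x. ?w x * xpow n q x) = 0" if "q \<in> slower n l" for q
    proof -
      have "xpow n q \<in> polys n" using that by (intro lspan_base) (simp add: slower_def)
      then show ?thesis
        using L_lincomb[OF w(1) uP, of "xpow n q" c] w1[OF that] upoly(2)[OF v(1), of q] that S by simp
    qed
    moreover have "L (\<lambda>x. ?w x * h x) = 0"
      if "h \<in> polys n" "\<forall>u\<in>expo n. dle n u l \<longrightarrow> dle n l u \<longrightarrow> ip (upoly u) h = 0" for h
      using L_lincomb[OF w(1) uP that(1), of c] w2[OF that(1)] that(2) v by simp
    ultimately show ?thesis
      by (intro bexI[of _ ?w] conjI ballI impI)
  qed
qed

text \<open>Both f and its component w are orthogonal to the smaller monomials, and f - w is a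
  combination of them; so f - w is null and f pairs like w.\<close>

lemma upoly_component:
  assumes "f \<in> pspan n (lower n l)"
    and "\<And>v. v \<in> slower n l \<Longrightarrow> ip f (xpow n v) = 0"
    and h: "h \<in> polys n"
    and "\<And>u. u \<in> expo n \<Longrightarrow> dle n u l \<Longrightarrow> dle n l u \<Longrightarrow> ip (upoly u) h = 0"
  shows "ip f h = 0"
proof -
  obtain w where w: "w \<in> polys n" "(\<lambda>x. f x - w x) \<in> pspan n (slower n l)"
    and w1: "\<And>v. v \<in> slower n l \<Longrightarrow> ip w (xpow n v) = 0"
    and w2: "ip w h = 0"
    using upoly_decomposition[OF assms(1)] assms(3,4) by blast
  define z where "z x = f x - w x" for x
  have fP: "f \<in> polys n" by (rule polys_lower[OF assms(1)])
  have vS: "z \<in> pspan n (slower n l)" unfolding z_def by (rule w)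
  have vP: "z \<in> polys n" by (rule polys_slower[OF vS])
  have vh: "ip z k = ip f k - ip w k" if "k \<in> polys n" for k
    using L_lincomb[OF fP w(1) that, of "-1"] by (simp add: z_def)
  have "ip z z = 0"
  proof (rule L_lspan_zero[OF vS vP])
    fix v assume v: "v \<in> slower n l"
    then show P: "xpow n v \<in> polys n" by (intro lspan_base) (simp add: slower_def)
    show "ip z (xpow n v) = 0"
      using vh[OF P] assms(2)[OF v] w1[OF v] by simp
  qed
  then have "ip z h = 0" by (rule L_null[OF vP h])
  then show ?thesis using vh[OF h] w2 by simp
qed

theorem orthogonal_incomparable:
  assumes "f \<in> pspan n (lower n l)" "\<And>v. v \<in> slower n l \<Longrightarrow> ip f (xpow n v) = 0"
    and "h \<in> pspan n (lower n m)" "\<And>v. v \<in> slower n m \<Longrightarrow> ip h (xpow n v) = 0"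
    and "\<not> (dle n l m \<and> dle n m l)"
  shows "ip f h = 0"
proof (rule upoly_component[OF assms(1,2) polys_lower[OF assms(3)]])
  fix u assume u: "u \<in> expo n" "dle n u l" "dle n l u"
  have "ip h (upoly u) = 0"
  proof (rule upoly_component[OF assms(3,4) upoly_polys[OF u(1)]])
    fix v assume v: "v \<in> expo n" "dle n v m" "dle n m v"
    show "ip (upoly v) (upoly u) = 0"
      using u v assms(5) dle_trans by (intro upoly_orthogonal) metis+
  qed
  then show "ip (upoly u) h = 0"
    by (simp add: L_commute[of h])
qed

end

section \<open>Gaussian bounds and null sets\<close>

fun coord :: "wtype \<Rightarrow> real \<Rightarrow> real" where
  "coord TypeA t = t"
| "coord TypeB t = t\<^sup>2"

definition cv :: "wtype \<Rightarrow> point \<Rightarrow> nat \<Rightarrow> real" where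
  "cv C x i = coord C (x i)"

definition lebI :: "nat \<Rightarrow> point measure" where
  "lebI n = (\<Pi>\<^sub>M j\<in>{1..n}. (lborel :: real measure))"

interpretation lb: product_sigma_finite "\<lambda>_::nat. lborel :: real measure"
  by standard

abbreviation "meas n \<equiv> borel_measurable (lebI n)"

lemmas lint_cong = Bochner_Integration.integral_cong[OF refl]

lemma component_measurable [measurable (raw)]:
  "i \<in> {1..n} \<Longrightarrow> (\<lambda>x. x i) \<in> meas n"
  unfolding lebI_def using measurable_component_singleton[of i "{1..n}" "\<lambda>_. lborel :: real measure"] by simp

lemma coord_measurable [measurable]: "coord C \<in> borel_measurable borel"
proof -
  have "coord C = (if C = TypeA then (\<lambda>t. t) else (\<lambda>t. t\<^sup>2))" by (cases C) auto
  then show ?thesis by simp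
qed

lemma cv_measurable [measurable (raw)]:
  "i \<in> {1..n} \<Longrightarrow> (\<lambda>x. cv C x i) \<in> meas n"
  unfolding cv_def by measurable

text \<open>Tonelli with coordinate j innermost: each line in direction j meets the exceptional set
  in finitely many points.\<close>

lemma AE_finite_exceptions:
  assumes j: "j \<in> {1..n}" and meas: "{x \<in> space (lebI n). \<not> R x} \<in> sets (lebI n)"
    and fin: "\<And>x. finite {t. \<not> R (x(j := t))}"
  shows "AE x in lebI n. R x"
proof -
  let ?A = "{x \<in> space (lebI n). \<not> R x}"
  have I: "insert j ({1..n}-{j}) = {1..n}" using j by auto
  have "emeasure (lebI n) ?A = (\<integral>\<^sup>+ x. indicator ?A x \<partial>lebI n)"
    using meas by simp
  also have "\<dots> = (\<integral>\<^sup>+ x. indicator ?A x \<partial>(\<Pi>\<^sub>M i\<in>insert j ({1..n}-{j}). (lborel :: real measure)))"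
    by (simp only: lebI_def I)
  also have "\<dots> = (\<integral>\<^sup>+ x. (\<integral>\<^sup>+ t. indicator ?A (x(j := t)) \<partial>lborel) \<partial>(\<Pi>\<^sub>M i\<in>{1..n}-{j}. (lborel :: real measure)))"
    using meas by (intro lb.product_nn_integral_insert) (auto simp only: I lebI_def[symmetric] finite_Diff finite_atLeastAtMost
      borel_measurable_indicator)
  also have "\<dots> = (\<integral>\<^sup>+ x. 0 \<partial>(\<Pi>\<^sub>M i\<in>{1..n}-{j}. (lborel :: real measure)))"
  proof (rule nn_integral_cong)
    fix x :: point
    have "AE t in lborel. t \<notin> {t. \<not> R (x(j := t))}"
      using fin[of x] by (intro AE_not_in finite_imp_null_set_lborel)
    then have "AE t in lborel. indicator ?A (x(j := t)) = (0::ennreal)"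
      by (rule AE_mp) (auto simp: indicator_def)
    then show "(\<integral>\<^sup>+ t. indicator ?A (x(j := t)) \<partial>lborel) = 0"
      using nn_integral_cong_AE[of "\<lambda>t. indicator ?A (x(j := t))" "\<lambda>_. 0" lborel] by simp
  qed
  finally have "?A \<in> null_sets (lebI n)" using meas by auto
  then show ?thesis by (rule AE_I') auto
qed

text \<open>Outside the hyperplanes removed here all logarithms in \<open>logW\<close> have positive
  arguments, even for r = 0.\<close>

definition generic :: "wtype \<Rightarrow> nat \<Rightarrow> point \<Rightarrow> bool" where
  "generic C n x \<longleftrightarrow> inj_on (cv C x) {1..n} \<and> (\<forall>i\<in>{1..n}. x i \<noteq> 0)"

lemma generic_iff:
  "generic C n x \<longleftrightarrow> (\<forall>i\<in>{1..n}. (\<forall>k\<in>{1..n}-{i}. cv C x i \<noteq> cv C x k) \<and> x i \<noteq> 0)"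
  unfolding generic_def inj_on_def by blast

lemma finite_coord_vimage: "finite {t. coord C t = a}"
proof (cases C)
  case TypeB
  have "{t. coord C t = a} \<subseteq> {sqrt a, - sqrt a}"
    using TypeB by (auto simp: real_sqrt_abs abs_if split: if_splits)
  then show ?thesis by (rule finite_subset) simp
qed simp

lemma AE_generic: "AE x in lebI n. generic C n x"
proof -
  have "AE x in lebI n. \<forall>k\<in>{1..n}-{i}. cv C x i \<noteq> cv C x k" if i: "i \<in> {1..n}" for i
  proof (rule AE_finite_allI)
    fix k assume k: "k \<in> {1..n}-{i}"
    then have km: "k \<in> {1..n}" by auto
    note [measurable] = cv_measurable[OF i, of C] cv_measurable[OF km, of C]
    show "AE x in lebI n. cv C x i \<noteq> cv C x k"
    proof (rule AE_finite_exceptions[OF i])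
      show "finite {t. \<not> cv C (x(i := t)) i \<noteq> cv C (x(i := t)) k}" for x
        using k finite_coord_vimage[of C "coord C (x k)"] by (simp add: cv_def)
      show "{x \<in> space (lebI n). \<not> cv C x i \<noteq> cv C x k} \<in> sets (lebI n)"
      proof -
        have "{x \<in> space (lebI n). cv C x i - cv C x k = 0} \<in> sets (lebI n)"
          by measurable
        then show ?thesis by simp
      qed
    qed
  qed simp
  moreover have "AE x in lebI n. x i \<noteq> 0" if i: "i \<in> {1..n}" for i
  proof (rule AE_finite_exceptions[OF i])
    show "{x \<in> space (lebI n). \<not> x i \<noteq> 0} \<in> sets (lebI n)"
      using component_measurable[OF i] by measurable
  qed simp
  ultimately have "AE x in lebI n. \<forall>i\<in>{1..n}. (\<forall>k\<in>{1..n}-{i}. cv C x i \<noteq> cv C x k) \<and> x i \<noteq> 0"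
    by (intro AE_finite_allI) auto
  then show ?thesis by (simp only: generic_iff)
qed

section \<open>Integrable majorants, uniform in the regularization\<close>

lemma integrable_poly_gauss:
  assumes "w > 0"
  shows "integrable lborel (\<lambda>t::real. (1 + \<bar>t\<bar>) ^ p * exp (- w * t\<^sup>2))"
proof -
  \<comment> \<open>The standard deviation for which the Gaussian density has exponent - w * t^2, so
    that its absolute moments apply.\<close>
  define d where "d = 1 / sqrt (2 * w)"
  have d: "d > 0" "2 * d\<^sup>2 = 1 / w"
    using assms by (auto simp: d_def power_divide)
  have nd: "normal_density 0 d t = 1 / sqrt (2 * pi * d\<^sup>2) * exp (- w * t\<^sup>2)" for t
    using d assms by (simp add: normal_density_def field_simps)
  have "integrable lborel (\<lambda>t::real. exp (- w * t\<^sup>2) * \<bar>t\<bar> ^ k)" for k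
  proof -
    have "integrable lborel (\<lambda>t. sqrt (2 * pi * d\<^sup>2) * (normal_density 0 d t * \<bar>t - 0\<bar> ^ k))"
      using d by (intro integrable_mult_right integrable_normal_moment_abs)
    then show ?thesis
      unfolding nd using d by simp
  qed
  then have "integrable lborel (\<lambda>t::real. \<Sum>k\<le>p. real (p choose k) * (exp (- w * t\<^sup>2) * \<bar>t\<bar> ^ (p - k)))"
    by (intro Bochner_Integration.integrable_sum integrable_mult_right)
  then show ?thesis
    by (simp add: binomial_ring sum_distrib_left sum_distrib_right mult_ac)
qed

lemma integrable_poly_gauss_prod:
  assumes "w > 0"
  shows "integrable (lebI n) (\<lambda>x. \<Prod>i=1..n. (1 + \<bar>x i\<bar>) ^ p * exp (- w * (x i)\<^sup>2))"
  unfolding lebI_def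
  using lb.product_integrable_prod[of "{1..n}" "\<lambda>_ t. (1 + \<bar>t\<bar>) ^ p * exp (- w * t\<^sup>2)"]
    integrable_poly_gauss[OF assms] by simp

text \<open>
  For r > 0 the exponential of this function is a smooth weight invariant under permutations, so
  that integration by parts is unproblematic even for small g; r = 0 is the logarithm of the
  weight itself.
\<close>

definition "logW C n g g' w r x = g / 2 * (\<Sum>i=1..n. \<Sum>k\<in>{1..n}-{i}. ln ((cv C x i - cv C x k)\<^sup>2 + r))
     + (\<Sum>i=1..n. g' * ln ((x i)\<^sup>2 + r) - w * (x i)\<^sup>2)"

abbreviation "W C n g g' w r x \<equiv> exp (logW C n g g' w r x)"

abbreviation ratio :: "real \<Rightarrow> real \<Rightarrow> real" where
  "ratio r y \<equiv> y\<^sup>2 / (y\<^sup>2 + r)"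

lemma logW_measurable [measurable]: "logW C n g g' w r \<in> meas n"
  unfolding logW_def
proof (intro borel_measurable_add borel_measurable_times borel_measurable_sum borel_measurable_diff
    borel_measurable_ln borel_measurable_power borel_measurable_const)
qed (auto intro!: cv_measurable component_measurable)

lemma one_plus_coord_le: "1 + \<bar>coord C t\<bar> \<le> (1 + \<bar>t\<bar>)\<^sup>2"
  by (cases C) (auto simp: power2_eq_square algebra_simps)

text \<open>For r <= 1 the argument is at most the square of (1 + |coord C a|) (1 + |coord C b|),
  and each factor is at most a square by \<open>one_plus_coord_le\<close>; thus one bound serves all
  r and both types.\<close>

lemma ln_pair_le:
  assumes "0 \<le> r" "r \<le> 1" "0 < (coord C a - coord C b)\<^sup>2 + r"
  shows "ln ((coord C a - coord C b)\<^sup>2 + r) \<le> 4 * (ln (1 + \<bar>a\<bar>) + ln (1 + \<bar>b\<bar>))"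
proof -
  let ?u = "coord C a" and ?v = "coord C b"
  have "(?u - ?v)\<^sup>2 + r \<le> (\<bar>?u\<bar> + \<bar>?v\<bar>)\<^sup>2 + 1"
    using assms by (intro add_mono) (auto simp: power2_le_iff_abs_le abs_triangle_ineq4)
  also have "\<dots> \<le> ((1 + \<bar>?u\<bar>) * (1 + \<bar>?v\<bar>))\<^sup>2"
  proof -
    have "(\<bar>?u\<bar> + \<bar>?v\<bar>)\<^sup>2 + 1 \<le> (1 + (\<bar>?u\<bar> + \<bar>?v\<bar>))\<^sup>2"
      by (simp add: power2_eq_square algebra_simps)
    also have "\<dots> \<le> ((1 + \<bar>?u\<bar>) * (1 + \<bar>?v\<bar>))\<^sup>2"
      by (intro power_mono) (auto simp: algebra_simps)
    finally show ?thesis .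
  qed
  also have "\<dots> \<le> ((1 + \<bar>a\<bar>)\<^sup>2 * (1 + \<bar>b\<bar>)\<^sup>2)\<^sup>2"
    by (intro power_mono mult_mono one_plus_coord_le) auto
  also have "\<dots> = ((1 + \<bar>a\<bar>) * (1 + \<bar>b\<bar>)) ^ 4"
    by (simp add: power_mult_distrib flip: power_mult)
  finally have "ln ((?u - ?v)\<^sup>2 + r) \<le> ln (((1 + \<bar>a\<bar>) * (1 + \<bar>b\<bar>)) ^ 4)"
    using assms by (subst ln_le_cancel_iff) auto
  also have "\<dots> = 4 * (ln (1 + \<bar>a\<bar>) + ln (1 + \<bar>b\<bar>))"
  proof -
    have "1 + \<bar>a\<bar> \<noteq> 0" "1 + \<bar>b\<bar> \<noteq> 0" by linarith+
    then show ?thesis by (simp add: ln_realpow ln_mult)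
  qed
  finally show ?thesis .
qed

lemma ln_square_le:
  fixes a r :: real
  assumes "0 \<le> r" "r \<le> 1" "0 < a\<^sup>2 + r"
  shows "ln (a\<^sup>2 + r) \<le> 2 * ln (1 + \<bar>a\<bar>)"
proof -
  have "a\<^sup>2 + r \<le> (1 + \<bar>a\<bar>)\<^sup>2"
    using assms abs_mult_self_eq[of a] by (simp add: power2_eq_square algebra_simps del: abs_mult_self_eq)
  then have "ln (a\<^sup>2 + r) \<le> ln ((1 + \<bar>a\<bar>)\<^sup>2)"
    using assms by (subst ln_le_cancel_iff) auto
  then show ?thesis by (simp add: ln_realpow)
qed

lemma exp_logW_le:
  assumes "g \<ge> 0" "g' \<ge> 0" "0 \<le> r" "r \<le> 1" "r > 0 \<or> generic C n x"
  shows "W C n g g' w r x \<le>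
    (\<Prod>i=1..n. (1 + \<bar>x i\<bar>) ^ (nat \<lceil>4 * g * real n + 2 * g'\<rceil>) * exp (- w * (x i)\<^sup>2))"
proof -
  let ?l = "\<lambda>i. ln (1 + \<bar>x i\<bar>)"
  \<comment> \<open>Each factor 1 + |x i| receives the exponent g / 2 * 8 * n from the double sum
    over pairs and 2 * g' from the one-variable logarithms.\<close>
  define N where "N = nat \<lceil>4 * g * real n + 2 * g'\<rceil>"
  have N: "4 * g * real n + 2 * g' \<le> real N"
    unfolding N_def by (rule real_nat_ceiling_ge)
  have l0: "0 \<le> ?l i" for i by simp
  have pos: "0 < (cv C x i - cv C x k)\<^sup>2 + r" if "i \<in> {1..n}" "k \<in> {1..n}-{i}" for i k
    using assms(3,5) that unfolding generic_iff by (auto intro: add_pos_nonneg add_nonneg_pos)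
  have pos': "0 < (x i)\<^sup>2 + r" if "i \<in> {1..n}" for i
    using assms(3,5) that unfolding generic_iff by (auto intro: add_pos_nonneg add_nonneg_pos)
  have "(\<Sum>i=1..n. \<Sum>k\<in>{1..n}-{i}. ln ((cv C x i - cv C x k)\<^sup>2 + r))
      \<le> (\<Sum>i=1..n. \<Sum>k\<in>{1..n}-{i}. 4 * (?l i + ?l k))"
    using pos unfolding cv_def by (intro sum_mono ln_pair_le assms) auto
  also have "\<dots> \<le> (\<Sum>i=1..n. \<Sum>k=1..n. 4 * (?l i + ?l k))"
    using l0 by (intro sum_mono sum_mono2) auto
  also have "\<dots> = 8 * real n * (\<Sum>i=1..n. ?l i)"
    by (simp add: sum.distrib flip: sum_distrib_left)
  finally have 1: "g / 2 * (\<Sum>i=1..n. \<Sum>k\<in>{1..n}-{i}. ln ((cv C x i - cv C x k)\<^sup>2 + r))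
      \<le> g / 2 * (8 * real n * (\<Sum>i=1..n. ?l i))"
    using assms(1) by (intro mult_left_mono) auto
  have 2: "(\<Sum>i=1..n. g' * ln ((x i)\<^sup>2 + r) - w * (x i)\<^sup>2) \<le> (\<Sum>i=1..n. g' * (2 * ?l i) - w * (x i)\<^sup>2)"
    by (rule sum_mono, rule diff_right_mono, rule mult_left_mono, rule ln_square_le) (use assms pos' in auto)
  have "logW C n g g' w r x \<le> (4 * g * real n + 2 * g') * (\<Sum>i=1..n. ?l i) - (\<Sum>i=1..n. w * (x i)\<^sup>2)"
    using 1 2 unfolding logW_def by (simp add: sum_subtractf sum_distrib_left[symmetric] algebra_simps)
  also have "\<dots> \<le> real N * (\<Sum>i=1..n. ?l i) - (\<Sum>i=1..n. w * (x i)\<^sup>2)"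
    using N l0 by (intro diff_mono mult_right_mono sum_nonneg) auto
  also have "\<dots> = (\<Sum>i=1..n. real N * ?l i + (- w * (x i)\<^sup>2))"
    by (simp add: sum_distrib_left sum_subtractf)
  finally have "W C n g g' w r x \<le> exp (\<Sum>i=1..n. real N * ?l i + (- w * (x i)\<^sup>2))"
    by simp
  also have "\<dots> = (\<Prod>i=1..n. (1 + \<bar>x i\<bar>) ^ N * exp (- w * (x i)\<^sup>2))"
  proof -
    have "exp (real N * ln (1 + \<bar>y\<bar>) + (- w * y\<^sup>2)) = (1 + \<bar>y\<bar>) ^ N * exp (- w * y\<^sup>2)" for y
    proof -
      have "0 < 1 + \<bar>y\<bar>" by linarith
      then show ?thesis unfolding exp_add exp_of_nat_mult by simp
    qed
    then show ?thesis
      by (simp only: exp_sum[OF finite_atLeastAtMost])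
  qed
  finally show ?thesis unfolding N_def .
qed

section \<open>Functions of polynomial growth\<close>

abbreviation growth :: "nat \<Rightarrow> nat \<Rightarrow> point \<Rightarrow> real" where
  "growth n p x \<equiv> \<Prod>i=1..n. (1 + \<bar>x i\<bar>) ^ p"

text \<open>The bound is imposed at generic points, where difference quotients of polynomials agree
  with polynomials; a product of one-variable factors combines directly with the product bound of
  \<open>exp_logW_le\<close>.\<close>

definition tame :: "wtype \<Rightarrow> nat \<Rightarrow> (point \<Rightarrow> real) \<Rightarrow> bool" where
  "tame C n f \<longleftrightarrow> f \<in> meas n \<and>
     (\<exists>c p. \<forall>x. generic C n x \<longrightarrow> \<bar>f x\<bar> \<le> c * growth n p x)"

lemma tame_measurable: "tame C n f \<Longrightarrow> f \<in> meas n"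
  by (simp add: tame_def)

lemma prod_one_plus_ge_1: "1 \<le> (\<Prod>i=1..n. (1 + \<bar>x i :: real\<bar>) ^ p)"
  by (intro prod_ge_1) simp

lemma tame_bound:
  assumes "tame C n f"
  obtains c p where "c \<ge> 0" "\<And>x. generic C n x \<Longrightarrow> \<bar>f x\<bar> \<le> c * growth n p x"
proof -
  obtain c p where cp: "\<And>x. generic C n x \<Longrightarrow> \<bar>f x\<bar> \<le> c * growth n p x"
    using assms unfolding tame_def by blast
  have "\<bar>f x\<bar> \<le> \<bar>c\<bar> * growth n p x" if "generic C n x" for x
  proof -
    have "0 \<le> growth n p x" by (intro prod_nonneg) auto
    then have "c * growth n p x \<le> \<bar>c\<bar> * growth n p x"
      by (intro mult_right_mono) auto
    then show ?thesis using cp[OF that] by linarith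
  qed
  then show ?thesis by (intro that[of "\<bar>c\<bar>" p]) auto
qed

lemma tameI:
  assumes "f \<in> meas n"
    and "\<And>x. generic C n x \<Longrightarrow> \<bar>f x\<bar> \<le> c * growth n p x"
  shows "tame C n f"
  using assms unfolding tame_def by blast

lemma tame_const: "tame C n (\<lambda>x. c)"
  by (rule tameI[of _ _ _ "\<bar>c\<bar>" 0]) auto

lemma tame_add:
  assumes "tame C n f" "tame C n h"
  shows "tame C n (\<lambda>x. f x + h x)"
proof -
  obtain c p where c: "c \<ge> 0" "\<And>x. generic C n x \<Longrightarrow> \<bar>f x\<bar> \<le> c * growth n p x"
    using tame_bound[OF assms(1)] by blast
  obtain d q where d: "d \<ge> 0" "\<And>x. generic C n x \<Longrightarrow> \<bar>h x\<bar> \<le> d * growth n q x"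
    using tame_bound[OF assms(2)] by blast
  have le: "c * growth n p x \<le> c * growth n (p + q) x"
    "d * growth n q x \<le> d * growth n (p + q) x" for x :: point
    using c(1) d(1) by (intro mult_left_mono prod_mono; auto intro: power_increasing)+
  show ?thesis
  proof (rule tameI[of _ _ _ "c + d" "p + q"])
    show "\<bar>f x + h x\<bar> \<le> (c + d) * growth n (p + q) x" if "generic C n x" for x
      using c(2)[OF that] d(2)[OF that] le[of x] by (simp add: distrib_right)
  qed (intro borel_measurable_add tame_measurable[OF assms(1)] tame_measurable[OF assms(2)])
qed

lemma tame_mult:
  assumes "tame C n f" "tame C n h"
  shows "tame C n (\<lambda>x. f x * h x)"
proof -
  obtain c p where c: "c \<ge> 0" "\<And>x. generic C n x \<Longrightarrow> \<bar>f x\<bar> \<le> c * growth n p x"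
    using tame_bound[OF assms(1)] by blast
  obtain d q where d: "d \<ge> 0" "\<And>x. generic C n x \<Longrightarrow> \<bar>h x\<bar> \<le> d * growth n q x"
    using tame_bound[OF assms(2)] by blast
  show ?thesis
  proof (rule tameI[of _ _ _ "c * d" "p + q"])
    fix x assume "generic C n x"
    then have "\<bar>f x\<bar> * \<bar>h x\<bar> \<le> (c * growth n p x) * (d * growth n q x)"
      using c d prod_one_plus_ge_1[of x p n] by (intro mult_mono) auto
    then show "\<bar>f x * h x\<bar> \<le> c * d * growth n (p + q) x"
      by (simp add: abs_mult power_add prod.distrib mult_ac)
  qed (intro borel_measurable_times tame_measurable[OF assms(1)] tame_measurable[OF assms(2)])
qed

lemma tame_sum: "(\<And>k. k \<in> A \<Longrightarrow> tame C n (f k)) \<Longrightarrow> tame C n (\<lambda>x. \<Sum>k\<in>A. f k x)"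
  by (induction A rule: infinite_finite_induct) (auto intro: tame_add tame_const)

lemma tame_prod: "(\<And>k. k \<in> A \<Longrightarrow> tame C n (f k)) \<Longrightarrow> tame C n (\<lambda>x. \<Prod>k\<in>A. f k x)"
  by (induction A rule: infinite_finite_induct) (auto intro: tame_mult tame_const)

lemma tame_power: "tame C n f \<Longrightarrow> tame C n (\<lambda>x. f x ^ k)"
  by (induction k) (auto intro: tame_mult tame_const)

lemma tame_component:
  assumes "i \<in> {1..n}"
  shows "tame C n (\<lambda>x. x i)"
proof (rule tameI[of _ _ _ 1 1])
  fix x :: point
  have "\<bar>x i\<bar> \<le> (1 + \<bar>x i\<bar>) * 1" by simp
  also have "\<dots> \<le> (1 + \<bar>x i\<bar>) * (\<Prod>i\<in>{1..n}-{i}. 1 + \<bar>x i\<bar>)"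
    by (intro mult_left_mono prod_ge_1) auto
  also have "\<dots> = growth n 1 x"
    using assms by (subst (2) prod.remove[of _ i]) auto
  finally show "\<bar>x i\<bar> \<le> 1 * growth n 1 x" by simp
qed (use assms in measurable)

lemma tame_cv: "i \<in> {1..n} \<Longrightarrow> tame C n (\<lambda>x. cv C x i)"
  by (cases C) (simp_all add: cv_def tame_component tame_power)

lemma tame_xpow: "tame C n (\<lambda>x. xpow n u (cv C x))"
  unfolding xpow_def by (intro tame_prod tame_power tame_cv)

lemma tame_dominated:
  assumes "tame C n f" "h \<in> meas n" "\<And>x. generic C n x \<Longrightarrow> \<bar>h x\<bar> \<le> \<bar>f x\<bar>"
  shows "tame C n h"
proof -
  obtain c p where "c \<ge> 0" "\<And>x. generic C n x \<Longrightarrow> \<bar>f x\<bar> \<le> c * growth n p x"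
    using tame_bound[OF assms(1)] by blast
  then show ?thesis
    using assms(2,3) by (intro tameI[of _ _ _ c p]) (auto intro: order_trans)
qed

text \<open>An element of \<open>polys\<close> is determined only at regular points, so
  measurability is a separate hypothesis; the growth bound comes from a true polynomial agreeing
  with it there.\<close>

lemma tame_polys:
  assumes "f \<in> polys n" "(\<lambda>x. f (cv C x)) \<in> meas n"
  shows "tame C n (\<lambda>x. f (cv C x))"
proof -
  have "\<exists>h. tame C n h \<and> (\<forall>x. inj_on (cv C x) {1..n} \<longrightarrow> f (cv C x) = h x)"
    using assms(1)
  proof induction
    case (lspan_zero f)
    then show ?case by (intro exI[of _ "\<lambda>_. 0"]) (auto intro: tame_const)
  next
    case (lspan_step f u f' c)
    then obtain h where "tame C n h" "\<And>x. inj_on (cv C x) {1..n} \<Longrightarrow> f (cv C x) = h x"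
      by blast
    then show ?case
      using lspan_step
      by (intro exI[of _ "\<lambda>x. h x + c * xpow n u (cv C x)"])
        (auto intro!: tame_add tame_mult tame_const tame_xpow)
  qed
  then obtain h where "tame C n h" "\<And>x. inj_on (cv C x) {1..n} \<Longrightarrow> f (cv C x) = h x"
    by blast
  then show ?thesis
    using assms(2) by (intro tame_dominated[of C n h "\<lambda>x. f (cv C x)"]) (simp_all add: generic_def)
qed

text \<open>One majorant serves all r in [0, 1], as required by dominated convergence for r tending
  to 0.\<close>

lemma tame_dominating:
  assumes "tame C n f" "g \<ge> 0" "g' \<ge> 0" "w > 0"
  obtains B where "integrable (lebI n) B" "\<And>x. 0 \<le> B x"
    "\<And>x r. generic C n x \<Longrightarrow> 0 \<le> r \<Longrightarrow> r \<le> 1 \<Longrightarrow> \<bar>f x\<bar> * W C n g g' w r x \<le> B x"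
proof -
  obtain c p where c: "c \<ge> 0" "\<And>x. generic C n x \<Longrightarrow> \<bar>f x\<bar> \<le> c * growth n p x"
    using tame_bound[OF assms(1)] by blast
  let ?N = "nat \<lceil>4 * g * real n + 2 * g'\<rceil>"
  let ?w = "\<lambda>x. c * (\<Prod>i=1..n. (1 + \<bar>x i\<bar>) ^ (p + ?N) * exp (- w * (x i)\<^sup>2))"
  show ?thesis
  proof (rule that[of ?w])
    show "integrable (lebI n) ?w"
      by (intro integrable_mult_right integrable_poly_gauss_prod assms)
    show "0 \<le> ?w x" for x
      using c(1) by (intro mult_nonneg_nonneg prod_nonneg) auto
    fix x r assume x: "generic C n x" and e: "0 \<le> r" "r \<le> (1::real)"
    have "\<bar>f x\<bar> * W C n g g' w r x \<le> (c * growth n p x) *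
        (\<Prod>i=1..n. (1 + \<bar>x i\<bar>) ^ ?N * exp (- w * (x i)\<^sup>2))"
      using c x e assms prod_one_plus_ge_1[of x p n] by (intro mult_mono exp_logW_le) auto
    then show "\<bar>f x\<bar> * W C n g g' w r x \<le> ?w x"
      by (simp add: power_add prod.distrib mult_ac)
  qed
qed

lemma integrable_tame:
  assumes "tame C n f" "g \<ge> 0" "g' \<ge> 0" "w > 0" "0 \<le> r" "r \<le> 1"
  shows "integrable (lebI n) (\<lambda>x. f x * W C n g g' w r x)"
proof -
  obtain B where B: "integrable (lebI n) B" "\<And>x. 0 \<le> B x"
    "\<And>x. generic C n x \<Longrightarrow> \<bar>f x\<bar> * W C n g g' w r x \<le> B x"
    using tame_dominating[OF assms(1-4)] assms(5,6) by metis
  have [measurable]: "f \<in> meas n" by (rule tame_measurable[OF assms(1)])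
  show ?thesis
  proof (rule Bochner_Integration.integrable_bound[OF B(1)])
    show "AE x in lebI n. norm (f x * W C n g g' w r x) \<le> norm (B x)"
      using AE_generic by (rule AE_mp) (use B in \<open>auto simp: abs_mult\<close>)
  qed measurable
qed

section \<open>Integration by parts for a regularized weight\<close>

lemma integral_derivative_zero:
  fixes F f :: "real \<Rightarrow> real"
  assumes F: "\<And>t. (F has_field_derivative f t) (at t)" and f: "\<And>t. isCont f t"
    and top: "(F \<longlongrightarrow> 0) at_top" and bot: "(F \<longlongrightarrow> 0) at_bot"
  shows "(LINT t|lborel. f t) = 0"
proof (cases "integrable lborel f")
  case True
  have "(LBINT t=-\<infinity>..\<infinity>. f t) = 0 - 0"
  proof (rule interval_integral_FTC_integrable)
    show "(F has_vector_derivative f t) (at t)" for t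
      using F by (simp add: has_real_derivative_iff_has_vector_derivative)
    show "set_integrable lborel (einterval (- \<infinity>) \<infinity>) f"
      using True by (simp add: set_integrable_def einterval_def)
    show "((F \<circ> real_of_ereal) \<longlongrightarrow> 0) (at_right (- \<infinity>))" "((F \<circ> real_of_ereal) \<longlongrightarrow> 0) (at_left \<infinity>)"
      using top bot by (simp_all add: ereal_tendsto_simps)
  qed (use f in auto)
  then show ?thesis
    by (simp add: interval_lebesgue_integral_def set_lebesgue_integral_def einterval_def)
next
  \<comment> \<open>A nonintegrable function has integral 0 by convention.\<close>
  case False
  then show ?thesis by (rule not_integrable_integral_eq)
qed

lemma poly_gauss_tendsto_0:
  assumes "w > 0"
  shows "((\<lambda>t::real. (1 + \<bar>t\<bar>) ^ p * exp (- w * t\<^sup>2)) \<longlongrightarrow> 0) at_top"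
    and "((\<lambda>t::real. (1 + \<bar>t\<bar>) ^ p * exp (- w * t\<^sup>2)) \<longlongrightarrow> 0) at_bot"
proof -
  have "((\<lambda>t::real. (1 + t) ^ p * exp (- w * t\<^sup>2)) \<longlongrightarrow> 0) at_top"
    using assms by real_asymp
  then show 1: "((\<lambda>t::real. (1 + \<bar>t\<bar>) ^ p * exp (- w * t\<^sup>2)) \<longlongrightarrow> 0) at_top"
    by (rule Lim_transform_eventually) (rule eventually_mono[OF eventually_ge_at_top[of 0]], simp)
  then show "((\<lambda>t::real. (1 + \<bar>t\<bar>) ^ p * exp (- w * t\<^sup>2)) \<longlongrightarrow> 0) at_bot"
    unfolding filterlim_at_bot_mirror by simp
qed

section \<open>Permutations of the coordinates\<close>

lemma measurable_permute:
  assumes p: "p permutes {1..n}"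
  shows "(\<lambda>x. \<lambda>i\<in>{1..n}. x (p i)) \<in> measurable (lebI n) (lebI n)"
  unfolding lebI_def
proof (rule measurable_restrict)
  fix i assume "i \<in> {1..n}"
  then show "(\<lambda>x. x (p i)) \<in> measurable (\<Pi>\<^sub>M j\<in>{1..n}. (lborel :: real measure)) lborel"
    using permutes_in_image[OF p] by (intro measurable_component_singleton) blast
qed

text \<open>A product measure is determined by its values on boxes, and permuting the sides of a box
  does not change its volume.\<close>

lemma distr_permute:
  assumes p: "p permutes {1..n}"
  shows "distr (lebI n) (lebI n) (\<lambda>x. \<lambda>i\<in>{1..n}. x (p i)) = lebI n"
proof -
  let ?T = "\<lambda>x. \<lambda>i\<in>{1..n}. x (p i)"
  have pI: "p i \<in> {1..n} \<longleftrightarrow> i \<in> {1..n}" for i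
    using permutes_in_image[OF p] by blast
  note T = measurable_permute[OF p]
  have "distr (lebI n) (lebI n) ?T = (\<Pi>\<^sub>M j\<in>{1..n}. (lborel :: real measure))"
  proof (rule lb.PiM_eqI)
    fix A :: "nat \<Rightarrow> real set"
    assume A: "\<And>i. i \<in> {1..n} \<Longrightarrow> A i \<in> sets lborel"
    have inv: "p (inv p i) = i" "inv p (p i) = i" for i
      using permutes_inverses[OF p] by blast+
    have inv_in: "inv p i \<in> {1..n} \<longleftrightarrow> i \<in> {1..n}" for i
      using permutes_in_image[OF permutes_inv[OF p]] by blast
    have "?T -` (PiE {1..n} A) \<inter> space (lebI n) = PiE {1..n} (A \<circ> inv p)"
    proof (intro equalityI subsetI)
      fix x assume x: "x \<in> ?T -` (PiE {1..n} A) \<inter> space (lebI n)"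
      show "x \<in> PiE {1..n} (A \<circ> inv p)"
      proof (rule PiE_I)
        fix i assume i: "i \<in> {1..n}"
        then have "?T x (inv p i) \<in> A (inv p i)"
          using x inv_in by (intro PiE_mem[of _ "{1..n}" A]) blast+
        then show "x i \<in> (A \<circ> inv p) i" using i inv_in inv by simp
      qed (use x in \<open>auto simp: lebI_def space_PiM PiE_def extensional_def\<close>)
    next
      fix x assume x: "x \<in> PiE {1..n} (A \<circ> inv p)"
      have "x (p i) \<in> A i" if "i \<in> {1..n}" for i
        using PiE_mem[OF x, of "p i"] that pI inv by simp
      then show "x \<in> ?T -` (PiE {1..n} A) \<inter> space (lebI n)"
        using x by (auto simp: lebI_def space_PiM PiE_def)
    qed
    then have "emeasure (distr (lebI n) (lebI n) ?T) (PiE {1..n} A) = emeasure (lebI n) (PiE {1..n} (A \<circ> inv p))"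
      using A T by (subst emeasure_distr) (auto simp: lebI_def intro!: sets_PiM_I_finite)
    also have "\<dots> = (\<Prod>i=1..n. emeasure lborel (A (inv p i)))"
      unfolding lebI_def using A inv_in by (subst lb.emeasure_PiM) auto
    also have "\<dots> = (\<Prod>i=1..n. emeasure lborel (A i))"
      using prod.permute[OF permutes_inv[OF p], of "\<lambda>i. emeasure lborel (A i)"] by (simp add: o_def)
    finally show "emeasure (distr (lebI n) (lebI n) ?T) (PiE {1..n} A) = (\<Prod>i=1..n. emeasure lborel (A i))" .
  qed (simp_all add: lebI_def)
  then show ?thesis by (simp add: lebI_def)
qed

lemma integral_permute:
  fixes H :: "point \<Rightarrow> real"
  assumes p: "p permutes {1..n}" and H: "H \<in> meas n"
    and cong: "\<And>x y. (\<And>i. i \<in> {1..n} \<Longrightarrow> x i = y i) \<Longrightarrow> H x = H y"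
  shows "(LINT x|lebI n. H (x \<circ> p)) = (LINT x|lebI n. H x)"
proof -
  let ?T = "\<lambda>x. \<lambda>i\<in>{1..n}. x (p i)"
  note T = measurable_permute[OF p]
  have "(LINT x|lebI n. H x) = (LINT x|distr (lebI n) (lebI n) ?T. H x)"
    by (simp only: distr_permute[OF p])
  also have "\<dots> = (LINT x|lebI n. H (?T x))"
    by (rule integral_distr[OF T H])
  also have "\<dots> = (LINT x|lebI n. H (x \<circ> p))"
    by (rule lint_cong, rule cong) simp
  finally show ?thesis by simp
qed

lemma cv_permute: "cv C (x \<circ> p) = cv C x \<circ> p"
  by (simp add: cv_def fun_eq_iff)

lemma cv_update: "cv C (x(j := t)) = (cv C x)(j := coord C t)"
  by (simp add: cv_def fun_eq_iff)

lemma logW_permute: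
  assumes p: "p permutes {1..n}"
  shows "logW C n g g' w r (x \<circ> p) = logW C n g g' w r x"
proof -
  have split: "(\<Sum>k\<in>{1..n}-{i}. f k) = (\<Sum>k=1..n. if k = i then 0 else f k)"
    for i and f :: point
    by (rule sum.mono_neutral_cong_left) auto
  have inj: "p k = p i \<longleftrightarrow> k = i" for i k
    using permutes_inj[OF p] by (auto dest: injD)
  let ?h = "\<lambda>i k. if k = i then 0 else ln ((cv C x i - cv C x k)\<^sup>2 + r)"
  have "(\<Sum>i=1..n. \<Sum>k=1..n. ?h (p i) (p k)) = (\<Sum>i=1..n. \<Sum>k=1..n. ?h (p i) k)"
    using sum.permute[OF p, of "?h (p i)" for i] by (simp add: o_def)
  also have "\<dots> = (\<Sum>i=1..n. \<Sum>k=1..n. ?h i k)"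
    using sum.permute[OF p, of "\<lambda>i. \<Sum>k=1..n. ?h i k"] by (simp add: o_def)
  finally have 1: "(\<Sum>i=1..n. \<Sum>k=1..n. ?h (p i) (p k)) = (\<Sum>i=1..n. \<Sum>k=1..n. ?h i k)" .
  have 2: "(\<Sum>i=1..n. g' * ln ((x (p i))\<^sup>2 + r) - w * (x (p i))\<^sup>2) = (\<Sum>i=1..n. g' * ln ((x i)\<^sup>2 + r) - w * (x i)\<^sup>2)"
    using sum.permute[OF p, of "\<lambda>i. g' * ln ((x i)\<^sup>2 + r) - w * (x i)\<^sup>2"] by (simp add: o_def)
  show ?thesis
    unfolding logW_def split cv_permute o_apply using 1 2 unfolding inj by simp
qed

text \<open>The pair of j and k occurs in both orders in the double sum, hence g in place of g / 2.
  K gathers what does not depend on t and disappears on differentiation.\<close>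

lemma logW_update:
  assumes j: "j \<in> {1..n}"
  shows "\<exists>K. \<forall>t. logW C n g g' w r (x(j := t)) =
    g * (\<Sum>k\<in>{1..n}-{j}. ln ((coord C t - cv C x k)\<^sup>2 + r)) + g' * ln (t\<^sup>2 + r) - w * t\<^sup>2 + K"
proof -
  let ?J = "{1..n}-{j}"
  let ?h = "\<lambda>u v. ln ((u - v)\<^sup>2 + r)"
  let ?K = "g / 2 * (\<Sum>i\<in>?J. \<Sum>k\<in>?J-{i}. ?h (cv C x i) (cv C x k)) + (\<Sum>i\<in>?J. g' * ln ((x i)\<^sup>2 + r) - w * (x i)\<^sup>2)"
  have I: "{1..n} = insert j ?J" using j by auto
  have "logW C n g g' w r (x(j := t)) = g * (\<Sum>k\<in>?J. ?h (coord C t) (cv C x k)) + g' * ln (t\<^sup>2 + r) - w * t\<^sup>2 + ?K" for t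
  proof -
    let ?c = "(cv C x)(j := coord C t)"
    have "(\<Sum>i=1..n. \<Sum>k\<in>{1..n}-{i}. ?h (?c i) (?c k))
        = (\<Sum>k\<in>?J. ?h (?c j) (?c k)) + (\<Sum>i\<in>?J. \<Sum>k\<in>{1..n}-{i}. ?h (?c i) (?c k))"
      using j by (subst sum.remove[of _ j]) auto
    also have "(\<Sum>k\<in>?J. ?h (?c j) (?c k)) = (\<Sum>k\<in>?J. ?h (coord C t) (cv C x k))"
      by (rule sum.cong) auto
    also have "(\<Sum>i\<in>?J. \<Sum>k\<in>{1..n}-{i}. ?h (?c i) (?c k))
        = (\<Sum>i\<in>?J. ?h (coord C t) (cv C x i) + (\<Sum>k\<in>?J-{i}. ?h (cv C x i) (cv C x k)))"
    proof (rule sum.cong)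
      fix i assume i: "i \<in> ?J"
      have "(\<Sum>k\<in>{1..n}-{i}. ?h (?c i) (?c k)) = ?h (?c i) (?c j) + (\<Sum>k\<in>{1..n}-{i}-{j}. ?h (?c i) (?c k))"
        using i j by (subst sum.remove[of _ j]) auto
      also have "{1..n}-{i}-{j} = ?J-{i}" by auto
      also have "(\<Sum>k\<in>?J-{i}. ?h (?c i) (?c k)) = (\<Sum>k\<in>?J-{i}. ?h (cv C x i) (cv C x k))"
        using i by (intro sum.cong) auto
      also have "?h (?c i) (?c j) = ?h (coord C t) (cv C x i)"
        using i by (simp add: power2_commute)
      finally show "(\<Sum>k\<in>{1..n}-{i}. ?h (?c i) (?c k))
          = ?h (coord C t) (cv C x i) + (\<Sum>k\<in>?J-{i}. ?h (cv C x i) (cv C x k))" .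
    qed simp
    finally have 1: "(\<Sum>i=1..n. \<Sum>k\<in>{1..n}-{i}. ?h (?c i) (?c k)) = 2 * (\<Sum>k\<in>?J. ?h (coord C t) (cv C x k))
        + (\<Sum>i\<in>?J. \<Sum>k\<in>?J-{i}. ?h (cv C x i) (cv C x k))"
      by (simp add: sum.distrib)
    let ?r = "\<lambda>y. g' * ln (y\<^sup>2 + r) - w * y\<^sup>2"
    have "(\<Sum>i=1..n. ?r ((x(j := t)) i)) = ?r t + (\<Sum>i\<in>?J. ?r ((x(j := t)) i))"
      using j by (subst sum.remove[of _ j]) auto
    also have "(\<Sum>i\<in>?J. ?r ((x(j := t)) i)) = (\<Sum>i\<in>?J. ?r (x i))"
      by (rule sum.cong) auto
    finally have 2: "(\<Sum>i=1..n. ?r ((x(j := t)) i)) = ?r t + (\<Sum>i\<in>?J. ?r (x i))" .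
    show ?thesis
      unfolding logW_def cv_update 1 2 by (simp add: algebra_simps)
  qed
  then show ?thesis by blast
qed

text \<open>
  The test functions of the integration by parts are wfac C (x j) times a monomial in y; the
  factor bfac expresses wfac times the derivative of the coordinate change in terms of y.
\<close>

fun wfac :: "wtype \<Rightarrow> real \<Rightarrow> real" where
  "wfac TypeA t = 1"
| "wfac TypeB t = t"

fun dcoord :: "wtype \<Rightarrow> real \<Rightarrow> real" where
  "dcoord TypeA t = 1"
| "dcoord TypeB t = 2 * t"

text \<open>The constant derivative of \<open>wfac C\<close>.\<close>

fun tdelta :: "wtype \<Rightarrow> real" where
  "tdelta TypeA = 0"
| "tdelta TypeB = 1"

fun bfac :: "wtype \<Rightarrow> real \<Rightarrow> real" where
  "bfac TypeA y = 1"
| "bfac TypeB y = 2 * y"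

lemma wfac_dcoord: "wfac C t * dcoord C t = bfac C (coord C t)"
  by (cases C) (auto simp: power2_eq_square)

lemma wfac_mult_self: "t * wfac C t = coord C t"
  by (cases C) (auto simp: power2_eq_square)

lemma coord_derivative [derivative_intros]:
  "(f has_field_derivative D) (at t within S) \<Longrightarrow>
    ((\<lambda>t. coord C (f t)) has_field_derivative dcoord C (f t) * D) (at t within S)"
  by (cases C) (auto intro!: derivative_eq_intros)

lemma wfac_derivative [derivative_intros]:
  "(f has_field_derivative D) (at t within S) \<Longrightarrow>
    ((\<lambda>t. wfac C (f t)) has_field_derivative tdelta C * D) (at t within S)"
  by (cases C) (auto intro!: derivative_eq_intros)

lemma coord_continuous [continuous_intros]:
  "continuous F f \<Longrightarrow> continuous F (\<lambda>t. coord C (f t))"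
  "continuous F f \<Longrightarrow> continuous F (\<lambda>t. dcoord C (f t))"
  "continuous F f \<Longrightarrow> continuous F (\<lambda>t. wfac C (f t))"
  by (cases C; auto intro!: continuous_intros)+

text \<open>In type B the factor x j turns the derivative in x j into 2 * y j times the derivative
  in y j and so keeps all terms polynomial in y.\<close>

definition "phi C n j u x = wfac C (x j) * xpow n u (cv C x)"

definition "dphi C n j u x = tdelta C * xpow n u (cv C x) +
     bfac C (cv C x j) * (real (u j) * xpow n (u(j := u j - 1)) (cv C x))"

definition "dlogW C n g g' w r j x =
     g * (\<Sum>k\<in>{1..n}-{j}. 2 * (cv C x j - cv C x k) * dcoord C (x j) / ((cv C x j - cv C x k)\<^sup>2 + r))
     + g' * (2 * x j / ((x j)\<^sup>2 + r)) - w * (2 * x j)"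

text \<open>On every line in direction j the integrand is the derivative of \<open>phi\<close> times
  the weight, which vanishes at both ends; Fubini gives the rest. The nonintegrable case is settled
  by the default value 0 of the integral.\<close>

lemma integral_by_parts:
  assumes j: "j \<in> {1..n}" and pos: "g \<ge> 0" "g' \<ge> 0" "w > 0" "0 < r" "r \<le> 1"
  shows "(LINT x|lebI n. (dphi C n j u x + phi C n j u x * dlogW C n g g' w r j x) *
      W C n g g' w r x) = 0" (is "(LINT x|lebI n. ?E x) = 0")
proof (cases "integrable (lebI n) ?E")
  case True
  let ?J = "{1..n}-{j}"
  have I: "insert j ?J = {1..n}" using j by auto
  have inner: "(LINT t|lborel. ?E (x(j := t))) = 0" for x
  proof (rule integral_derivative_zero)
    obtain K where K: "\<And>t. logW C n g g' w r (x(j := t)) =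
      g * (\<Sum>k\<in>?J. ln ((coord C t - cv C x k)\<^sup>2 + r)) + g' * ln (t\<^sup>2 + r) - w * t\<^sup>2 + K"
      using logW_update[OF j] by blast
    define R where "R = (\<Prod>i\<in>?J. cv C x i ^ u i)"
    let ?F = "\<lambda>t. phi C n j u (x(j := t)) * exp (logW C n g g' w r (x(j := t)))"
    have phi: "phi C n j u (x(j := t)) = wfac C t * (coord C t ^ u j * R)" for t
      unfolding phi_def cv_update xpow_update[OF j] R_def by simp
    have dphi: "dphi C n j u (x(j := t)) = tdelta C * (coord C t ^ u j * R)
        + wfac C t * (real (u j) * coord C t ^ (u j - 1) * dcoord C t * R)" for t
    proof -
      have "(\<Prod>i\<in>?J. cv C x i ^ (u(j := u j - 1)) i) = R"
        unfolding R_def by (rule prod.cong) auto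
      then show ?thesis
        unfolding dphi_def cv_update xpow_update[OF j] R_def by (simp add: wfac_dcoord[symmetric])
    qed
    have dlogW: "dlogW C n g g' w r j (x(j := t)) =
        g * (\<Sum>k\<in>?J. 2 * (coord C t - cv C x k) * dcoord C t / ((coord C t - cv C x k)\<^sup>2 + r))
        + g' * (2 * t / (t\<^sup>2 + r)) - w * (2 * t)" for t
      unfolding dlogW_def cv_update by simp
    have p: "0 < y\<^sup>2 + r" for y using pos(4) by (simp add: add_nonneg_pos)
    have p': "y\<^sup>2 + r \<noteq> 0" for y using p[of y] by simp
    have dL: "((\<lambda>t. logW C n g g' w r (x(j := t))) has_field_derivative dlogW C n g g' w r j (x(j := t))) (at t)" for t
    proof -
      have "((\<lambda>t. ln ((coord C t - a)\<^sup>2 + r)) has_field_derivative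
          2 * (coord C t - a) * dcoord C t / ((coord C t - a)\<^sup>2 + r)) (at t)" for a
        by (rule derivative_eq_intros refl p | simp)+
      moreover have "((\<lambda>t. ln (t\<^sup>2 + r)) has_field_derivative 2 * t / (t\<^sup>2 + r)) (at t)"
        by (rule derivative_eq_intros refl p | simp)+
      moreover have "((\<lambda>t::real. t\<^sup>2) has_field_derivative 2 * t) (at t)"
        by (auto intro!: derivative_eq_intros)
      ultimately have "((\<lambda>t. g * (\<Sum>k\<in>?J. ln ((coord C t - cv C x k)\<^sup>2 + r)) + g' * ln (t\<^sup>2 + r) - w * t\<^sup>2 + K)
          has_field_derivative (g * (\<Sum>k\<in>?J. 2 * (coord C t - cv C x k) * dcoord C t / ((coord C t - cv C x k)\<^sup>2 + r))
        + g' * (2 * t / (t\<^sup>2 + r)) - w * (2 * t)) + 0) (at t)"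
        by (intro DERIV_add DERIV_diff DERIV_cmult DERIV_sum DERIV_const)
      then show ?thesis unfolding K dlogW by simp
    qed
    have dP: "((\<lambda>t. phi C n j u (x(j := t))) has_field_derivative dphi C n j u (x(j := t))) (at t)" for t
      unfolding phi dphi by (auto intro!: derivative_eq_intros simp: algebra_simps)
    show "(?F has_field_derivative ?E (x(j := t))) (at t)" for t
      by (rule DERIV_cong[OF DERIV_mult[OF dP DERIV_fun_exp[OF dL]]]) (simp add: algebra_simps)
    show "isCont (\<lambda>t. ?E (x(j := t))) t" for t
      unfolding phi dphi dlogW K
      by (intro continuous_intros) (auto simp: p' intro!: p less_imp_neq[OF p, symmetric])
    \<comment> \<open>The majorant of the boundary terms collects the exponents 1 from
      \<open>wfac\<close>, 2 * u j from the power of \<open>coord\<close>, and N from the weight; c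
      is constant in t.\<close>
    define N where "N = nat \<lceil>4 * g * real n + 2 * g'\<rceil>"
    define c where "c = \<bar>R\<bar> * (\<Prod>i\<in>?J. (1 + \<bar>x i\<bar>) ^ N * exp (- w * (x i)\<^sup>2))"
    have bound: "norm (?F t) \<le> ((1 + \<bar>t\<bar>) ^ (1 + 2 * u j + N) * exp (- w * t\<^sup>2)) * c" for t
    proof -
      have "exp (logW C n g g' w r (x(j := t))) \<le> (\<Prod>i=1..n. (1 + \<bar>(x(j := t)) i\<bar>) ^ N * exp (- w * ((x(j := t)) i)\<^sup>2))"
        unfolding N_def using pos by (intro exp_logW_le) auto
      also have "\<dots> = ((1 + \<bar>t\<bar>) ^ N * exp (- w * t\<^sup>2)) *
          (\<Prod>i\<in>?J. (1 + \<bar>(x(j := t)) i\<bar>) ^ N * exp (- w * ((x(j := t)) i)\<^sup>2))"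
        using j by (subst prod.remove[of _ j]) auto
      also have "(\<Prod>i\<in>?J. (1 + \<bar>(x(j := t)) i\<bar>) ^ N * exp (- w * ((x(j := t)) i)\<^sup>2))
          = (\<Prod>i\<in>?J. (1 + \<bar>x i\<bar>) ^ N * exp (- w * (x i)\<^sup>2))"
        by (rule prod.cong) auto
      finally have e: "exp (logW C n g g' w r (x(j := t))) \<le> ((1 + \<bar>t\<bar>) ^ N * exp (- w * t\<^sup>2)) *
          (\<Prod>i\<in>?J. (1 + \<bar>x i\<bar>) ^ N * exp (- w * (x i)\<^sup>2))" .
      have "\<bar>wfac C t\<bar> \<le> 1 + \<bar>t\<bar>" by (cases C) auto
      moreover have "\<bar>coord C t\<bar> ^ u j \<le> ((1 + \<bar>t\<bar>)\<^sup>2) ^ u j"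
        using one_plus_coord_le[of C t] by (intro power_mono) auto
      ultimately have "\<bar>phi C n j u (x(j := t))\<bar> \<le> (1 + \<bar>t\<bar>) * (((1 + \<bar>t\<bar>)\<^sup>2) ^ u j * \<bar>R\<bar>)"
        unfolding phi abs_mult power_abs by (intro mult_mono) auto
      then have "norm (?F t) \<le> ((1 + \<bar>t\<bar>) * (((1 + \<bar>t\<bar>)\<^sup>2) ^ u j * \<bar>R\<bar>)) * (((1 + \<bar>t\<bar>) ^ N * exp (- w * t\<^sup>2)) *
          (\<Prod>i\<in>?J. (1 + \<bar>x i\<bar>) ^ N * exp (- w * (x i)\<^sup>2)))"
        unfolding real_norm_def abs_mult using e by (intro mult_mono) auto
      then show ?thesis
        unfolding c_def power_add power_mult power_one_right by (simp only: mult_ac)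
    qed
    show "(?F \<longlongrightarrow> 0) at_top"
      by (rule Lim_null_comparison[OF always_eventually[OF allI[OF bound]]
        tendsto_mult_left_zero[OF poly_gauss_tendsto_0(1)[OF pos(3)]]])
    show "(?F \<longlongrightarrow> 0) at_bot"
      by (rule Lim_null_comparison[OF always_eventually[OF allI[OF bound]]
        tendsto_mult_left_zero[OF poly_gauss_tendsto_0(2)[OF pos(3)]]])
  qed
  have "(LINT x|lebI n. ?E x) = (LINT x|(\<Pi>\<^sub>M i\<in>insert j ?J. (lborel :: real measure)). ?E x)"
    by (simp only: lebI_def I)
  also have "\<dots> = (LINT x|(\<Pi>\<^sub>M i\<in>?J. (lborel :: real measure)). LINT t|lborel. ?E (x(j := t)))"
    using True by (intro lb.product_integral_insert) (simp_all only: I lebI_def, auto)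
  also have "\<dots> = 0"
    unfolding inner by simp
  finally show ?thesis .
next
  case False
  then show ?thesis by (rule not_integrable_integral_eq)
qed

text \<open>Equal to 2 * w times the argument (\<alpha> + \<beta> * y j) * y^u of the Stein
  identity, with the constants of \<open>dunkl_form_Lf\<close>.\<close>

definition "bxpow C n j u y = bfac C (y j) * xpow n u y"

lemma bxpow_polys:
  assumes "j \<in> {1..n}" "u \<in> expo n"
  shows "bxpow C n j u \<in> polys n"
proof -
  have "(\<lambda>y. bfac C (y j)) \<in> polys n"
    by (cases C) (use polys_const polys_var[OF assms(1)] lspan_scale in auto)
  then show ?thesis
    unfolding bxpow_def using assms by (intro polys_mult lspan_base)
qed

lemma tame_bfac: "j \<in> {1..n} \<Longrightarrow> tame C n (\<lambda>x. bfac C (cv C x j))"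
  by (cases C) (use tame_cv tame_const tame_mult in auto)

lemma tame_bxpow: "j \<in> {1..n} \<Longrightarrow> tame C n (\<lambda>x. bxpow C n j u (cv C x))"
  unfolding bxpow_def by (intro tame_mult tame_xpow tame_bfac)

lemma tame_bxpow_transpose:
  assumes "j \<in> {1..n}" "k \<in> {1..n}"
  shows "tame C n (\<lambda>x. bxpow C n j u (cv C x \<circ> tr j k))"
  unfolding bxpow_def xpow_transpose[OF assms]
  using tame_mult[OF tame_bfac[OF assms(2)] tame_xpow] by simp

abbreviation "dbx C n j u k x \<equiv> ddiff j k (bxpow C n j u) (cv C x)"

lemma tame_ddiff_bxpow:
  assumes "j \<in> {1..n}" "k \<in> {1..n}" "j \<noteq> k" "u \<in> expo n"
  shows "tame C n (\<lambda>x. dbx C n j u k x)"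
proof (rule tame_polys[OF polys_ddiff[OF bxpow_polys[OF assms(1,4)] assms(1-3)]])
  note [measurable] = tame_measurable[OF tame_bxpow[OF assms(1)]]
    tame_measurable[OF tame_bxpow_transpose[OF assms(1,2)]] cv_measurable[OF assms(1)] cv_measurable[OF assms(2)]
  show "(\<lambda>x. dbx C n j u k x) \<in> meas n"
    unfolding ddiff_def by measurable
qed

lemma xpow_cong: "(\<And>i. i \<in> {1..n} \<Longrightarrow> x i = y i) \<Longrightarrow> xpow n u x = xpow n u y"
  unfolding xpow_def by (intro prod.cong) auto

lemma logW_cong: "(\<And>i. i \<in> {1..n} \<Longrightarrow> x i = y i) \<Longrightarrow> logW C n g g' w r x = logW C n g g' w r y"
  unfolding logW_def cv_def by (intro arg_cong2[of _ _ _ _ "(+)"] arg_cong2[of _ _ _ _ "(*)"] sum.cong refl) auto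

text \<open>
  Averaging over the transposition turns the kernel d / (d^2 + r), singular as r tends to 0, into
  a difference quotient times a bounded factor.
\<close>

lemma symmetrization:
  fixes C :: wtype
  assumes j: "j \<in> {1..n}" and k: "k \<in> {1..n}" and jk: "j \<noteq> k" and u: "u \<in> expo n"
    and pos: "g \<ge> 0" "g' \<ge> 0" "w > 0" "0 < r" "r \<le> 1"
  defines "d \<equiv> \<lambda>x. cv C x j - cv C x k"
  shows "integrable (lebI n) (\<lambda>x. bxpow C n j u (cv C x) * (d x / ((d x)\<^sup>2 + r)) * W C n g g' w r x)"
    and "integrable (lebI n) (\<lambda>x. dbx C n j u k x * ratio r (d x) * W C n g g' w r x)"
    and "2 * (LINT x|lebI n. bxpow C n j u (cv C x) * (d x / ((d x)\<^sup>2 + r)) * W C n g g' w r x) =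
      (LINT x|lebI n. dbx C n j u k x * ratio r (d x) * W C n g g' w r x)"
proof -
  let ?W = "\<lambda>x. W C n g g' w r x"
  let ?Q = "\<lambda>x. bxpow C n j u (cv C x)" and ?R = "\<lambda>x. bxpow C n j u (cv C x \<circ> tr j k)"
  let ?q = "\<lambda>x. d x / ((d x)\<^sup>2 + r)" and ?t = "\<lambda>x. ratio r (d x)"
  have perm: "tr j k permutes {1..n}" by (rule tr_permutes[OF j k])
  note [measurable] = tame_measurable[OF tame_bxpow[OF j]] tame_measurable[OF tame_bxpow_transpose[OF j k]]
    cv_measurable[OF j] cv_measurable[OF k]
  have dm [measurable]: "d \<in> meas n" unfolding d_def by measurable
  have p: "0 < (d x)\<^sup>2 + r" for x using pos(4) by (simp add: add_nonneg_pos)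
  have td: "tame C n d"
    unfolding d_def using tame_add[OF tame_cv[OF j] tame_mult[OF tame_const[of C n "-1"] tame_cv[OF k]]] by simp
  have tq: "tame C n ?q"
  proof (rule tame_dominated[OF tame_mult[OF td tame_const[of C n "1 / r"]]])
    show "\<bar>?q x\<bar> \<le> \<bar>d x * (1 / r)\<bar>" for x
      using p[of x] pos(4) by (simp add: abs_divide divide_left_mono)
  qed measurable
  have tt: "tame C n ?t"
  proof (rule tame_dominated[OF tame_const[of C n 1]])
    show "\<bar>?t x\<bar> \<le> \<bar>1\<bar>" for x
      using p[of x] pos(4) by simp
  qed measurable
  note I = integrable_tame[OF _ pos(1-3) less_imp_le[OF pos(4)] pos(5)]
  show 1: "integrable (lebI n) (\<lambda>x. ?Q x * ?q x * ?W x)"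
    by (intro I tame_mult tame_bxpow[OF j] tq)
  show 2: "integrable (lebI n) (\<lambda>x. dbx C n j u k x * ?t x * ?W x)"
    by (intro I tame_mult tame_ddiff_bxpow j k jk u tt)
  have 3: "integrable (lebI n) (\<lambda>x. ?R x * ?q x * ?W x)"
    by (intro I tame_mult tame_bxpow_transpose j k tq)
  have "(LINT x|lebI n. ?Q x * ?q x * ?W x) = (LINT x|lebI n. (\<lambda>x. ?Q x * ?q x * ?W x) (x \<circ> tr j k))"
  proof (rule integral_permute[OF perm, symmetric])
    show "(\<lambda>x. ?Q x * ?q x * ?W x) \<in> meas n" by measurable
    fix x y :: point assume xy: "\<And>i. i \<in> {1..n} \<Longrightarrow> x i = y i"
    then have "xpow n u (cv C x) = xpow n u (cv C y)" by (intro xpow_cong) (simp add: cv_def)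
    then show "?Q x * ?q x * ?W x = ?Q y * ?q y * ?W y"
      using xy[OF j] xy[OF k] logW_cong[of n x y, OF xy] by (simp add: bxpow_def d_def cv_def)
  qed
  also have "\<dots> = (LINT x|lebI n. - (?R x * ?q x * ?W x))"
  proof (rule lint_cong)
    fix x :: point
    have "d (x \<circ> tr j k) = - d x" by (simp add: d_def cv_def)
    then show "(\<lambda>x. ?Q x * ?q x * ?W x) (x \<circ> tr j k) = - (?R x * ?q x * ?W x)"
      by (simp add: logW_permute[OF perm] cv_permute)
  qed
  finally have "2 * (LINT x|lebI n. ?Q x * ?q x * ?W x)
      = (LINT x|lebI n. ?Q x * ?q x * ?W x) - (LINT x|lebI n. ?R x * ?q x * ?W x)"
    by simp
  also have "\<dots> = (LINT x|lebI n. ?Q x * ?q x * ?W x - ?R x * ?q x * ?W x)"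
    by (rule Bochner_Integration.integral_diff[OF 1 3, symmetric])
  also have "\<dots> = (LINT x|lebI n. dbx C n j u k x * ?t x * ?W x)"
  proof (rule lint_cong)
    fix x :: point
    show "?Q x * ?q x * ?W x - ?R x * ?q x * ?W x = dbx C n j u k x * ?t x * ?W x"
    \<comment> \<open>For d x = 0 the kernels on both sides have numerator 0, so both sides
      vanish.\<close>
    proof (cases "d x = 0")
      case False
      have "?Q x * ?q x * ?W x - ?R x * ?q x * ?W x = (?Q x - ?R x) * ?q x * ?W x"
        by (simp only: left_diff_distrib)
      also have "?Q x - ?R x = dbx C n j u k x * d x"
        using False by (simp add: ddiff_def d_def)
      also have "dbx C n j u k x * d x * ?q x * ?W x
          = dbx C n j u k x * ?t x * ?W x"
        by (simp add: power2_eq_square)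
      finally show ?thesis .
    qed simp
  qed
  finally show "2 * (LINT x|lebI n. ?Q x * ?q x * ?W x)
      = (LINT x|lebI n. dbx C n j u k x * ?t x * ?W x)" .
qed

definition "steinG C n g' w r j u x = dphi C n j u x + 2 * g' * xpow n u (cv C x) * ratio r (x j)
     - 2 * w * (cv C x j * xpow n u (cv C x))"

text \<open>D j applied to \<open>bxpow\<close>, minus 2 * w times the right-hand side of the Stein
  identity, with a factor \<open>ratio\<close> attached to every term that stems from a logarithm;
  at r = 0 and generic points these factors are 1.\<close>

definition "steinI C n g g' w r j u x = steinG C n g' w r j u x
     + g * (\<Sum>k\<in>{1..n}-{j}. dbx C n j u k x * ratio r (cv C x j - cv C x k))"

lemma tame_dphi: "j \<in> {1..n} \<Longrightarrow> tame C n (dphi C n j u)"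
  unfolding dphi_def by (intro tame_add tame_mult tame_const tame_xpow tame_bfac)

lemma ratio_measurable:
  fixes d :: "point \<Rightarrow> real"
  assumes [measurable]: "d \<in> meas n"
  shows "(\<lambda>x. ratio r (d x)) \<in> meas n"
  by measurable

lemma ratio_le_1: "0 \<le> r \<Longrightarrow> \<bar>(y::real)\<^sup>2 / (y\<^sup>2 + r)\<bar> \<le> 1"
proof (cases "y\<^sup>2 + r = 0")
  case False
  assume "0 \<le> r"
  moreover from this False have "0 < y\<^sup>2 + r"
    using zero_le_power2[of y] by linarith
  ultimately show ?thesis by simp
qed simp

text \<open>The kernels in \<open>integral_by_parts\<close> are replaced by difference quotients
  through \<open>symmetrization\<close>; its factor 2 is the 2 in the derivative of the squared
  difference.\<close>

lemma stein_regularized: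
  assumes j: "j \<in> {1..n}" and u: "u \<in> expo n" and AB: "C = TypeA \<Longrightarrow> g' = 0"
    and pos: "g \<ge> 0" "g' \<ge> 0" "w > 0" "0 < r" "r \<le> 1"
  shows "(LINT x|lebI n. steinI C n g g' w r j u x * W C n g g' w r x) = 0"
proof -
  let ?W = "\<lambda>x. W C n g g' w r x" and ?J = "{1..n}-{j}"
  let ?d = "\<lambda>k x. cv C x j - cv C x k"
  let ?A = "\<lambda>k x. bxpow C n j u (cv C x) * (?d k x / ((?d k x)\<^sup>2 + r)) * ?W x"
  let ?B = "\<lambda>k x. dbx C n j u k x * ratio r (?d k x) * ?W x"
  let ?G = "steinG C n g' w r j u"
  have sym: "integrable (lebI n) (?A k)" "integrable (lebI n) (?B k)"
      "2 * (LINT x|lebI n. ?A k x) = (LINT x|lebI n. ?B k x)" if "k \<in> ?J" for k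
    using symmetrization[OF j _ _ u pos, of k] that by auto
  have tamek: "tame C n (\<lambda>x. ratio r (x j))"
    using ratio_le_1[of r] pos(4)
    by (intro tame_dominated[OF tame_const[of C n 1] ratio_measurable[OF component_measurable[OF j]]]) auto
  have "tame C n (\<lambda>x. dphi C n j u x + 2 * g' * xpow n u (cv C x) * ratio r (x j)
      + (- 2 * w) * (cv C x j * xpow n u (cv C x)))"
    by (intro tame_add tame_mult tame_const tame_xpow tame_cv tame_dphi tamek j)
  then have GI: "integrable (lebI n) (\<lambda>x. ?G x * ?W x)"
    unfolding steinG_def using integrable_tame[OF _ pos(1-3) less_imp_le[OF pos(4)] pos(5)] by simp
  have AI: "integrable (lebI n) (\<lambda>x. 2 * g * (\<Sum>k\<in>?J. ?A k x))"
    by (intro integrable_mult_right Bochner_Integration.integrable_sum sym(1))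
  have BI: "integrable (lebI n) (\<lambda>x. g * (\<Sum>k\<in>?J. ?B k x))"
    by (intro integrable_mult_right Bochner_Integration.integrable_sum sym(2))
  have "(LINT x|lebI n. steinI C n g g' w r j u x * ?W x) = (LINT x|lebI n. ?G x * ?W x + g * (\<Sum>k\<in>?J. ?B k x))"
    unfolding steinI_def sum_distrib_right[symmetric] by (simp only: distrib_right mult.assoc)
  also have "\<dots> = (LINT x|lebI n. ?G x * ?W x) + (LINT x|lebI n. g * (\<Sum>k\<in>?J. ?B k x))"
    by (rule Bochner_Integration.integral_add[OF GI BI])
  also have "(LINT x|lebI n. g * (\<Sum>k\<in>?J. ?B k x)) = g * (\<Sum>k\<in>?J. LINT x|lebI n. ?B k x)"
    using sym(2) by (subst integral_mult_right_zero, subst Bochner_Integration.integral_sum) auto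
  also have "(\<Sum>k\<in>?J. LINT x|lebI n. ?B k x) = (\<Sum>k\<in>?J. 2 * (LINT x|lebI n. ?A k x))"
    by (rule sum.cong[OF refl sym(3)[symmetric]])
  also have "g * (\<Sum>k\<in>?J. 2 * (LINT x|lebI n. ?A k x)) = 2 * g * (\<Sum>k\<in>?J. LINT x|lebI n. ?A k x)"
    by (simp only: sum_distrib_left[symmetric] mult.assoc mult.left_commute)
  also have "\<dots> = (LINT x|lebI n. 2 * g * (\<Sum>k\<in>?J. ?A k x))"
    using sym(1) by (subst integral_mult_right_zero, subst Bochner_Integration.integral_sum) auto
  also have "(LINT x|lebI n. ?G x * ?W x) + (LINT x|lebI n. 2 * g * (\<Sum>k\<in>?J. ?A k x))
      = (LINT x|lebI n. ?G x * ?W x + 2 * g * (\<Sum>k\<in>?J. ?A k x))"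
    by (rule Bochner_Integration.integral_add[OF GI AI, symmetric])
  also have "\<dots> = (LINT x|lebI n. (dphi C n j u x + phi C n j u x * dlogW C n g g' w r j x) * ?W x)"
  proof (rule lint_cong)
    fix x :: point
    let ?P = "xpow n u (cv C x)"
    have a: "phi C n j u x * (\<Sum>k\<in>?J. 2 * ?d k x * dcoord C (x j) / ((?d k x)\<^sup>2 + r))
        = 2 * (\<Sum>k\<in>?J. bxpow C n j u (cv C x) * (?d k x / ((?d k x)\<^sup>2 + r)))"
      unfolding sum_distrib_left
    proof (rule sum.cong[OF refl])
      fix k
      have "bxpow C n j u (cv C x) = wfac C (x j) * dcoord C (x j) * ?P"
        by (simp add: bxpow_def wfac_dcoord cv_def)
      then show "phi C n j u x * (2 * ?d k x * dcoord C (x j) / ((?d k x)\<^sup>2 + r))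
          = 2 * (bxpow C n j u (cv C x) * (?d k x / ((?d k x)\<^sup>2 + r)))"
        by (simp add: phi_def)
    qed
    \<comment> \<open>In type B the factor x j of \<open>phi\<close> completes 2 * x j / ((x j)^2 +
      r) to twice \<open>ratio\<close>; in type A there is no such factor, and g' = 0.\<close>
    have b: "phi C n j u x * (g' * (2 * x j / ((x j)\<^sup>2 + r))) = 2 * g' * ?P * ratio r (x j)"
      using AB by (cases C) (simp_all add: phi_def power2_eq_square)
    have c: "phi C n j u x * (w * (2 * x j)) = 2 * w * (cv C x j * ?P)"
      using wfac_mult_self[of "x j" C] by (simp add: phi_def cv_def mult_ac flip: wfac_mult_self)
    have d: "phi C n j u x * dlogW C n g g' w r j x = g * (2 * (\<Sum>k\<in>?J. bxpow C n j u (cv C x) * (?d k x / ((?d k x)\<^sup>2 + r))))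
        + 2 * g' * ?P * ratio r (x j) - 2 * w * (cv C x j * ?P)"
      unfolding dlogW_def a[symmetric] b[symmetric] c[symmetric] by (simp add: algebra_simps)
    have e: "(\<Sum>k\<in>?J. ?A k x) = (\<Sum>k\<in>?J. bxpow C n j u (cv C x) * (?d k x / ((?d k x)\<^sup>2 + r))) * ?W x"
      by (rule sum_distrib_right[symmetric])
    have regroup: "(a + b - c) * w + 2 * g * (S * w) = (a + (g * (2 * S) + b - c)) * w" for a b c S w :: real
      by (simp add: algebra_simps)
    show "?G x * ?W x + 2 * g * (\<Sum>k\<in>?J. ?A k x)
        = (dphi C n j u x + phi C n j u x * dlogW C n g g' w r j x) * ?W x"
      unfolding steinG_def d e by (rule regroup)
  qed
  also have "\<dots> = 0"
    by (rule integral_by_parts[OF j pos])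
  finally show ?thesis .
qed

section \<open>The integral as a functional on polynomials\<close>

text \<open>Cutting the weight off at nongeneric points makes the integrand insensitive to values
  there, so \<open>Lf_cong\<close> holds by pointwise equality of the integrands, for arbitrary f
  and h.\<close>

definition "wt C n g g' w x = (if generic C n x then W C n g g' w 0 x else 0)"

lemma generic_measurable: "{x \<in> space (lebI n). generic C n x} \<in> sets (lebI n)"
proof -
  have 1: "{x \<in> space (lebI n). cv C x i - cv C x k \<noteq> 0} \<in> sets (lebI n)"
    if "i \<in> {1..n}" "k \<in> {1..n}" for i k
  proof -
    note [measurable] = cv_measurable[OF that(1), of C] cv_measurable[OF that(2), of C]
    show ?thesis by measurable
  qed
  have 2: "{x \<in> space (lebI n). x i \<noteq> 0} \<in> sets (lebI n)" if "i \<in> {1..n}" for i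
  proof -
    note [measurable] = component_measurable[OF that]
    show ?thesis by measurable
  qed
  have "{x \<in> space (lebI n). generic C n x} = space (lebI n) \<inter>
      (\<Inter>i\<in>{1..n}. (\<Inter>k\<in>{1..n}-{i}. {x \<in> space (lebI n). cv C x i - cv C x k \<noteq> 0}) \<inter>
        {x \<in> space (lebI n). x i \<noteq> 0} \<inter> space (lebI n))"
    by (auto simp: generic_iff)
  also have "\<dots> = {x \<in> space (lebI n). \<forall>i\<in>{1..n}. (\<forall>k\<in>{1..n}-{i}. cv C x i - cv C x k \<noteq> 0) \<and> x i \<noteq> 0}"
    by auto
  also have "\<dots> \<in> sets (lebI n)"
    using 1 2 by (intro sets.sets_Collect_finite_All sets.sets_Collect_conj) auto
  finally show ?thesis .
qed

lemma wt_measurable [measurable]: "wt C n g g' w \<in> meas n"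
  unfolding wt_def
  by (rule measurable_If[OF _ _ generic_measurable]) measurable

lemma wt_nonneg: "0 \<le> wt C n g g' w x"
  by (simp add: wt_def)

lemma tame_abs: "tame C n f \<Longrightarrow> tame C n (\<lambda>x. \<bar>f x\<bar>)"
  by (rule tame_dominated[of C n f]) (auto intro: borel_measurable_abs tame_measurable)

lemma steinI_measurable:
  assumes j: "j \<in> {1..n}" and u: "u \<in> expo n"
  shows "steinI C n g g' w r j u \<in> meas n"
  unfolding steinI_def steinG_def
proof (intro borel_measurable_add borel_measurable_diff borel_measurable_times borel_measurable_const
    borel_measurable_sum)
  fix k assume "k \<in> {1..n}-{j}"
  then have k: "k \<in> {1..n}" "j \<noteq> k" by auto
  show "(\<lambda>x. dbx C n j u k x) \<in> meas n"
    by (rule tame_measurable[OF tame_ddiff_bxpow[OF j k u]])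
  show "(\<lambda>x. ratio r (cv C x j - cv C x k)) \<in> meas n"
    by (intro ratio_measurable borel_measurable_diff cv_measurable j k)
qed (use j in \<open>auto intro!: tame_measurable[OF tame_dphi] tame_measurable[OF tame_xpow]
  ratio_measurable component_measurable cv_measurable\<close>)

lemma ratio_tendsto_1:
  fixes y :: real
  assumes "y \<noteq> 0" "e \<longlonglongrightarrow> 0"
  shows "(\<lambda>m. y\<^sup>2 / (y\<^sup>2 + e m)) \<longlonglongrightarrow> y\<^sup>2 / (y\<^sup>2 + 0)"
  using assms by (intro tendsto_intros) auto

text \<open>Dominated convergence along r = 1 / (m + 1): all factors \<open>ratio\<close> are at
  most 1, so T bounds \<open>steinI\<close> for every r at once.\<close>

lemma stein_limit:
  assumes j: "j \<in> {1..n}" and u: "u \<in> expo n" and AB: "C = TypeA \<Longrightarrow> g' = 0"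
    and pos: "g \<ge> 0" "g' \<ge> 0" "w > 0"
  shows "(LINT x|lebI n. steinI C n g g' w 0 j u x * wt C n g g' w x) = 0"
proof -
  define e where "e m = inverse (real (Suc m))" for m
  have e: "0 < e m" "e m \<le> 1" for m
    by (auto simp: e_def inverse_le_1_iff)
  have e0: "e \<longlonglongrightarrow> 0"
    unfolding e_def by (rule LIMSEQ_inverse_real_of_nat)
  let ?J = "{1..n}-{j}"
  define T where "T x = \<bar>dphi C n j u x\<bar> + g * (\<Sum>k\<in>?J. \<bar>dbx C n j u k x\<bar>)
     + 2 * g' * \<bar>xpow n u (cv C x)\<bar> + 2 * w * \<bar>cv C x j * xpow n u (cv C x)\<bar>" for x
  have "tame C n T"
    unfolding T_def using j u
    by (intro tame_add tame_mult tame_const tame_sum tame_abs tame_dphi tame_ddiff_bxpow tame_xpow tame_cv) auto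
  then obtain B where B: "integrable (lebI n) B" "\<And>x. 0 \<le> B x"
    "\<And>x r. generic C n x \<Longrightarrow> 0 \<le> r \<Longrightarrow> r \<le> 1 \<Longrightarrow> \<bar>T x\<bar> * W C n g g' w r x \<le> B x"
    using tame_dominating[OF _ pos] by metis
  have bound: "\<bar>steinI C n g g' w r j u x\<bar> \<le> T x" if "0 \<le> r" for r x
  proof -
    have r: "\<bar>a * (y\<^sup>2 / (y\<^sup>2 + r))\<bar> \<le> \<bar>a\<bar>" for a y :: real
      using mult_left_mono[OF ratio_le_1[OF that, of y], of "\<bar>a\<bar>"] unfolding abs_mult by simp
    have "\<bar>\<Sum>k\<in>?J. dbx C n j u k x * ratio r (cv C x j - cv C x k)\<bar>
        \<le> (\<Sum>k\<in>?J. \<bar>dbx C n j u k x\<bar>)"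
      by (rule order_trans[OF sum_abs sum_mono[OF r]])
    then have a: "\<bar>g * (\<Sum>k\<in>?J. dbx C n j u k x * ratio r (cv C x j - cv C x k))\<bar>
        \<le> g * (\<Sum>k\<in>?J. \<bar>dbx C n j u k x\<bar>)"
      using pos(1) by (simp only: abs_mult abs_of_nonneg) (rule mult_left_mono)
    have b: "\<bar>2 * g' * xpow n u (cv C x) * ratio r (x j)\<bar> \<le> 2 * g' * \<bar>xpow n u (cv C x)\<bar>"
      using r[of "2 * g' * xpow n u (cv C x)" "x j"] pos(2) by (simp add: abs_mult)
    have c: "\<bar>2 * w * (cv C x j * xpow n u (cv C x))\<bar> \<le> 2 * w * \<bar>cv C x j * xpow n u (cv C x)\<bar>"
      using pos(3) by (simp add: abs_mult)
    show ?thesis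
      unfolding steinI_def steinG_def T_def using a b c by linarith
  qed
  have lim: "(\<lambda>m. LINT x|lebI n. steinI C n g g' w (e m) j u x * exp (logW C n g g' w (e m) x))
      \<longlonglongrightarrow> (LINT x|lebI n. steinI C n g g' w 0 j u x * wt C n g g' w x)"
  proof (rule integral_dominated_convergence[OF _ _ B(1)])
    note [measurable] = steinI_measurable[OF j u]
    show "(\<lambda>x. steinI C n g g' w 0 j u x * wt C n g g' w x) \<in> meas n"
      by measurable
    show "(\<lambda>x. steinI C n g g' w (e m) j u x * exp (logW C n g g' w (e m) x)) \<in> meas n" for m
      by measurable
    show "AE x in lebI n. norm (steinI C n g g' w (e m) j u x * exp (logW C n g g' w (e m) x)) \<le> B x" for m
      using AE_generic
    proof (rule AE_mp, intro AE_I2 impI)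
      fix x assume "generic C n x"
      then have "\<bar>T x\<bar> * exp (logW C n g g' w (e m) x) \<le> B x"
        using e[of m] B(3) by (auto intro: less_imp_le)
      moreover have "\<bar>steinI C n g g' w (e m) j u x\<bar> * exp (logW C n g g' w (e m) x)
          \<le> \<bar>T x\<bar> * exp (logW C n g g' w (e m) x)"
        using bound[of "e m" x] e[of m] by (intro mult_right_mono) auto
      ultimately show "norm (steinI C n g g' w (e m) j u x * exp (logW C n g g' w (e m) x)) \<le> B x"
        unfolding real_norm_def abs_mult abs_exp_cancel by linarith
    qed
    show "AE x in lebI n. (\<lambda>m. steinI C n g g' w (e m) j u x * exp (logW C n g g' w (e m) x))
        \<longlonglongrightarrow> steinI C n g g' w 0 j u x * wt C n g g' w x"
      using AE_generic
    proof (rule AE_mp, intro AE_I2 impI)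
      fix x assume x: "generic C n x"
      have d: "cv C x i - cv C x k \<noteq> 0" if "i \<in> {1..n}" "k \<in> {1..n}-{i}" for i k
        using x that unfolding generic_iff by auto
      have x0: "x i \<noteq> 0" if "i \<in> {1..n}" for i
        using x that unfolding generic_iff by auto
      have "(\<lambda>m. steinI C n g g' w (e m) j u x) \<longlonglongrightarrow> steinI C n g g' w 0 j u x"
        unfolding steinI_def steinG_def
        by (intro tendsto_add tendsto_diff tendsto_mult tendsto_const tendsto_sum ratio_tendsto_1 e0 d x0 j)
      moreover have "(\<lambda>m. logW C n g g' w (e m) x) \<longlonglongrightarrow> logW C n g g' w 0 x"
        unfolding logW_def
        by (intro tendsto_add tendsto_diff tendsto_mult tendsto_const tendsto_sum tendsto_ln e0) (use d x0 in auto)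
      ultimately show "(\<lambda>m. steinI C n g g' w (e m) j u x * exp (logW C n g g' w (e m) x))
        \<longlonglongrightarrow> steinI C n g g' w 0 j u x * wt C n g g' w x"
        using x by (auto simp: wt_def intro!: tendsto_mult tendsto_exp)
    qed
  qed
  moreover have "(LINT x|lebI n. steinI C n g g' w (e m) j u x * exp (logW C n g g' w (e m) x)) = 0" for m
    by (rule stein_regularized[OF j u AB pos e])
  ultimately show ?thesis
    by (simp add: LIMSEQ_const_iff)
qed

definition "Lf C n g g' w f = (LINT x|lebI n. f (cv C x) * wt C n g g' w x)"

lemma wt_regular: "wt C n g g' w x \<noteq> 0 \<Longrightarrow> inj_on (cv C x) {1..n}"
  by (auto simp: wt_def generic_def split: if_splits)

lemma Lf_cong:
  assumes "\<And>y. inj_on y {1..n} \<Longrightarrow> f y = h y"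
  shows "Lf C n g g' w f = Lf C n g g' w h"
  unfolding Lf_def
proof (rule lint_cong)
  fix x
  show "f (cv C x) * wt C n g g' w x = h (cv C x) * wt C n g g' w x"
    using assms wt_regular[of C n g g' w x] by (cases "wt C n g g' w x = 0") auto
qed

lemma integrable_wt:
  assumes "f \<in> polys n" and pos: "g \<ge> 0" "g' \<ge> 0" "w > 0"
  shows "integrable (lebI n) (\<lambda>x. f (cv C x) * wt C n g g' w x)"
  using assms(1)
proof induction
  case (lspan_zero f)
  then have "(\<lambda>x. f (cv C x) * wt C n g g' w x) = (\<lambda>x. 0)"
    using wt_regular by fastforce
  then show ?case by simp
next
  case (lspan_step f u h c)
  have "integrable (lebI n) (\<lambda>x. xpow n u (cv C x) * wt C n g g' w x)"
  proof (subst integrable_cong_AE)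
    note [measurable] = tame_measurable[OF tame_xpow[of C n u]]
    show "(\<lambda>x. xpow n u (cv C x) * wt C n g g' w x) \<in> meas n" by measurable
    show "(\<lambda>x. xpow n u (cv C x) * W C n g g' w 0 x) \<in> meas n" by measurable
    show "AE x in lebI n. xpow n u (cv C x) * wt C n g g' w x = xpow n u (cv C x) * W C n g g' w 0 x"
      using AE_generic by (rule AE_mp) (auto simp: wt_def)
    show "integrable (lebI n) (\<lambda>x. xpow n u (cv C x) * W C n g g' w 0 x)"
      by (rule integrable_tame[OF tame_xpow pos]) auto
  qed
  then have "integrable (lebI n) (\<lambda>x. f (cv C x) * wt C n g g' w x + c * (xpow n u (cv C x) * wt C n g g' w x))"
    using lspan_step by (intro Bochner_Integration.integrable_add integrable_mult_right)
  moreover have "h (cv C x) * wt C n g g' w x =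
      f (cv C x) * wt C n g g' w x + c * (xpow n u (cv C x) * wt C n g g' w x)" for x
    using lspan_step wt_regular[of C n g g' w x]
    by (cases "wt C n g g' w x = 0") (auto simp: algebra_simps)
  ultimately show ?case by simp
qed

lemma wt_permute:
  assumes "p permutes {1..n}"
  shows "wt C n g g' w (x \<circ> p) = wt C n g g' w x"
proof -
  have "(\<forall>i\<in>{1..n}. (x \<circ> p) i \<noteq> 0) \<longleftrightarrow> (\<forall>i\<in>p ` {1..n}. x i \<noteq> 0)" by auto
  then have "generic C n (x \<circ> p) \<longleftrightarrow> generic C n x"
    unfolding generic_def cv_permute regular_permute[OF assms] permutes_image[OF assms] by simp
  then show ?thesis
    by (simp add: wt_def logW_permute[OF assms])
qed

lemma wt_cong:
  assumes "\<And>i. i \<in> {1..n} \<Longrightarrow> x i = y i"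
  shows "wt C n g g' w x = wt C n g g' w y"
proof -
  have "generic C n x = generic C n y"
    using assms unfolding generic_iff cv_def by auto
  then show ?thesis
    unfolding wt_def using logW_cong[of n x y, OF assms] by simp
qed

text \<open>\<open>bfac\<close> has derivative 2 * \<open>tdelta\<close>, while \<open>dphi\<close>
  contains \<open>tdelta\<close> once; the surplus reappears in \<open>steinI_generic\<close> and
  enters the constant s.\<close>

lemma deriv_bxpow:
  assumes j: "j \<in> {1..n}"
  shows "deriv (\<lambda>t. bxpow C n j u (y(j := t))) (y j) =
    2 * tdelta C * xpow n u y + bfac C (y j) * (real (u j) * xpow n (u(j := u j - 1)) y)"
proof -
  have "((\<lambda>t. bfac C t) has_field_derivative 2 * tdelta C) (at (y j))"
    by (cases C) (auto intro!: derivative_eq_intros)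
  then have "((\<lambda>t. bfac C t * xpow n u (y(j := t))) has_field_derivative
      2 * tdelta C * xpow n u (y(j := y j)) + real (u j) * xpow n (u(j := u j - 1)) y * bfac C (y j)) (at (y j))"
    by (rule DERIV_mult[OF _ DERIV_xpow[OF j]])
  then show ?thesis
    unfolding bxpow_def by (simp add: DERIV_imp_deriv mult.commute)
qed

lemma steinI_generic:
  assumes j: "j \<in> {1..n}" and x: "generic C n x"
  shows "steinI C n g g' w 0 j u x =
    dunkl n g j (bxpow C n j u) (cv C x) - (2 * w * cv C x j + (tdelta C - 2 * g')) * xpow n u (cv C x)"
proof -
  have "cv C x j - cv C x k \<noteq> 0" if "k \<in> {1..n}-{j}" for k
    using x j that unfolding generic_iff by auto
  then have 1: "(\<Sum>k\<in>{1..n}-{j}. dbx C n j u k x *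
         ((cv C x j - cv C x k)\<^sup>2 / ((cv C x j - cv C x k)\<^sup>2 + 0))) = (\<Sum>k\<in>{1..n}-{j}. dbx C n j u k x)"
    by (intro sum.cong) auto
  have "x j \<noteq> 0" using x j unfolding generic_iff by auto
  then have 2: "(x j)\<^sup>2 / ((x j)\<^sup>2 + 0) = 1" by simp
  show ?thesis
    unfolding steinI_def steinG_def dunkl_def 1 2 deriv_bxpow[OF j] dphi_def by (simp add: algebra_simps)
qed

lemma Lf_add:
  assumes "f \<in> polys n" "h \<in> polys n" "g \<ge> 0" "g' \<ge> 0" "w > 0"
  shows "Lf C n g g' w (\<lambda>x. f x + c * h x) = Lf C n g g' w f + c * Lf C n g g' w h"
  unfolding Lf_def
  using Bochner_Integration.integral_add[OF integrable_wt[OF assms(1,3-5), of C]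
      integrable_mult_right[OF integrable_wt[OF assms(2-5), of C], of c]]
  by (simp add: algebra_simps)

text \<open>\<open>bfac\<close> is affine, so dividing the limit identity by 2 * w yields \<alpha>,
  \<beta>, s. They are 1 / (2 * w), 0, 0 in type A and 0, 1 / w, (1 - 2 * g') / (2 * w) in type
  B.\<close>

lemma dunkl_form_Lf:
  fixes C n g g' w
  assumes AB: "C = TypeA \<Longrightarrow> g' = 0" and pos: "g \<ge> 0" "g' \<ge> 0" "w > 0"
  shows "dunkl_form n g (Lf C n g g' w) (bfac C 0 / (2 * w)) ((bfac C 1 - bfac C 0) / (2 * w))
    ((tdelta C - 2 * g') / (2 * w))"
proof
  let ?L = "Lf C n g g' w"
  let ?\<alpha> = "bfac C 0 / (2 * w)" and ?\<beta> = "(bfac C 1 - bfac C 0) / (2 * w)" and ?s = "(tdelta C - 2 * g') / (2 * w)"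
  have zero: "?L (\<lambda>x. 0) = 0" by (simp add: Lf_def)
  have zP: "(\<lambda>x. 0) \<in> polys n" by (rule polys_const)
  show "g \<ge> 0" by fact
  show "?L f = ?L h" if "\<And>x. inj_on x {1..n} \<Longrightarrow> f x = h x" for f h
    using that by (rule Lf_cong)
  show "?L (\<lambda>x. f x + h x) = ?L f + ?L h" if "f \<in> polys n" "h \<in> polys n" for f h
    using Lf_add[OF that pos, of C 1] by simp
  show scale: "?L (\<lambda>x. c * f x) = c * ?L f" if "f \<in> polys n" for f c
    using Lf_add[OF zP that pos, of C c] zero by simp
  show "0 \<le> ?L (\<lambda>x. f x * f x)" for f
    unfolding Lf_def by (intro Bochner_Integration.integral_nonneg) (simp add: wt_nonneg)
  \<comment> \<open>Induction over the span leads to monomials, whose measurability allows the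
    change of variables; f itself is arbitrary off the regular points.\<close>
  show "?L (\<lambda>x. f (x \<circ> p)) = ?L f" if p: "p permutes {1..n}" and f: "f \<in> polys n" for f p
    using f
  proof induction
    case (lspan_zero f)
    then have "f (x \<circ> p) = 0" if "inj_on x {1..n}" for x
      using regular_permute[OF p] that by blast
    then have "?L (\<lambda>x. f (x \<circ> p)) = ?L (\<lambda>x. 0)" by (rule Lf_cong)
    moreover have "?L f = ?L (\<lambda>x. 0)" using lspan_zero by (intro Lf_cong) auto
    ultimately show ?case by (rule trans[OF _ sym])
  next
    case (lspan_step f u h c)
    have u: "xpow n u \<in> polys n" using lspan_step by (intro lspan_base)
    let ?H = "\<lambda>x. xpow n u (cv C x) * wt C n g g' w x"
    have "?L (\<lambda>x. xpow n u (x \<circ> p)) = (LINT x|lebI n. ?H (x \<circ> p))"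
      by (simp add: Lf_def cv_permute wt_permute[OF p])
    also have "\<dots> = (LINT x|lebI n. ?H x)"
    proof (rule integral_permute[OF p])
      note [measurable] = tame_measurable[OF tame_xpow[of C n u]]
      show "?H \<in> meas n" by measurable
      fix x y :: point assume xy: "\<And>i. i \<in> {1..n} \<Longrightarrow> x i = y i"
      then have "xpow n u (cv C x) = xpow n u (cv C y)" by (intro xpow_cong) (simp add: cv_def)
      then show "?H x = ?H y" using wt_cong[of n x y, OF xy] by simp
    qed
    finally have 1: "?L (\<lambda>x. xpow n u (x \<circ> p)) = ?L (xpow n u)" by (simp add: Lf_def)
    have "?L (\<lambda>x. h (x \<circ> p)) = ?L (\<lambda>x. f (x \<circ> p) + c * xpow n u (x \<circ> p))"
      using lspan_step regular_permute[OF p] by (intro Lf_cong) blast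
    also have "\<dots> = ?L (\<lambda>x. f (x \<circ> p)) + c * ?L (\<lambda>x. xpow n u (x \<circ> p))"
      by (rule Lf_add[OF polys_permute[OF p lspan_step(1)] polys_permute[OF p u] pos])
    also have "\<dots> = ?L f + c * ?L (xpow n u)" by (simp only: 1 lspan_step.IH)
    also have "\<dots> = ?L (\<lambda>x. f x + c * xpow n u x)"
      by (rule Lf_add[OF lspan_step(1) u pos, symmetric])
    also have "\<dots> = ?L h"
      using lspan_step by (intro Lf_cong) auto
    finally show ?case .
  qed
  fix j u assume j: "j \<in> {1..n}" and u: "u \<in> expo n"
  note bP = bxpow_polys[OF j u, of C]
  have xP: "(\<lambda>y. (2 * w * y j + (tdelta C - 2 * g')) * xpow n u y) \<in> polys n"
    using j u by (intro polys_mult lspan_add lspan_scale polys_var polys_const lspan_base)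
  have dP: "dunkl n g j (bxpow C n j u) \<in> polys n" by (rule polys_dunkl[OF bP j])
  have "?L (\<lambda>y. dunkl n g j (bxpow C n j u) y + (-1) * ((2 * w * y j + (tdelta C - 2 * g')) * xpow n u y))
      = (LINT x|lebI n. steinI C n g g' w 0 j u x * wt C n g g' w x)"
    unfolding Lf_def
    by (rule lint_cong) (auto simp: wt_def steinI_generic[OF j])
  also have "\<dots> = 0" by (rule stein_limit[OF j u AB pos])
  finally have main: "?L (dunkl n g j (bxpow C n j u)) = ?L (\<lambda>y. (2 * w * y j + (tdelta C - 2 * g')) * xpow n u y)"
    using Lf_add[OF dP xP pos, of C "-1"] by simp
  have "?L (dunkl n g j (\<lambda>y. (?\<alpha> + ?\<beta> * y j) * xpow n u y)) = ?L (\<lambda>y. 1 / (2 * w) * dunkl n g j (bxpow C n j u) y)"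
  proof (rule Lf_cong)
    fix y :: point assume y: "inj_on y {1..n}"
    have "(\<lambda>y. (?\<alpha> + ?\<beta> * y j) * xpow n u y) = (\<lambda>y. 0 + 1 / (2 * w) * bxpow C n j u y)"
    proof
      fix y :: point
      have "?\<alpha> + ?\<beta> * y j = 1 / (2 * w) * bfac C (y j)"
        by (cases C) (auto simp: field_simps)
      then show "(?\<alpha> + ?\<beta> * y j) * xpow n u y = 0 + 1 / (2 * w) * bxpow C n j u y"
        by (simp add: bxpow_def)
    qed
    then show "dunkl n g j (\<lambda>y. (?\<alpha> + ?\<beta> * y j) * xpow n u y) y = 1 / (2 * w) * dunkl n g j (bxpow C n j u) y"
      using dunkl_add[OF zP bP y j, of g "1 / (2 * w)"] by simp
  qed
  also have "\<dots> = 1 / (2 * w) * ?L (dunkl n g j (bxpow C n j u))"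
    by (rule scale[OF dP])
  also have "\<dots> = ?L (\<lambda>y. 1 / (2 * w) * ((2 * w * y j + (tdelta C - 2 * g')) * xpow n u y))"
    unfolding main by (rule scale[OF xP, symmetric])
  also have "\<dots> = ?L (\<lambda>y. (y j + ?s) * xpow n u y)"
    using pos(3) by (intro Lf_cong) (simp add: field_simps)
  finally show "?L (dunkl n g j (\<lambda>y. (?\<alpha> + ?\<beta> * y j) * xpow n u y)) = ?L (\<lambda>y. (y j + ?s) * xpow n u y)" .
qed

section \<open>Hermite and Laguerre polynomials\<close>

lemma sum_symmetric_pairs:
  fixes f :: "nat \<Rightarrow> nat \<Rightarrow> real"
  assumes "\<And>i k. f i k = f k i"
  shows "(\<Sum>i=1..n. \<Sum>k\<in>{1..n}-{i}. f i k) = 2 * (\<Sum>k=1..n. \<Sum>j\<in>{1..<k}. f j k)"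
proof -
  have "(\<Sum>i=1..n. \<Sum>k\<in>{1..n}-{i}. f i k)
      = (\<Sum>i=1..n. (\<Sum>k=1..n. if k < i then f i k else 0) + (\<Sum>k=1..n. if i < k then f i k else 0))"
  proof (rule sum.cong[OF refl])
    fix i
    have "(\<Sum>k\<in>{1..n}-{i}. f i k) = (\<Sum>k=1..n. (if k < i then f i k else 0) + (if i < k then f i k else 0))"
      by (rule sum.mono_neutral_cong_left) auto
    then show "(\<Sum>k\<in>{1..n}-{i}. f i k) = (\<Sum>k=1..n. if k < i then f i k else 0) + (\<Sum>k=1..n. if i < k then f i k else 0)"
      by (simp add: sum.distrib)
  qed
  also have "\<dots> = (\<Sum>i=1..n. \<Sum>k=1..n. if k < i then f i k else 0) + (\<Sum>k=1..n. \<Sum>i=1..n. if i < k then f i k else 0)"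
    unfolding sum.distrib by (subst (2) sum.swap) simp
  also have "\<dots> = 2 * (\<Sum>k=1..n. \<Sum>j=1..n. if j < k then f j k else 0)"
    by (simp add: assms cong: if_cong)
  also have "(\<Sum>k=1..n. \<Sum>j=1..n. if j < k then f j k else 0) = (\<Sum>k=1..n. \<Sum>j\<in>{1..<k}. f j k)"
    by (intro sum.cong refl sum.mono_neutral_cong_right) auto
  finally show ?thesis .
qed

text \<open>The type A weight does not involve g1; the value 0 gives both types the same logarithmic
  form.\<close>

definition gexp :: "wtype \<Rightarrow> real \<Rightarrow> real" where
  "gexp C g1 = (case C of TypeA \<Rightarrow> 0 | TypeB \<Rightarrow> g1)"

lemma weight_eq:
  "weight C n g0 g1 w x = (\<Prod>k\<in>{1..n}. \<Prod>j\<in>{1..<k}. \<bar>cv C x j - cv C x k\<bar> powr (2 * g0)) *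
     (\<Prod>j\<in>{1..n}. (case C of TypeA \<Rightarrow> 1 | TypeB \<Rightarrow> \<bar>x j\<bar> powr (2 * g1)) * exp (- w * (x j)\<^sup>2))"
  by (cases C) (simp_all add: cv_def power2_eq_square algebra_simps)

lemma weight_generic:
  assumes x: "generic C n x"
  shows "weight C n g0 g1 w x = wt C n g0 (gexp C g1) w x"
proof -
  have ln2: "ln (y\<^sup>2) = 2 * ln \<bar>y\<bar>" if "y \<noteq> 0" for y :: real
    using that ln_realpow[of "\<bar>y\<bar>" 2] by simp
  have d: "cv C x j - cv C x k \<noteq> 0" if "j \<in> {1..n}" "k \<in> {1..n}-{j}" for j k
    using x that unfolding generic_iff by auto
  have x0: "x i \<noteq> 0" if "i \<in> {1..n}" for i
    using x that unfolding generic_iff by auto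
  have "(\<Prod>k\<in>{1..n}. \<Prod>j\<in>{1..<k}. \<bar>cv C x j - cv C x k\<bar> powr (2 * g0))
      = exp (\<Sum>k=1..n. \<Sum>j\<in>{1..<k}. 2 * g0 * ln \<bar>cv C x j - cv C x k\<bar>)"
    unfolding exp_sum[OF finite_atLeastAtMost] exp_sum[OF finite_atLeastLessThan]
  proof (intro prod.cong refl)
    fix k j assume "k \<in> {1..n}" "j \<in> {1..<k}"
    then have "cv C x j - cv C x k \<noteq> 0" by (intro d) auto
    then show "\<bar>cv C x j - cv C x k\<bar> powr (2 * g0) = exp (2 * g0 * ln \<bar>cv C x j - cv C x k\<bar>)"
      by (simp add: powr_def)
  qed
  also have "(\<Sum>k=1..n. \<Sum>j\<in>{1..<k}. 2 * g0 * ln \<bar>cv C x j - cv C x k\<bar>)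
      = g0 * (2 * (\<Sum>k=1..n. \<Sum>j\<in>{1..<k}. ln \<bar>cv C x j - cv C x k\<bar>))"
    by (simp add: sum_distrib_left mult_ac)
  also have "2 * (\<Sum>k=1..n. \<Sum>j\<in>{1..<k}. ln \<bar>cv C x j - cv C x k\<bar>)
      = (\<Sum>i=1..n. \<Sum>k\<in>{1..n}-{i}. ln \<bar>cv C x i - cv C x k\<bar>)"
    by (rule sum_symmetric_pairs[symmetric]) (simp add: abs_minus_commute)
  \<comment> \<open>Each unordered pair occurs twice in the ordered sum and the logarithm of a
    square is twice a logarithm, so g0 / 2 produces the exponent 2 * g0.\<close>
  also have "g0 * \<dots> = g0 / 2 * (\<Sum>i=1..n. \<Sum>k\<in>{1..n}-{i}. ln ((cv C x i - cv C x k)\<^sup>2 + 0))"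
  proof -
    have "(\<Sum>i=1..n. \<Sum>k\<in>{1..n}-{i}. ln ((cv C x i - cv C x k)\<^sup>2 + 0))
        = (\<Sum>i=1..n. \<Sum>k\<in>{1..n}-{i}. 2 * ln \<bar>cv C x i - cv C x k\<bar>)"
      unfolding add_0_right by (intro sum.cong refl ln2 d) auto
    then show ?thesis by (simp add: sum_distrib_left[symmetric])
  qed
  finally have 1: "(\<Prod>k\<in>{1..n}. \<Prod>j\<in>{1..<k}. \<bar>cv C x j - cv C x k\<bar> powr (2 * g0))
      = exp (g0 / 2 * (\<Sum>i=1..n. \<Sum>k\<in>{1..n}-{i}. ln ((cv C x i - cv C x k)\<^sup>2 + 0)))" .
  have 2: "(\<Prod>j\<in>{1..n}. (case C of TypeA \<Rightarrow> 1 | TypeB \<Rightarrow> \<bar>x j\<bar> powr (2 * g1)) * exp (- w * (x j)\<^sup>2))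
      = exp (\<Sum>i=1..n. gexp C g1 * ln ((x i)\<^sup>2 + 0) - w * (x i)\<^sup>2)"
    unfolding exp_sum[OF finite_atLeastAtMost]
  proof (rule prod.cong[OF refl])
    fix i assume "i \<in> {1..n}"
    then have "x i \<noteq> 0" by (rule x0)
    then show "(case C of TypeA \<Rightarrow> 1 | TypeB \<Rightarrow> \<bar>x i\<bar> powr (2 * g1)) * exp (- w * (x i)\<^sup>2)
        = exp (gexp C g1 * ln ((x i)\<^sup>2 + 0) - w * (x i)\<^sup>2)"
      by (cases C) (simp_all add: gexp_def powr_def ln2 exp_diff exp_minus divide_inverse mult_ac)
  qed
  show ?thesis
    unfolding weight_eq 1 2 using x by (simp add: wt_def logW_def exp_add)
qed

lemma weight_measurable: "weight C n g0 g1 w \<in> meas n"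
proof -
  have [measurable]: "(\<lambda>x. cv C x j - cv C x k) \<in> meas n"
    if "k \<in> {1..n}" "j \<in> {1..<k}" for j k
    using that by (intro borel_measurable_diff cv_measurable) auto
  have [measurable]: "(\<lambda>x. x j) \<in> meas n" if "j \<in> {1..n}" for j
    by (rule component_measurable[OF that])
  show ?thesis
    unfolding weight_eq[abs_def] by (cases C) (simp_all, measurable)
qed

section \<open>Orbit sums and their combinations\<close>

definition msym :: "nat \<Rightarrow> (nat \<Rightarrow> nat) \<Rightarrow> point \<Rightarrow> real" where
  "msym n l y = (\<Sum>u\<in>orbit_Sn n l. xpow n u y)"

lemma sym_mono_eq: "sym_mono C n l x = complex_of_real (msym n l (cv C x))"
  by (cases C) (simp_all add: msym_def xpow_def cv_def power_mult)

lemma orbit_expo: "l \<in> expo n \<Longrightarrow> u \<in> orbit_Sn n l \<Longrightarrow> u \<in> expo n"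
  unfolding orbit_Sn_def using comp_permutes_expo by blast

lemma orbit_lower: "l \<in> expo n \<Longrightarrow> u \<in> orbit_Sn n l \<Longrightarrow> u \<in> lower n l"
  unfolding lower_def using orbit_expo dle_permutes(1) by (auto simp: orbit_Sn_def)

lemma msym_lower: "l \<in> expo n \<Longrightarrow> msym n l \<in> pspan n (lower n l)"
  unfolding msym_def by (intro lspan_sum lspan_base orbit_lower)

lemma msym_slower:
  assumes "m \<in> slower n l"
  shows "msym n m \<in> pspan n (slower n l)"
proof (rule lspan_mono[OF msym_lower])
  show "m \<in> expo n" using assms by (simp add: slower_def)
  show "lower n m \<subseteq> slower n l" using slower_lower_trans(2)[OF assms] by blast
qed

lemma msym_polys: "l \<in> expo n \<Longrightarrow> msym n l \<in> polys n"
  by (rule polys_lower[OF msym_lower])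

lemma msym_permute:
  assumes "p permutes {1..n}"
  shows "msym n l (y \<circ> p) = msym n l y"
proof -
  have "bij_betw (\<lambda>u. u \<circ> inv p) (orbit_Sn n l) (orbit_Sn n l)"
  proof (rule bij_betw_byWitness[where f' = "\<lambda>u. u \<circ> p"])
    show "(\<lambda>u. u \<circ> inv p) ` orbit_Sn n l \<subseteq> orbit_Sn n l"
      using permutes_compose[OF permutes_inv[OF assms]] by (fastforce simp: orbit_Sn_def o_assoc[symmetric])
    show "(\<lambda>u. u \<circ> p) ` orbit_Sn n l \<subseteq> orbit_Sn n l"
      using permutes_compose[OF assms] by (fastforce simp: orbit_Sn_def o_assoc[symmetric])
  qed (simp_all add: o_assoc[symmetric] permutes_inv_o[OF assms])
  then show ?thesis
    unfolding msym_def xpow_permute'[OF assms] by (rule sum.reindex_bij_betw)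
qed

lemma msym_measurable: "(\<lambda>x. msym n l (cv C x)) \<in> meas n"
  unfolding msym_def by (intro borel_measurable_sum tame_measurable[OF tame_xpow])

definition msyms :: "nat \<Rightarrow> (nat \<Rightarrow> nat) \<Rightarrow> (nat \<Rightarrow> nat) set" where
  "msyms n l = {m\<in>partitions n. dom_less n m l}"

lemma msyms_slower: "l \<in> partitions n \<Longrightarrow> m \<in> msyms n l \<Longrightarrow> m \<in> slower n l"
  by (auto simp: msyms_def dom_less_iff_slower)

definition comb :: "nat \<Rightarrow> (nat \<Rightarrow> nat) \<Rightarrow> ((nat \<Rightarrow> nat) \<Rightarrow> real) \<Rightarrow> point \<Rightarrow> real" where
  "comb n l d y = (\<Sum>m\<in>msyms n l. d m * msym n m y)"

abbreviation lead :: "nat \<Rightarrow> (nat \<Rightarrow> nat) \<Rightarrow> ((nat \<Rightarrow> nat) \<Rightarrow> real) \<Rightarrow> point \<Rightarrow> real" where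
  "lead n l d y \<equiv> msym n l y + comb n l d y"

lemma comb_slower: "l \<in> partitions n \<Longrightarrow> comb n l d \<in> pspan n (slower n l)"
  unfolding comb_def by (intro lspan_sum lspan_scale msym_slower msyms_slower)

lemma comb_permute: "p permutes {1..n} \<Longrightarrow> comb n l d (y \<circ> p) = comb n l d y"
  by (simp add: comb_def msym_permute)

lemma comb_measurable: "(\<lambda>x. comb n l d (cv C x)) \<in> meas n"
  unfolding comb_def by (intro borel_measurable_sum borel_measurable_times borel_measurable_const msym_measurable)

lemma cv_continuous: "continuous_on UNIV (\<lambda>x::nat \<Rightarrow> real. cv C x i)"
  by (cases C) (auto simp: cv_def intro!: continuous_intros continuous_on_product_coordinates)

lemma comb_continuous: "continuous_on UNIV (\<lambda>x. comb n l d (cv C x))"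
  unfolding comb_def msym_def xpow_def by (intro continuous_intros cv_continuous)

lemma comb_cong: "(\<And>i. i \<in> {1..n} \<Longrightarrow> y i = z i) \<Longrightarrow> comb n l d y = comb n l d z"
  unfolding comb_def msym_def using xpow_cong[of n y z] by simp

text \<open>If f is nonzero at x, continuity in the product topology gives a box around x where f
  does not vanish, and this box has positive measure in the coordinates 1, ..., n.\<close>

lemma AE_zero_imp_zero:
  fixes f :: "point \<Rightarrow> real"
  assumes cont: "continuous_on UNIV f" and cong: "\<And>x y. (\<And>i. i \<in> {1..n} \<Longrightarrow> x i = y i) \<Longrightarrow> f x = f y"
    and AE: "AE x in lebI n. f x = 0"
  shows "f x = 0"
proof (rule ccontr)
  assume nz: "f x \<noteq> 0"
  have "open (f -` (- {0}))"
    using cont by (rule open_vimage[rotated]) auto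
  then have "openin (product_topology (\<lambda>i::nat. euclidean) UNIV) (f -` (- {0}))"
    by (simp add: euclidean_product_topology)
  then obtain X where X: "x \<in> (\<Pi>\<^sub>E i\<in>UNIV. X i)" "\<And>i. openin euclidean (X i)" "(\<Pi>\<^sub>E i\<in>UNIV. X i) \<subseteq> f -` (- {0})"
    using product_topology_open_contains_basis[of "\<lambda>i::nat. (euclidean :: real topology)" UNIV "f -` (- {0})" x] nz
    by auto
  have "\<exists>e>0. {x i - e..x i + e} \<subseteq> X i" for i
  proof -
    have "open (X i)" "x i \<in> X i" using X by (auto simp: PiE_iff)
    then obtain e where "e > 0" "cball (x i) e \<subseteq> X i"
      using open_contains_cball by blast
    then show ?thesis by (auto simp: cball_eq_atLeastAtMost)
  qed
  then obtain e where e: "\<And>i. e i > 0" "\<And>i. {x i - e i..x i + e i} \<subseteq> X i"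
    by metis
  let ?B = "PiE {1..n} (\<lambda>i. {x i - e i..x i + e i})"
  have "f z \<noteq> 0" if "z \<in> ?B" for z
  proof -
    \<comment> \<open>The topology involves all coordinates, the measure only the first n; the
      others are filled in from x, which \<open>cong\<close> permits.\<close>
    let ?z = "\<lambda>i. if i \<in> {1..n} then z i else x i"
    have "?z i \<in> X i" for i
      using PiE_mem[OF that, of i] e(2)[of i] X(1) by (auto simp: PiE_iff)
    then have "?z \<in> (\<Pi>\<^sub>E i\<in>UNIV. X i)" by (intro PiE_I) simp_all
    then have "f ?z \<noteq> 0" using X(3) by blast
    then show ?thesis using cong[of ?z z] by simp
  qed
  then have "AE z in lebI n. z \<notin> ?B"
    using AE by (auto elim: AE_mp)
  moreover have meas: "?B \<in> sets (lebI n)"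
    unfolding lebI_def by (intro sets_PiM_I_finite) auto
  ultimately have "emeasure (lebI n) ?B = 0"
    using AE_iff_measurable[OF meas, of "\<lambda>z. z \<notin> ?B"] sets.sets_into_space[OF meas] by auto
  moreover have "emeasure (lebI n) ?B = (\<Prod>i=1..n. ennreal (2 * e i))"
    unfolding lebI_def using e(1) by (subst lb.emeasure_PiM) (auto simp: less_imp_le)
  moreover have "(\<Prod>i=1..n. ennreal (2 * e i)) \<noteq> 0"
  proof -
    have "ennreal (2 * e i) \<noteq> 0" for i
      using e(1)[of i] by (simp add: ennreal_eq_0_iff)
    then show ?thesis by (simp add: prod_zero_iff)
  qed
  ultimately show False by simp
qed

section \<open>Existence, uniqueness and orthogonality of the polynomials\<close>

locale hermite_laguerre_params =
  fixes C :: wtype and n :: nat and g0 g1 w :: real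
  assumes g0: "g0 \<ge> 0" and g1: "g1 \<ge> 0" and w: "w > 0"
begin

abbreviation "L \<equiv> Lf C n g0 (gexp C g1) w"

lemma gexp_nonneg: "gexp C g1 \<ge> 0"
  using g1 by (cases C) (auto simp: gexp_def)

sublocale dunkl_form n g0 L "bfac C 0 / (2 * w)" "(bfac C 1 - bfac C 0) / (2 * w)" "(tdelta C - 2 * gexp C g1) / (2 * w)"
  by (rule dunkl_form_Lf) (use g0 gexp_nonneg w in \<open>auto simp: gexp_def\<close>)

text \<open>The functional L is real, so complex polynomials are carried as real and imaginary
  parts; \<open>weight\<close> and \<open>wt\<close> agree almost everywhere.\<close>

lemma inner_prod_eq:
  assumes P: "f \<in> polys n" "f' \<in> polys n" "h \<in> polys n" "h' \<in> polys n"
    and [measurable]: "(\<lambda>x. f (cv C x)) \<in> meas n" "(\<lambda>x. f' (cv C x)) \<in> meas n"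
      "(\<lambda>x. h (cv C x)) \<in> meas n" "(\<lambda>x. h' (cv C x)) \<in> meas n"
  shows "inner_prod C n g0 g1 w (\<lambda>x. Complex (f (cv C x)) (f' (cv C x))) (\<lambda>x. Complex (h (cv C x)) (h' (cv C x)))
    = Complex (ip f h + ip f' h') (ip f' h - ip f h')"
proof -
  note [measurable] = weight_measurable
  let ?w = "wt C n g0 (gexp C g1) w"
  let ?F = "\<lambda>x. Complex (f (cv C x)) (f' (cv C x)) * cnj (Complex (h (cv C x)) (h' (cv C x)))"
  have F: "?F x * complex_of_real v = complex_of_real (f (cv C x) * h (cv C x) * v + f' (cv C x) * h' (cv C x) * v)
      + \<i> * complex_of_real (f' (cv C x) * h (cv C x) * v - f (cv C x) * h' (cv C x) * v)" for x v
    by (simp add: complex_eq_iff algebra_simps)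
  have int: "integrable (lebI n) (\<lambda>x. a (cv C x) * b (cv C x) * ?w x)" if "a \<in> polys n" "b \<in> polys n" for a b
    using integrable_wt[OF polys_mult[OF that] g0 gexp_nonneg w, of C] .
  have "inner_prod C n g0 g1 w (\<lambda>x. Complex (f (cv C x)) (f' (cv C x))) (\<lambda>x. Complex (h (cv C x)) (h' (cv C x)))
      = (LINT x|lebI n. ?F x * complex_of_real (weight C n g0 g1 w x))"
    by (simp add: inner_prod_def lebI_def)
  also have "\<dots> = (LINT x|lebI n. ?F x * complex_of_real (?w x))"
  proof (rule integral_cong_AE)
    show "(\<lambda>x. ?F x * complex_of_real (weight C n g0 g1 w x)) \<in> meas n"
      unfolding F by measurable
    show "(\<lambda>x. ?F x * complex_of_real (?w x)) \<in> meas n"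
      unfolding F by measurable
    show "AE x in lebI n. ?F x * complex_of_real (weight C n g0 g1 w x) = ?F x * complex_of_real (?w x)"
      using AE_generic[of C n] by (rule AE_mp) (auto simp: weight_generic)
  qed
  also have "\<dots> = complex_of_real (LINT x|lebI n. f (cv C x) * h (cv C x) * ?w x + f' (cv C x) * h' (cv C x) * ?w x)
      + \<i> * complex_of_real (LINT x|lebI n. f' (cv C x) * h (cv C x) * ?w x - f (cv C x) * h' (cv C x) * ?w x)"
    unfolding F integral_complex_of_real[symmetric] integral_mult_right_zero[symmetric]
    by (intro Bochner_Integration.integral_add integrable_mult_right integrable_of_real
        Bochner_Integration.integrable_add Bochner_Integration.integrable_diff int P)
  also have "\<dots> = complex_of_real (ip f h + ip f' h')
      + \<i> * complex_of_real (ip f' h - ip f h')"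
    unfolding Lf_def
    by (simp only: Bochner_Integration.integral_add[OF int[OF P(1,3)] int[OF P(2,4)]]
      Bochner_Integration.integral_diff[OF int[OF P(2,3)] int[OF P(1,4)]])
  finally show ?thesis
    by (simp add: complex_eq_iff)
qed

text \<open>A symmetric f pairs equally with all monomials of an orbit, so its pairing with the
  orbit sum is the orbit size times each of them. This passes from the symmetric conditions of the
  definition to those of \<open>orthogonal_incomparable\<close>.\<close>

lemma L_msym_imp_L_xpow:
  assumes l: "l \<in> partitions n" and f: "f \<in> polys n"
    and sym: "\<And>p y. p permutes {1..n} \<Longrightarrow> f (y \<circ> p) = f y"
    and orth: "\<And>m. m \<in> msyms n l \<Longrightarrow> ip f (msym n m) = 0"
    and v: "v \<in> slower n l"
  shows "ip f (xpow n v) = 0"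
proof -
  obtain k p where k: "k \<in> partitions n" "p permutes {1..n}" "v = k \<circ> p"
    using sorted_permutation[of v n] v by (auto simp: slower_def)
  have kE: "k \<in> expo n" using k(1) partitions_expo by blast
  have "k = v \<circ> inv p"
    using k(3) permutes_inv_o(1)[OF k(2)] by (simp add: o_assoc[symmetric])
  then have "k \<in> slower n l"
    using slower_permute[OF permutes_inv[OF k(2)] v] by simp
  then have "k \<in> msyms n l"
    using k(1) l by (simp add: msyms_def dom_less_iff_slower)
  then have 0: "ip f (msym n k) = 0" by (rule orth)
  have same: "ip f (xpow n u) = ip f (xpow n k)" if u: "u \<in> orbit_Sn n k" for u
  proof -
    obtain t where t: "t permutes {1..n}" "u = k \<circ> t"
      using u unfolding orbit_Sn_def by blast
    have "u \<in> expo n" using u kE by (rule orbit_expo[rotated])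
    then have "(\<lambda>y. f y * xpow n u y) \<in> polys n"
      using f by (intro polys_mult lspan_base)
    then have "L (\<lambda>y. f (y \<circ> t) * xpow n u (y \<circ> t)) = ip f (xpow n u)"
      by (rule L_permute[OF t(1)])
    then show ?thesis
      by (simp add: sym[OF t(1)] t(2) xpow_permute[OF t(1)])
  qed
  have "ip f (msym n k) = (\<Sum>u\<in>orbit_Sn n k. ip f (xpow n u))"
    unfolding msym_def sum_distrib_left
    by (intro L_sum finite_orbit_Sn polys_mult f lspan_base orbit_expo[OF kE])
  also have "\<dots> = real (card (orbit_Sn n k)) * ip f (xpow n k)"
    by (simp add: same)
  finally have "real (card (orbit_Sn n k)) * ip f (xpow n k) = 0"
    using 0 by simp
  moreover have "v \<in> orbit_Sn n k" using k by (auto simp: orbit_Sn_def)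
  moreover from this have "card (orbit_Sn n k) \<noteq> 0"
    using finite_orbit_Sn[of n k] by auto
  ultimately show ?thesis using same[of v] by simp
qed

text \<open>The weight is positive at generic points, so a null combination vanishes almost
  everywhere and, being continuous, everywhere. This definiteness serves the uniqueness required by
  \<open>THE\<close>.\<close>

lemma L_definite:
  assumes l: "l \<in> partitions n" and zero: "ip (comb n l d) (comb n l d) = 0"
  shows "comb n l d (cv C x) = 0"
proof -
  let ?f = "\<lambda>x. comb n l d (cv C x)" and ?w = "wt C n g0 (gexp C g1) w"
  have P: "comb n l d \<in> polys n" by (rule polys_slower[OF comb_slower[OF l]])
  have int: "integrable (lebI n) (\<lambda>x. ?f x * ?f x * ?w x)"
    using integrable_wt[OF polys_mult[OF P P] g0 gexp_nonneg w, of C] .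
  have "AE x in lebI n. ?f x * ?f x * ?w x = 0"
    using zero integral_nonneg_eq_0_iff_AE[OF int] by (simp add: Lf_def wt_nonneg)
  then have "AE x in lebI n. ?f x = 0"
    using AE_generic[of C n] by (auto simp: wt_def elim: AE_mp)
  moreover have "?f x = ?f y" if "\<And>i. i \<in> {1..n} \<Longrightarrow> x i = y i" for x y
    using that by (intro comb_cong) (simp add: cv_def)
  ultimately show ?thesis
    using AE_zero_imp_zero[OF comb_continuous] by blast
qed

lemma hl_form:
  "(\<lambda>x. sym_mono C n l x + (\<Sum>m\<in>{m\<in>partitions n. dom_less n m l}. c m * sym_mono C n m x))
    = (\<lambda>x. Complex (msym n l (cv C x) + comb n l (\<lambda>m. Re (c m)) (cv C x)) (comb n l (\<lambda>m. Im (c m)) (cv C x)))"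
  by (simp add: fun_eq_iff complex_eq_iff sym_mono_eq comb_def msyms_def)

lemma inner_prod_sym_mono:
  assumes l: "l \<in> partitions n" and m: "m \<in> partitions n"
  shows "inner_prod C n g0 g1 w (\<lambda>x. Complex (lead n l d (cv C x)) (comb n l d' (cv C x))) (sym_mono C n m)
    = Complex (ip (lead n l d) (msym n m)) (ip (comb n l d') (msym n m))"
proof -
  have s: "sym_mono C n m = (\<lambda>x. Complex (msym n m (cv C x)) ((\<lambda>_. 0) (cv C x)))"
    by (simp add: fun_eq_iff complex_eq_iff sym_mono_eq)
  have E: "l \<in> expo n" "m \<in> expo n"
    using l m partitions_expo by blast+
  have P: "(\<lambda>y. msym n l y + comb n l d y) \<in> polys n" "comb n l d' \<in> polys n" "msym n m \<in> polys n"
    using polys_slower[OF comb_slower[OF l]] E by (auto intro!: lspan_add msym_polys)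
  have z: "L (\<lambda>y. 0) = 0" by (rule L_zero) simp
  show ?thesis
    unfolding s
    by (subst inner_prod_eq[OF P polys_const])
      (auto intro!: borel_measurable_add msym_measurable comb_measurable simp: z)
qed

definition hl_poly :: "(nat \<Rightarrow> nat) \<Rightarrow> ((nat \<Rightarrow> nat) \<Rightarrow> real) \<Rightarrow> ((nat \<Rightarrow> nat) \<Rightarrow> real) \<Rightarrow> point \<Rightarrow> complex" where
  "hl_poly l d d' x = Complex (lead n l d (cv C x)) (comb n l d' (cv C x))"

definition orthogonal_coeffs :: "(nat \<Rightarrow> nat) \<Rightarrow> ((nat \<Rightarrow> nat) \<Rightarrow> real) \<Rightarrow> ((nat \<Rightarrow> nat) \<Rightarrow> real) \<Rightarrow> bool" where
  "orthogonal_coeffs l d d' \<longleftrightarrow> (\<forall>m\<in>msyms n l.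
     ip (lead n l d) (msym n m) = 0 \<and> ip (comb n l d') (msym n m) = 0)"

lemma is_hermite_laguerre_iff:
  assumes l: "l \<in> partitions n"
  shows "is_hermite_laguerre C n g0 g1 w l p \<longleftrightarrow> (\<exists>d d'. p = hl_poly l d d' \<and> orthogonal_coeffs l d d')"
proof -
  have form: "(\<exists>c. p = (\<lambda>x. sym_mono C n l x + (\<Sum>m\<in>{m\<in>partitions n. dom_less n m l}. c m * sym_mono C n m x)))
      \<longleftrightarrow> (\<exists>d d'. p = hl_poly l d d')"
  proof
    assume "\<exists>d d'. p = hl_poly l d d'"
    then obtain d d' where "p = hl_poly l d d'" by blast
    then show "\<exists>c. p = (\<lambda>x. sym_mono C n l x + (\<Sum>m\<in>{m\<in>partitions n. dom_less n m l}. c m * sym_mono C n m x))"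
      unfolding hl_form by (intro exI[of _ "\<lambda>m. Complex (d m) (d' m)"]) (simp add: hl_poly_def fun_eq_iff)
  qed (auto simp: hl_form hl_poly_def fun_eq_iff)
  have ip: "inner_prod C n g0 g1 w (hl_poly l d d') (sym_mono C n m) = 0 \<longleftrightarrow>
      ip (lead n l d) (msym n m) = 0 \<and> ip (comb n l d') (msym n m) = 0"
    if "m \<in> msyms n l" for d d' m
    using inner_prod_sym_mono[OF l, of m d d'] that
    by (simp add: hl_poly_def[abs_def] msyms_def complex_eq_iff)
  have "is_hermite_laguerre C n g0 g1 w l p \<longleftrightarrow> (\<exists>d d'. p = hl_poly l d d' \<and>
      (\<forall>m\<in>msyms n l. inner_prod C n g0 g1 w (hl_poly l d d') (sym_mono C n m) = 0))"
    unfolding is_hermite_laguerre_def form msyms_def by fastforce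
  then show ?thesis by (simp add: ip orthogonal_coeffs_def)
qed

lemma hl_exists_unique:
  assumes l: "l \<in> partitions n"
  shows "\<exists>!p. is_hermite_laguerre C n g0 g1 w l p"
proof (rule ex_ex1I)
  have E: "l \<in> expo n" using l partitions_expo by blast
  have fin: "finite (msyms n l)" unfolding msyms_def by (rule finite_dom_less)
  have mE: "m \<in> expo n" if "m \<in> msyms n l" for m
    using that partitions_expo by (auto simp: msyms_def)
  show "\<exists>p. is_hermite_laguerre C n g0 g1 w l p"
  proof -
    obtain v where v: "v \<in> lspan n (msym n) (msyms n l)"
        "\<And>m. m \<in> msyms n l \<Longrightarrow> L (\<lambda>y. (msym n l y - v y) * msym n m y) = 0"
      using orthogonal_projection[of "msyms n l" "msym n" "msym n l", OF fin msym_polys[OF mE] msym_polys[OF E]]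
      by blast
    obtain d where d: "\<And>y. inj_on y {1..n} \<Longrightarrow> v y = (\<Sum>m\<in>msyms n l. d m * msym n m y)"
      using lspan_finite[OF v(1) fin] by blast
    \<comment> \<open>The projection coefficients enter with the opposite sign; since L is real, the
      imaginary coefficients can be taken to be 0.\<close>
    have "L (\<lambda>y. lead n l (\<lambda>m. - d m) y * msym n m y) = 0" if "m \<in> msyms n l" for m
    proof -
      have "L (\<lambda>y. lead n l (\<lambda>m. - d m) y * msym n m y) = L (\<lambda>y. (msym n l y - v y) * msym n m y)"
        by (rule L_cong) (simp add: comb_def d sum_negf)
      then show ?thesis using v(2)[OF that] by simp
    qed
    moreover have "L (\<lambda>y. comb n l (\<lambda>m. 0) y * msym n m y) = 0" for m
      by (rule L_zero) (simp add: comb_def)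
    ultimately have "orthogonal_coeffs l (\<lambda>m. - d m) (\<lambda>m. 0)"
      by (simp add: orthogonal_coeffs_def)
    then show ?thesis
      unfolding is_hermite_laguerre_iff[OF l] by blast
  qed
  fix p q assume "is_hermite_laguerre C n g0 g1 w l p" "is_hermite_laguerre C n g0 g1 w l q"
  then obtain d d' e e' where pq: "p = hl_poly l d d'" "q = hl_poly l e e'"
    and "orthogonal_coeffs l d d'" "orthogonal_coeffs l e e'"
    unfolding is_hermite_laguerre_iff[OF l] by blast
  then have p0: "\<And>m. m \<in> msyms n l \<Longrightarrow> ip (lead n l d) (msym n m) = 0"
      "\<And>m. m \<in> msyms n l \<Longrightarrow> ip (comb n l d') (msym n m) = 0"
    and q0: "\<And>m. m \<in> msyms n l \<Longrightarrow> ip (lead n l e) (msym n m) = 0"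
      "\<And>m. m \<in> msyms n l \<Longrightarrow> ip (comb n l e') (msym n m) = 0"
    unfolding orthogonal_coeffs_def by blast+
  have cP: "comb n l d \<in> polys n" for d by (rule polys_slower[OF comb_slower[OF l]])
  have diff: "comb n l (\<lambda>m. d m - d' m) y = comb n l d y - comb n l d' y" for d d' y
    by (simp add: comb_def left_diff_distrib sum_subtractf)
  \<comment> \<open>Two solutions of the same conditions differ by a combination orthogonal to all
    its own summands, hence null. The real parts use h = \<open>msym n l\<close>, the imaginary
    parts h = 0.\<close>
  have unique: "comb n l d (cv C x) = comb n l d' (cv C x)"
    if h: "h \<in> polys n" and dh: "\<And>m. m \<in> msyms n l \<Longrightarrow> L (\<lambda>y. (h y + comb n l d y) * msym n m y) = 0"
      "\<And>m. m \<in> msyms n l \<Longrightarrow> L (\<lambda>y. (h y + comb n l d' y) * msym n m y) = 0" for d d' h x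
  proof -
    let ?r = "comb n l (\<lambda>m. d m - d' m)"
    have r0: "ip ?r (msym n m) = 0" if m: "m \<in> msyms n l" for m
    proof -
      have "L (\<lambda>y. ((h y + comb n l d y) + (-1) * (h y + comb n l d' y)) * msym n m y) = 0 + (-1) * 0"
        using L_lincomb[OF lspan_add[OF cP h] lspan_add[OF cP h] msym_polys[OF mE[OF m]], of d "-1" d'] dh[OF m]
        by simp
      then show ?thesis by (simp add: diff)
    qed
    have "L (\<lambda>y. ?r y * (\<Sum>m\<in>msyms n l. (d m - d' m) * msym n m y)) = 0"
      by (rule L_lspan_zero[of _ "msym n" "msyms n l", OF _ cP msym_polys[OF mE] r0])
        (intro lspan_sum lspan_scale lspan_base)
    then have "?r (cv C x) = 0"
      by (intro L_definite[OF l]) (simp add: comb_def)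
    then show ?thesis by (simp add: diff)
  qed
  have "comb n l d (cv C x) = comb n l e (cv C x)" for x
    by (rule unique[OF msym_polys[OF E] p0(1) q0(1)])
  moreover have "comb n l d' (cv C x) = comb n l e' (cv C x)" for x
    by (rule unique[OF polys_const[of 0]]) (simp_all add: p0(2) q0(2))
  ultimately show "p = q"
    unfolding pq by (simp add: hl_poly_def fun_eq_iff)
qed

lemma hermite_laguerre_parts:
  assumes l: "l \<in> partitions n"
  shows "\<exists>d d'. hermite_laguerre C n g0 g1 w l = hl_poly l d d' \<and> (\<forall>v\<in>slower n l.
    ip (lead n l d) (xpow n v) = 0 \<and> ip (comb n l d') (xpow n v) = 0)"
proof -
  have "is_hermite_laguerre C n g0 g1 w l (hermite_laguerre C n g0 g1 w l)"
    unfolding hermite_laguerre_def by (rule theI'[OF hl_exists_unique[OF l]])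
  then obtain d d' where p: "hermite_laguerre C n g0 g1 w l = hl_poly l d d'"
    and "orthogonal_coeffs l d d'"
    unfolding is_hermite_laguerre_iff[OF l] by blast
  then have p0: "\<And>m. m \<in> msyms n l \<Longrightarrow> ip (lead n l d) (msym n m) = 0"
      "\<And>m. m \<in> msyms n l \<Longrightarrow> ip (comb n l d') (msym n m) = 0"
    unfolding orthogonal_coeffs_def by blast+
  have cP: "comb n l d \<in> polys n" for d by (rule polys_slower[OF comb_slower[OF l]])
  have P: "(\<lambda>y. msym n l y + comb n l d y) \<in> polys n"
    by (rule lspan_add[OF cP msym_polys[OF subsetD[OF partitions_expo l]]])
  show ?thesis
  proof (rule exI[of _ d], rule exI[of _ d'], rule conjI[OF p], intro ballI conjI)
    fix v assume v: "v \<in> slower n l"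
    show "ip (lead n l d) (xpow n v) = 0"
      by (rule L_msym_imp_L_xpow[OF l P _ p0(1) v]) (simp_all add: msym_permute comb_permute)
    show "ip (comb n l d') (xpow n v) = 0"
      by (rule L_msym_imp_L_xpow[OF l cP _ p0(2) v]) (simp_all add: comb_permute)
  qed
qed

text \<open>The pairing splits into four real ones between real and imaginary parts. Each part lies
  in the lower span of its index and is orthogonal to the smaller monomials, so
  \<open>orthogonal_incomparable\<close> applies to all four.\<close>

lemma hermite_laguerre_orthogonal:
  assumes l: "l \<in> partitions n" and m: "m \<in> partitions n" and "l \<noteq> m"
  shows "inner_prod C n g0 g1 w (hermite_laguerre C n g0 g1 w l) (hermite_laguerre C n g0 g1 w m) = 0"
proof -
  have lowerI: "comb n q d \<in> pspan n (lower n q)" if "q \<in> partitions n" for q d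
    by (rule lspan_mono[OF comb_slower[OF that] slower_lower])
  have lowerR: "(\<lambda>y. msym n q y + comb n q d y) \<in> pspan n (lower n q)"
    if "q \<in> partitions n" for q d
    by (rule lspan_add[OF lowerI[OF that] msym_lower[OF subsetD[OF partitions_expo that]]])
  have ne: "\<not> (dle n l m \<and> dle n m l)"
    using dle_partitions_antisym assms by blast
  obtain d d' where p0: "hermite_laguerre C n g0 g1 w l = hl_poly l d d' \<and> (\<forall>v\<in>slower n l.
    ip (lead n l d) (xpow n v) = 0 \<and> ip (comb n l d') (xpow n v) = 0)"
    using hermite_laguerre_parts[OF l] by blast
  obtain e e' where q0: "hermite_laguerre C n g0 g1 w m = hl_poly m e e' \<and> (\<forall>v\<in>slower n m.
    L (\<lambda>y. lead n m e y * xpow n v y) = 0 \<and> L (\<lambda>y. comb n m e' y * xpow n v y) = 0)"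
    using hermite_laguerre_parts[OF m] by blast
  note p = conjunct1[OF p0] bspec[OF conjunct2[OF p0], THEN conjunct1] bspec[OF conjunct2[OF p0], THEN conjunct2]
  note q = conjunct1[OF q0] bspec[OF conjunct2[OF q0], THEN conjunct1] bspec[OF conjunct2[OF q0], THEN conjunct2]
  note R = lowerR[OF l, of d] lowerI[OF l, of d'] lowerR[OF m, of e] lowerI[OF m, of e']
  note Z = orthogonal_incomparable[OF R(1) p(2) R(3) q(2) ne] orthogonal_incomparable[OF R(1) p(2) R(4) q(3) ne]
    orthogonal_incomparable[OF R(2) p(3) R(3) q(2) ne] orthogonal_incomparable[OF R(2) p(3) R(4) q(3) ne]
  show ?thesis
    unfolding p(1) q(1) hl_poly_def[abs_def]
    by (subst inner_prod_eq[OF R[THEN polys_lower]])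
      (simp_all add: Z borel_measurable_add msym_measurable comb_measurable complex_eq_iff)
qed

end

theorem theorem2p1:
  fixes C :: wtype and n :: nat and g0 g1 \<omega> :: real and \<nu> \<mu> :: "nat \<Rightarrow> nat"
  assumes "n \<ge> 1" and "g0 \<ge> 0" and "g1 \<ge> 0" and "\<omega> > 0"
    and "\<nu> \<in> partitions n" and "\<mu> \<in> partitions n" and "\<nu> \<noteq> \<mu>"
  shows "inner_prod C n g0 g1 \<omega>
           (hermite_laguerre C n g0 g1 \<omega> \<nu>) (hermite_laguerre C n g0 g1 \<omega> \<mu>) = 0"
proof -
  interpret hermite_laguerre_params C n g0 g1 \<omega>
    using assms by unfold_locales
  show ?thesis
    using assms by (intro hermite_laguerre_orthogonal)
qed

end
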